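(* Let $\Omega\subset\mathbb{R}^d$ ($d\ge 2$) be a bounded connected open set and let $\phi\in C(\partial\Omega)$. Then there exist a harmonic function $u$ on $\Omega$ and a function $\Phi\in C(\overline{\Omega})$ with $\Phi|_{\partial\Omega}=\phi$ such that $\Phi-u\in H^1_0(\Omega)$. Moreover, $u$ is unique: if $u_1,u_2$ are harmonic on $\Omega$ and $\Phi_1,\Phi_2\in C(\overline{\Omega})$ satisfy $\Phi_1|_{\partial\Omega}=\Phi_2|_{\partial\Omega}=\phi$ and $\Phi_i-u_i\in H^1_0(\Omega)$ for $i=1,2$, then $u_1=u_2$.
   Context: $H^1(\Omega)$ is the Sobolev space of $L^2$ functions with distributional gradient in $L^2$; $H^1_0(\Omega)$ is the closure of $C_c^\infty(\Omega)$ in $H^1(\Omega)$. For $\Phi\in L^1_{\mathrm{loc}}(\Omega)$ we write $\Delta\Phi\in H^{-1}(\Omega)$ if there exists $M\ge 0$ with $\left|\int_\Omega \Phi\,\Delta w\,dx\right|\le M\|w\|_{H^1(\Omega)}$ for all $w\in C_c^\infty(\Omega)$. The following known extension result (Arendt–ter Elst–Sauter) may be used: for every $\phi\in C(\partial\Omega)$ there exists an extension $\Phi\in C(\overline{\Omega})$ of $\phi$ with $\Delta\Phi\in H^{-1}(\Omega)$. *)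

theory Defs
  imports "HOL-Analysis.Analysis"
begin

definition dderiv :: "'a::euclidean_space \<Rightarrow> ('a \<Rightarrow> real) \<Rightarrow> 'a \<Rightarrow> real" where
  "dderiv v f = (\<lambda>x. frechet_derivative f (at x) v)"

fun iter_dderiv :: "'a::euclidean_space list \<Rightarrow> ('a \<Rightarrow> real) \<Rightarrow> 'a \<Rightarrow> real" where
  "iter_dderiv [] f = f"
| "iter_dderiv (v # vs) f = dderiv v (iter_dderiv vs f)"

definition smooth_fun :: "('a::euclidean_space \<Rightarrow> real) \<Rightarrow> bool" where
  "smooth_fun f \<longleftrightarrow> (\<forall>vs x. iter_dderiv vs f differentiable at x)"

definition test_fun :: "'a::euclidean_space set \<Rightarrow> ('a \<Rightarrow> real) \<Rightarrow> bool" where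
  "test_fun \<Omega> w \<longleftrightarrow> smooth_fun w \<and> compact (closure {x. w x \<noteq> 0})
       \<and> closure {x. w x \<noteq> 0} \<subseteq> \<Omega>"

definition grad :: "('a::euclidean_space \<Rightarrow> real) \<Rightarrow> 'a \<Rightarrow> 'a" where
  "grad f x = (\<Sum>i\<in>Basis. dderiv i f x *\<^sub>R i)"

definition L2_on :: "'a::euclidean_space set \<Rightarrow> ('a \<Rightarrow> real) \<Rightarrow> bool" where
  "L2_on \<Omega> f \<longleftrightarrow> f \<in> borel_measurable (lebesgue_on \<Omega>)
      \<and> integrable (lebesgue_on \<Omega>) (\<lambda>x. (f x)\<^sup>2)"

definition L2_vec_on :: "'a::euclidean_space set \<Rightarrow> ('a \<Rightarrow> 'a) \<Rightarrow> bool" where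
  "L2_vec_on \<Omega> g \<longleftrightarrow> (\<forall>i\<in>Basis. L2_on \<Omega> (\<lambda>x. g x \<bullet> i))"

definition weak_gradient :: "'a::euclidean_space set \<Rightarrow> ('a \<Rightarrow> real) \<Rightarrow> ('a \<Rightarrow> 'a) \<Rightarrow> bool" where
  "weak_gradient \<Omega> f g \<longleftrightarrow>
     (\<forall>w. test_fun \<Omega> w \<longrightarrow> (\<forall>i\<in>Basis.
        integral\<^sup>L (lebesgue_on \<Omega>) (\<lambda>x. f x * dderiv i w x)
        = - integral\<^sup>L (lebesgue_on \<Omega>) (\<lambda>x. (g x \<bullet> i) * w x)))"

definition H1 :: "'a::euclidean_space set \<Rightarrow> ('a \<Rightarrow> real) \<Rightarrow> bool" where
  "H1 \<Omega> f \<longleftrightarrow> L2_on \<Omega> f \<and> (\<exists>g. L2_vec_on \<Omega> g \<and> weak_gradient \<Omega> f g)"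

definition H1_0 :: "'a::euclidean_space set \<Rightarrow> ('a \<Rightarrow> real) \<Rightarrow> bool" where
  "H1_0 \<Omega> f \<longleftrightarrow> L2_on \<Omega> f \<and> (\<exists>g. L2_vec_on \<Omega> g \<and> weak_gradient \<Omega> f g \<and>
     (\<exists>\<psi>::nat \<Rightarrow> 'a \<Rightarrow> real. (\<forall>n. test_fun \<Omega> (\<psi> n)) \<and>
        ((\<lambda>n. integral\<^sup>L (lebesgue_on \<Omega>) (\<lambda>x. (\<psi> n x - f x)\<^sup>2)
             + integral\<^sup>L (lebesgue_on \<Omega>) (\<lambda>x. (norm (grad (\<psi> n) x - g x))\<^sup>2))
          \<longlonglongrightarrow> 0)))"

definition harmonic_on :: "'a::euclidean_space set \<Rightarrow> ('a \<Rightarrow> real) \<Rightarrow> bool" where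
  "harmonic_on \<Omega> u \<longleftrightarrow>
     (\<forall>x\<in>\<Omega>. u differentiable at x) \<and>
     (\<forall>i\<in>Basis. \<forall>x\<in>\<Omega>. dderiv i u differentiable at x) \<and>
     (\<forall>i\<in>Basis. \<forall>j\<in>Basis. continuous_on \<Omega> (dderiv j (dderiv i u))) \<and>
     (\<forall>x\<in>\<Omega>. (\<Sum>i\<in>Basis. dderiv i (dderiv i u) x) = 0)"

end

theory Submission
  imports Defs "HOL-Real_Asymp.Real_Asymp"
begin

text \<open>
  Existence. By Stone--Weierstrass the boundary datum is a rapidly convergent series of polynomials.
  Each polynomial is corrected inside \<open>\<Omega>\<close> by a test function to a near-minimiser of the Dirichlet
  energy; truncation keeps it as small as its boundary values without increasing the energy. The sum
  \<open>\<Phi>\<close> of the corrected terms is continuous and \<open>\<Delta>\<Phi>\<close> is bounded for the Dirichlet norm, so Dirichlet's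
  principle yields \<open>h\<close> in the closure of the test functions with \<open>\<Phi> - h\<close> weakly harmonic, and Weyl's
  lemma makes \<open>\<Phi> - h\<close> harmonic.

  Weyl's lemma. For a radial kernel the derivative of the mean with respect to its scale is, up to a
  multiple of the mean itself, the integral against the Laplacian of a test function. Hence the
  normalised means do not depend on the scale, and they converge to the function.

  Uniqueness. Let \<open>\<Psi> = u + w\<close> with \<open>\<Psi>\<close> continuous and zero on the boundary, \<open>u\<close> harmonic and \<open>w\<close> a
  limit of test functions. Truncating \<open>\<Psi>\<close> near zero gives compactly supported functions converging
  to \<open>\<Psi>\<close> whose Dirichlet energy is asymptotically at most that of \<open>w\<close>. As \<open>\<Delta>\<Psi> = \<Delta>w\<close>, their
  gradients converge weakly, hence by the energy bound strongly, to that of \<open>w\<close>, and Poincare's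
  inequality gives \<open>\<Psi> = w\<close>.
\<close>

section \<open>Square-integrable functions\<close>

text \<open>Continuous boundary values may have no extension of finite energy, so neither
  \<open>\<Phi>\<close> nor \<open>u\<close> can be expected in \<open>H1\<close>, and minimising
  the energy over all extensions is not an option. Dirichlet's principle is applied instead to the
  functional sending w to the integral of \<Phi> \<Delta>w: its bound by the Dirichlet norm survives
  the summation of infinitely many terms even if their energies do not. The frontier is an arbitrary
  compact set: there are no traces or barriers, and \<open>u\<close> need not attain the values
  \<phi> at the frontier, so the maximum principle cannot compare two solutions. Uniqueness is
  therefore an energy argument, and as \<open>u\<close> may have infinite energy, it is only ever
  tested against functions of compact support. Minimisers are replaced by test functions whose
  energy is within e^2 of the infimum. A discriminant shows that these are critical up to an error
  e, which is all that is used, and it keeps the truncations inside the smooth functions.\<close>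

definition square_integrable :: "'x measure \<Rightarrow> ('x \<Rightarrow> 'b::euclidean_space) \<Rightarrow> bool" where
  "square_integrable M f \<longleftrightarrow> f \<in> borel_measurable M \<and> integrable M (\<lambda>x. (norm (f x))\<^sup>2)"

definition l2_inner :: "'x measure \<Rightarrow> ('x \<Rightarrow> 'b::euclidean_space) \<Rightarrow> ('x \<Rightarrow> 'b) \<Rightarrow> real" where
  "l2_inner M f g = (\<integral>x. f x \<bullet> g x \<partial>M)"

text \<open>Only a seminorm, since functions are not identified modulo null sets;
  \<open>l2_norm_eq_0_AE\<close> says what its vanishing means.\<close>

definition l2_norm :: "'x measure \<Rightarrow> ('x \<Rightarrow> 'b::euclidean_space) \<Rightarrow> real" where
  "l2_norm M f = sqrt (l2_inner M f f)"

lemma square_integrable_measurable: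
  "square_integrable M f \<Longrightarrow> f \<in> borel_measurable M"
  by (simp add: square_integrable_def)

lemma square_integrable_inner:
  assumes "square_integrable M f" "square_integrable M g"
  shows "integrable M (\<lambda>x. f x \<bullet> g x)"
proof (rule Bochner_Integration.integrable_bound)
  show "integrable M (\<lambda>x. (norm (f x))\<^sup>2 + (norm (g x))\<^sup>2)"
    using assms by (simp add: square_integrable_def)
  show "(\<lambda>x. f x \<bullet> g x) \<in> borel_measurable M"
    using assms[THEN square_integrable_measurable] by measurable
  have "\<bar>f x \<bullet> g x\<bar> \<le> (norm (f x))\<^sup>2 + (norm (g x))\<^sup>2" for x
  proof -
    have "\<bar>f x \<bullet> g x\<bar> \<le> norm (f x) * norm (g x)" by (rule Cauchy_Schwarz_ineq2)
    also have "\<dots> \<le> (norm (f x))\<^sup>2 + (norm (g x))\<^sup>2"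
    proof -
      have "0 \<le> norm (f x) * norm (g x)" by simp
      then show ?thesis using sum_squares_bound[of "norm (f x)" "norm (g x)"] by linarith
    qed
    finally show ?thesis .
  qed
  then show "AE x in M. norm (f x \<bullet> g x) \<le> norm ((norm (f x))\<^sup>2 + (norm (g x))\<^sup>2)"
    by (auto intro!: AE_I2 order_trans[OF _ abs_ge_self])
qed

lemma square_integrable_zero [simp]: "square_integrable M (\<lambda>x. 0)"
  by (simp add: square_integrable_def)

lemma square_integrable_scaleR:
  "square_integrable M f \<Longrightarrow> square_integrable M (\<lambda>x. c *\<^sub>R f x)"
  by (auto simp: square_integrable_def power_mult_distrib)

lemma square_integrable_minus:
  "square_integrable M f \<Longrightarrow> square_integrable M (\<lambda>x. - f x)"
  by (auto simp: square_integrable_def)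

lemma square_integrable_add:
  assumes "square_integrable M f" "square_integrable M g"
  shows "square_integrable M (\<lambda>x. f x + g x)"
proof -
  have "(norm (f x + g x))\<^sup>2 = (norm (f x))\<^sup>2 + (norm (g x))\<^sup>2 + 2 * (f x \<bullet> g x)" for x
    by (simp add: power2_norm_eq_inner inner_simps inner_commute)
  then show ?thesis
    using assms square_integrable_inner[OF assms] by (auto simp: square_integrable_def)
qed

lemma square_integrable_diff:
  assumes "square_integrable M f" "square_integrable M g"
  shows "square_integrable M (\<lambda>x. f x - g x)"
  using square_integrable_add[OF assms(1) square_integrable_minus[OF assms(2)]] by simp

lemma l2_inner_commute: "l2_inner M f g = l2_inner M g f"
  by (simp add: l2_inner_def inner_commute)

lemma l2_inner_add_left:
  "\<lbrakk>square_integrable M f; square_integrable M g; square_integrable M h\<rbrakk> \<Longrightarrow>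
    l2_inner M (\<lambda>x. f x + g x) h = l2_inner M f h + l2_inner M g h"
  by (simp add: l2_inner_def inner_simps square_integrable_inner)

lemma l2_inner_diff_left:
  "\<lbrakk>square_integrable M f; square_integrable M g; square_integrable M h\<rbrakk> \<Longrightarrow>
    l2_inner M (\<lambda>x. f x - g x) h = l2_inner M f h - l2_inner M g h"
  by (simp add: l2_inner_def inner_simps square_integrable_inner)

lemma l2_inner_add_right:
  "\<lbrakk>square_integrable M f; square_integrable M g; square_integrable M h\<rbrakk> \<Longrightarrow>
    l2_inner M h (\<lambda>x. f x + g x) = l2_inner M h f + l2_inner M h g"
  by (simp add: l2_inner_def inner_simps square_integrable_inner)

lemma l2_inner_diff_right:
  "\<lbrakk>square_integrable M f; square_integrable M g; square_integrable M h\<rbrakk> \<Longrightarrow>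
    l2_inner M h (\<lambda>x. f x - g x) = l2_inner M h f - l2_inner M h g"
  by (simp add: l2_inner_def inner_simps square_integrable_inner)

lemma l2_inner_scaleR_left: "l2_inner M (\<lambda>x. c *\<^sub>R f x) h = c * l2_inner M f h"
  by (simp add: l2_inner_def)

lemma l2_inner_scaleR_right: "l2_inner M h (\<lambda>x. c *\<^sub>R f x) = c * l2_inner M h f"
  by (simp add: l2_inner_def)

lemma l2_inner_nonneg: "0 \<le> l2_inner M f f"
  by (simp add: l2_inner_def)

lemma l2_norm_nonneg [simp]: "0 \<le> l2_norm M f"
  by (simp add: l2_norm_def l2_inner_nonneg)

lemma l2_norm_power2: "(l2_norm M f)\<^sup>2 = l2_inner M f f"
  by (simp add: l2_norm_def l2_inner_nonneg)

lemma l2_norm_power2_integral: "(l2_norm M f)\<^sup>2 = (\<integral>x. (norm (f x))\<^sup>2 \<partial>M)"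
  by (simp add: l2_norm_power2 l2_inner_def power2_norm_eq_inner)

lemma l2_norm_minus_commute: "l2_norm M (\<lambda>x. f x - g x) = l2_norm M (\<lambda>x. g x - f x)"
proof -
  have "(f x - g x) \<bullet> (f x - g x) = (g x - f x) \<bullet> (g x - f x)" for x
    by (simp add: inner_simps inner_commute)
  then show ?thesis by (simp add: l2_norm_def l2_inner_def)
qed

text \<open>Serves both the Cauchy-Schwarz inequality and the passage from almost minimal to almost
  critical. The sign of \<open>c\<close> is not given but forced: a negative leading coefficient
  makes the quadratic negative for large \<open>t\<close>.\<close>

lemma nonneg_quadratic_discriminant:
  fixes a b c :: real
  assumes "\<And>t. 0 \<le> a + 2 * t * b + t\<^sup>2 * c" and "0 \<le> a"
  shows "b\<^sup>2 \<le> a * c"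
proof (cases "c = 0")
  case True
  have "b = 0"
  proof (rule ccontr)
    assume "b \<noteq> 0"
    \<comment> \<open>This \<open>t\<close> makes the affine function equal to -1.\<close>
    then show False using assms(1)[of "-(a + 1) / (2 * b)"] True by (simp add: field_simps)
  qed
  then show ?thesis using True by simp
next
  case False
  have "0 < c"
  proof (rule ccontr)
    assume "\<not> 0 < c"
    then have "c < 0" using False by simp
    \<comment> \<open>Large enough for the leading term to outweigh the others, and at least 1, so
      that the constant term is at most \<open>a * t\<close>.\<close>
    define t where "t = (\<bar>2*b\<bar> + a + 1) / \<bar>c\<bar> + 1"
    have t: "t \<ge> 1" "t * \<bar>c\<bar> \<ge> \<bar>2*b\<bar> + a + 1"
      using \<open>c < 0\<close> assms(2) by (auto simp: t_def field_simps)
    have "a + 2 * t * b + t\<^sup>2 * c \<le> a * t + t * \<bar>2*b\<bar> - t * (t * \<bar>c\<bar>)"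
    proof -
      have "a * 1 \<le> a * t" by (rule mult_left_mono) (use t assms(2) in auto)
      moreover have "t * (2*b) \<le> t * \<bar>2*b\<bar>" by (rule mult_left_mono) (use t in auto)
      ultimately show ?thesis using \<open>c < 0\<close> by (simp add: power2_eq_square)
    qed
    also have "\<dots> = t * (a + \<bar>2*b\<bar> - t * \<bar>c\<bar>)" by (simp add: algebra_simps)
    also have "\<dots> < 0" using t by (intro mult_pos_neg) auto
    finally show False using assms(1)[of t] by simp
  qed
  then show ?thesis
    using assms(1)[of "- b / c"] by (simp add: field_simps power2_eq_square)
qed

lemma l2_inner_Cauchy_Schwarz:
  assumes "square_integrable M f" "square_integrable M g"
  shows "\<bar>l2_inner M f g\<bar> \<le> l2_norm M f * l2_norm M g"
proof -
  have "0 \<le> l2_inner M f f + 2 * t * l2_inner M f g + t\<^sup>2 * l2_inner M g g" for t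
  proof -
    have "0 \<le> l2_inner M (\<lambda>x. f x + t *\<^sub>R g x) (\<lambda>x. f x + t *\<^sub>R g x)" by (rule l2_inner_nonneg)
    also have "\<dots> = l2_inner M f f + 2 * t * l2_inner M f g + t\<^sup>2 * l2_inner M g g"
      using assms
      by (simp add: l2_inner_add_left l2_inner_add_right square_integrable_add square_integrable_scaleR
          l2_inner_scaleR_left l2_inner_scaleR_right l2_inner_commute[of M g f] power2_eq_square algebra_simps)
    finally show ?thesis .
  qed
  from nonneg_quadratic_discriminant[OF this l2_inner_nonneg]
  have "(l2_inner M f g)\<^sup>2 \<le> (l2_norm M f * l2_norm M g)\<^sup>2" by (simp add: power_mult_distrib l2_norm_power2)
  then show ?thesis by (metis abs_le_square_iff abs_of_nonneg mult_nonneg_nonneg l2_norm_nonneg)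
qed

lemma l2_norm_triangle:
  assumes "square_integrable M f" "square_integrable M g"
  shows "l2_norm M (\<lambda>x. f x + g x) \<le> l2_norm M f + l2_norm M g"
proof -
  have "(l2_norm M (\<lambda>x. f x + g x))\<^sup>2 = (l2_norm M f)\<^sup>2 + 2 * l2_inner M f g + (l2_norm M g)\<^sup>2"
    using assms by (simp add: l2_norm_power2 l2_inner_add_left l2_inner_add_right square_integrable_add
        l2_inner_commute[of M g f])
  also have "\<dots> \<le> (l2_norm M f + l2_norm M g)\<^sup>2"
    using l2_inner_Cauchy_Schwarz[OF assms] by (simp add: power2_sum)
  finally show ?thesis by (rule power2_le_imp_le) simp
qed

lemma l2_norm_triangle_diff:
  assumes "square_integrable M f" "square_integrable M g" "square_integrable M h"
  shows "l2_norm M (\<lambda>x. f x - h x) \<le> l2_norm M (\<lambda>x. f x - g x) + l2_norm M (\<lambda>x. g x - h x)"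
  using l2_norm_triangle[of M "\<lambda>x. f x - g x" "\<lambda>x. g x - h x"] assms
  by (simp add: square_integrable_diff)

lemma l2_norm_mono:
  assumes "square_integrable M f" "square_integrable M g" "\<And>x. x \<in> space M \<Longrightarrow> norm (f x) \<le> norm (g x)"
  shows "l2_norm M f \<le> l2_norm M g"
proof -
  have "(l2_norm M f)\<^sup>2 \<le> (l2_norm M g)\<^sup>2"
    unfolding l2_norm_power2_integral
    using assms by (intro integral_mono) (auto simp: square_integrable_def power_mono)
  then show ?thesis by (rule power2_le_imp_le) simp
qed

lemma l2_norm_eq_0_AE:
  assumes "square_integrable M f" "l2_norm M f = 0"
  shows "AE x in M. f x = 0"
proof -
  have "(\<integral>x. (norm (f x))\<^sup>2 \<partial>M) = 0" using assms(2) l2_norm_power2_integral[of M f] by simp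
  then have "AE x in M. (norm (f x))\<^sup>2 = 0"
    using assms(1) by (subst (asm) integral_nonneg_eq_0_iff_AE) (auto simp: square_integrable_def)
  then show ?thesis by simp
qed

lemma l2_norm_cong_AE:
  assumes "square_integrable M f" "square_integrable M g" "AE x in M. f x = g x"
  shows "l2_norm M f = l2_norm M g"
proof -
  have [measurable]: "f \<in> borel_measurable M" "g \<in> borel_measurable M"
    using assms by (auto simp: square_integrable_def)
  show ?thesis unfolding l2_norm_def l2_inner_def
    using assms(3) by (intro arg_cong[where f=sqrt] integral_cong_AE) auto
qed

lemma tendsto_l2_inner_left:
  assumes "\<And>n. square_integrable M (f n)" "square_integrable M f0" "square_integrable M g"
    and "(\<lambda>n. l2_norm M (\<lambda>x. f n x - f0 x)) \<longlonglongrightarrow> 0"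
  shows "(\<lambda>n. l2_inner M (f n) g) \<longlonglongrightarrow> l2_inner M f0 g"
proof -
  have "(\<lambda>n. l2_norm M (\<lambda>x. f n x - f0 x) * l2_norm M g) \<longlonglongrightarrow> 0"
    by (rule tendsto_mult_left_zero[OF assms(4)])
  moreover have "\<bar>l2_inner M (f n) g - l2_inner M f0 g\<bar> \<le> l2_norm M (\<lambda>x. f n x - f0 x) * l2_norm M g" for n
    using l2_inner_Cauchy_Schwarz[of M "\<lambda>x. f n x - f0 x" g] assms
    by (simp add: l2_inner_diff_left square_integrable_diff)
  then have "\<forall>\<^sub>F n in sequentially. norm (l2_inner M (f n) g - l2_inner M f0 g) \<le> l2_norm M (\<lambda>x. f n x - f0 x) * l2_norm M g"
    by (intro always_eventually allI) simp
  ultimately have "(\<lambda>n. l2_inner M (f n) g - l2_inner M f0 g) \<longlonglongrightarrow> 0"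
    by (rule Lim_null_comparison[rotated])
  then show ?thesis by (simp add: LIM_zero_iff)
qed

section \<open>Passage to the limit and completeness of L2\<close>

lemma l2_norm_enn:
  assumes "square_integrable M f"
  shows "(\<integral>\<^sup>+x. ennreal ((norm (f x))\<^sup>2) \<partial>M) = ennreal ((l2_norm M f)\<^sup>2)"
  using assms by (simp add: l2_norm_power2_integral square_integrable_def nn_integral_eq_integral)

text \<open>Fatou's lemma for the squared norms. It yields membership and bound at once, for a limit
  that is known only pointwise almost everywhere.\<close>

lemma square_integrable_Fatou:
  fixes f :: "nat \<Rightarrow> 'x \<Rightarrow> 'b::euclidean_space"
  assumes f: "\<And>n. square_integrable M (f n)" and g: "g \<in> borel_measurable M"
    and lim: "AE x in M. (\<lambda>n. f n x) \<longlonglongrightarrow> g x"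
    and bound: "\<And>n. l2_norm M (f n) \<le> B"
  shows "square_integrable M g" "l2_norm M g \<le> B"
proof -
  have [measurable]: "\<And>n. f n \<in> borel_measurable M" "g \<in> borel_measurable M"
    using f g by (auto simp: square_integrable_def)
  have B: "0 \<le> B" using bound[of 0] l2_norm_nonneg order_trans by blast
  have "(\<integral>\<^sup>+x. ennreal ((norm (g x))\<^sup>2) \<partial>M) = (\<integral>\<^sup>+x. liminf (\<lambda>n. ennreal ((norm (f n x))\<^sup>2)) \<partial>M)"
    using lim
  proof (intro nn_integral_cong_AE, eventually_elim)
    case (elim x)
    have "(\<lambda>n. ennreal ((norm (f n x))\<^sup>2)) \<longlonglongrightarrow> ennreal ((norm (g x))\<^sup>2)"
      by (intro tendsto_ennrealI tendsto_intros elim)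
    from lim_imp_Liminf[OF _ this] show ?case by simp
  qed
  also have "\<dots> \<le> liminf (\<lambda>n. \<integral>\<^sup>+x. ennreal ((norm (f n x))\<^sup>2) \<partial>M)"
    by (rule nn_integral_liminf) auto
  also have "\<dots> \<le> liminf (\<lambda>n. ennreal (B\<^sup>2))"
    using bound by (intro Liminf_mono) (auto simp: l2_norm_enn[OF f] intro!: always_eventually ennreal_leI power_mono)
  also have "\<dots> = ennreal (B\<^sup>2)" by (simp add: Liminf_const)
  finally have le: "(\<integral>\<^sup>+x. ennreal ((norm (g x))\<^sup>2) \<partial>M) \<le> ennreal (B\<^sup>2)" .
  then have "integrable M (\<lambda>x. (norm (g x))\<^sup>2)"
    by (intro integrableI_bounded) (auto simp: less_top[symmetric] top_unique)
  then show 1: "square_integrable M g" by (simp add: square_integrable_def)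
  have "(l2_norm M g)\<^sup>2 \<le> B\<^sup>2" using le l2_norm_enn[OF 1] by simp
  then show "l2_norm M g \<le> B" using B by (rule power2_le_imp_le)
qed

lemma square_integrable_norm: "square_integrable M f \<Longrightarrow> square_integrable M (\<lambda>x. norm (f x))"
  by (auto simp: square_integrable_def)

lemma l2_norm_norm: "l2_norm M (\<lambda>x. norm (f x)) = l2_norm M f"
  by (simp add: l2_norm_def l2_inner_def flip: power2_norm_eq_inner power2_eq_square)

lemma square_integrable_sum:
  "(\<And>i. i \<in> I \<Longrightarrow> square_integrable M (f i)) \<Longrightarrow> square_integrable M (\<lambda>x. \<Sum>i\<in>I. f i x)"
  by (induction I rule: infinite_finite_induct) (auto intro: square_integrable_add)

lemma l2_norm_sum:
  assumes "\<And>i. i \<in> I \<Longrightarrow> square_integrable M (f i)"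
  shows "l2_norm M (\<lambda>x. \<Sum>i\<in>I. f i x) \<le> (\<Sum>i\<in>I. l2_norm M (f i))"
  using assms
proof (induction I rule: infinite_finite_induct)
  case (insert i I)
  then show ?case
    using l2_norm_triangle[of M "f i" "\<lambda>x. \<Sum>i\<in>I. f i x"] by (auto simp: square_integrable_sum)
qed (auto simp: l2_norm_def l2_inner_def)

text \<open>By the triangle inequality the increasing partial sums \<open>S N\<close> of the norms
  have L2 norms bounded by \<open>B\<close>. Monotone convergence makes the supremum of their
  squares integrable, hence finite almost everywhere.\<close>

lemma AE_summable_square_integrable:
  assumes f: "\<And>n. square_integrable M (f n)" and sm: "summable (\<lambda>n. l2_norm M (f n))"
  shows "AE x in M. summable (\<lambda>n. norm (f n x))"
proof -
  have [measurable]: "\<And>n. f n \<in> borel_measurable M"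
    using f by (auto simp: square_integrable_def)
  define S where "S N x = (\<Sum>n<N. norm (f n x))" for N x
  have S: "square_integrable M (S N)" for N
    unfolding S_def by (intro square_integrable_sum square_integrable_norm f)
  have [measurable]: "\<And>n. S n \<in> borel_measurable M"
    using S by (auto simp: square_integrable_def)
  define B where "B = (\<Sum>n. l2_norm M (f n))"
  have "l2_norm M (S N) \<le> B" for N
  proof -
    have "l2_norm M (S N) \<le> (\<Sum>n<N. l2_norm M (\<lambda>x. norm (f n x)))"
      unfolding S_def by (intro l2_norm_sum square_integrable_norm f)
    also have "\<dots> \<le> B" unfolding B_def l2_norm_norm by (intro sum_le_suminf sm) auto
    finally show ?thesis .
  qed
  then have "(\<integral>\<^sup>+x. ennreal ((norm (S N x))\<^sup>2) \<partial>M) \<le> ennreal (B\<^sup>2)" for N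
    unfolding l2_norm_enn[OF S] by (intro ennreal_leI power_mono) auto
  then have "(SUP N. \<integral>\<^sup>+x. ennreal ((norm (S N x))\<^sup>2) \<partial>M) \<le> ennreal (B\<^sup>2)"
    by (intro SUP_least)
  moreover have "(SUP N. \<integral>\<^sup>+x. ennreal ((norm (S N x))\<^sup>2) \<partial>M) = (\<integral>\<^sup>+x. (SUP N. ennreal ((norm (S N x))\<^sup>2)) \<partial>M)"
  proof (rule nn_integral_monotone_convergence_SUP[symmetric])
    show "incseq (\<lambda>N x. ennreal ((norm (S N x))\<^sup>2))"
      by (auto simp: incseq_def le_fun_def S_def intro!: power_mono sum_mono2 sum_nonneg)
  qed auto
  ultimately have "(\<integral>\<^sup>+x. (SUP N. ennreal ((norm (S N x))\<^sup>2)) \<partial>M) \<noteq> \<infinity>"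
    by (auto simp: top_unique)
  then have "AE x in M. (SUP N. ennreal ((norm (S N x))\<^sup>2)) \<noteq> \<infinity>"
    by (intro nn_integral_PInf_AE) auto
  then show ?thesis
  proof eventually_elim
    case (elim x)
    then obtain r where r: "(SUP N. ennreal ((norm (S N x))\<^sup>2)) = ennreal r" "0 \<le> r"
      by (cases "SUP N. ennreal ((norm (S N x))\<^sup>2)") auto
    have "(S N x)\<^sup>2 \<le> r" for N
    proof -
      have "ennreal ((norm (S N x))\<^sup>2) \<le> ennreal r" unfolding r(1)[symmetric] by (rule SUP_upper) simp
      then show ?thesis using r(2) by simp
    qed
    then have "S N x \<le> sqrt r" for N using real_le_rsqrt by blast
    then show ?case
      unfolding S_def
      by (intro bounded_imp_summable[where B="sqrt r"]) (auto simp only: lessThan_Suc_atMost[symmetric] norm_ge_zero)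
  qed
qed

text \<open>The Riesz-Fischer argument: a rapidly converging subsequence converges almost
  everywhere, and Fatou's lemma upgrades the pointwise limit to a limit in norm of the whole
  sequence.\<close>

lemma square_integrable_complete:
  fixes f :: "nat \<Rightarrow> 'x \<Rightarrow> 'b::euclidean_space"
  assumes f: "\<And>n. square_integrable M (f n)"
    and Cauchy: "\<And>e. e > 0 \<Longrightarrow> \<exists>N. \<forall>m\<ge>N. \<forall>n\<ge>N. l2_norm M (\<lambda>x. f m x - f n x) \<le> e"
  obtains g where "square_integrable M g" "(\<lambda>n. l2_norm M (\<lambda>x. f n x - g x)) \<longlonglongrightarrow> 0"
proof -
  have [measurable]: "\<And>n. f n \<in> borel_measurable M"
    using f by (auto simp: square_integrable_def)
  obtain N where N: "\<And>k m n. m \<ge> N k \<Longrightarrow> n \<ge> N k \<Longrightarrow> l2_norm M (\<lambda>x. f m x - f n x) \<le> (1/2)^k"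
  proof -
    have "\<forall>k. \<exists>N. \<forall>m\<ge>N. \<forall>n\<ge>N. l2_norm M (\<lambda>x. f m x - f n x) \<le> (1/2)^k"
      by (intro allI Cauchy) simp
    then show ?thesis using that by metis
  qed
  \<comment> \<open>Summing the \<open>N j\<close> makes \<open>r\<close> monotone while
    \<open>N k \<le> r k\<close>, so consecutive terms of the subsequence differ by at most
    (1/2)^k.\<close>
  define r where "r k = (\<Sum>j\<le>k. N j) + k" for k
  have rN: "N k \<le> r k" for k
    unfolding r_def by (simp add: member_le_sum trans_le_add1)
  have rk: "k \<le> r k" for k by (simp add: r_def)
  have rS: "r k \<le> r (Suc k)" for k by (simp add: r_def)
  have step: "l2_norm M (\<lambda>x. f (r (Suc k)) x - f (r k) x) \<le> (1/2)^k" for k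
    using rN[of k] rS[of k] by (intro N) auto
  have "AE x in M. summable (\<lambda>k. norm (f (r (Suc k)) x - f (r k) x))"
    by (intro AE_summable_square_integrable square_integrable_diff f
        summable_comparison_test[OF _ summable_geometric[of "1/2::real"]] exI[of _ 0])
      (use step in auto)
  then have conv: "AE x in M. convergent (\<lambda>k. f (r k) x)"
  proof eventually_elim
    case (elim x)
    then have "summable (\<lambda>k. f (r (Suc k)) x - f (r k) x)" by (rule summable_norm_cancel)
    then have "convergent (\<lambda>n. (f (r n) x - f (r 0) x) + f (r 0) x)"
      by (intro convergent_add convergent_const) (simp add: summable_iff_convergent sum_lessThan_telescope[of "\<lambda>k. f (r k) x", symmetric])
    then show ?case by simp
  qed
  define g where "g x = lim (\<lambda>k. f (r k) x)" for x
  have [measurable]: "g \<in> borel_measurable M" unfolding g_def by measurable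
  have lim: "AE x in M. (\<lambda>k. f (r k) x) \<longlonglongrightarrow> g x"
    using conv by eventually_elim (simp add: g_def convergent_LIMSEQ_iff)
  \<comment> \<open>Here \<open>n\<close> is fixed and the limit is taken along the subsequence in
    the other argument. As the difference from \<open>g\<close> is square integrable, so is
    \<open>g\<close> itself.\<close>
  have key: "square_integrable M (\<lambda>x. f n x - g x) \<and> l2_norm M (\<lambda>x. f n x - g x) \<le> (1/2)^k" if "n \<ge> N k" for n k
  proof -
    have k: "l2_norm M (\<lambda>x. f n x - f (r (j + k)) x) \<le> (1/2)^k" for j
      using that rN[of k] lift_Suc_mono_le[of r k "j+k", OF rS] by (intro N) auto
    have "AE x in M. (\<lambda>j. f n x - f (r (j + k)) x) \<longlonglongrightarrow> f n x - g x"
      using lim by eventually_elim (intro tendsto_intros LIMSEQ_ignore_initial_segment)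
    from square_integrable_Fatou[OF square_integrable_diff[OF f f] _ this k] show ?thesis by simp
  qed
  show ?thesis
  proof
    have "square_integrable M (\<lambda>x. f (N 0) x - (f (N 0) x - g x))"
      by (rule square_integrable_diff[OF f key[OF order_refl, THEN conjunct1]])
    then show "square_integrable M g" by simp
    show "(\<lambda>n. l2_norm M (\<lambda>x. f n x - g x)) \<longlonglongrightarrow> 0"
    proof (rule LIMSEQ_I)
      fix e :: real assume "e > 0"
      then obtain k where k: "(1/2)^k < e" using real_arch_pow_inv[of e "1/2"] by auto
      show "\<exists>no. \<forall>n\<ge>no. norm (l2_norm M (\<lambda>x. f n x - g x) - 0) < e"
        using key k by (intro exI[of _ "N k"]) (auto intro: le_less_trans)
    qed
  qed
qed

lemma l2_norm_scaleR: "l2_norm M (\<lambda>x. c *\<^sub>R f x) = \<bar>c\<bar> * l2_norm M f"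
proof -
  have "l2_inner M (\<lambda>x. c *\<^sub>R f x) (\<lambda>x. c *\<^sub>R f x) = c\<^sup>2 * l2_inner M f f"
    unfolding l2_inner_scaleR_left l2_inner_scaleR_right by (simp add: power2_eq_square)
  then show ?thesis by (simp add: l2_norm_def real_sqrt_mult)
qed

lemma l2_norm_diff_le:
  assumes "square_integrable M f" "square_integrable M g"
  shows "l2_norm M (\<lambda>x. f x - g x) \<le> l2_norm M f + l2_norm M g"
  using l2_norm_triangle[OF assms(1) square_integrable_minus[OF assms(2)]] by (simp add: l2_norm_def l2_inner_def)

section \<open>Smooth functions\<close>

text \<open>Counting derivatives allows induction on the order in product and chain rules. The
  recursion takes the first derivative off, which in \<open>iter_dderiv\<close> belongs to the last
  vector of the list; hence the lemma on appending at the end.\<close>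

primrec differentiable_upto :: "nat \<Rightarrow> ('a::euclidean_space \<Rightarrow> real) \<Rightarrow> bool" where
  "differentiable_upto 0 f \<longleftrightarrow> True"
| "differentiable_upto (Suc n) f \<longleftrightarrow>
     (\<forall>x. f differentiable at x) \<and> (\<forall>v. differentiable_upto n (dderiv v f))"

lemma iter_dderiv_snoc: "iter_dderiv (vs @ [v]) f = iter_dderiv vs (dderiv v f)"
  by (induction vs) auto

lemma differentiable_upto_iff:
  "differentiable_upto n f \<longleftrightarrow> (\<forall>vs x. length vs < n \<longrightarrow> iter_dderiv vs f differentiable at x)"
proof (induction n arbitrary: f)
  case (Suc n)
  show ?case
  proof
    assume L: "differentiable_upto (Suc n) f"
    show "\<forall>vs x. length vs < Suc n \<longrightarrow> iter_dderiv vs f differentiable at x"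
    proof (intro allI impI)
      fix vs :: "'a list" and x assume "length vs < Suc n"
      then show "iter_dderiv vs f differentiable at x"
        using L Suc.IH by (cases vs rule: rev_cases) (auto simp: iter_dderiv_snoc)
    qed
  next
    assume R: "\<forall>vs x. length vs < Suc n \<longrightarrow> iter_dderiv vs f differentiable at x"
    have "f differentiable at x" for x using R[rule_format, of "[]"] by simp
    moreover have "differentiable_upto n (dderiv v f)" for v
      unfolding Suc.IH using R[rule_format, of "_ @ [v]"] by (auto simp: iter_dderiv_snoc)
    ultimately show "differentiable_upto (Suc n) f" by simp
  qed
qed simp

lemma smooth_fun_iff_differentiable_upto: "smooth_fun f \<longleftrightarrow> (\<forall>n. differentiable_upto n f)"
  unfolding smooth_fun_def differentiable_upto_iff by blast

lemma smooth_fun_differentiable: "smooth_fun f \<Longrightarrow> f differentiable at x"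
  unfolding smooth_fun_def by (metis iter_dderiv.simps(1))

lemma smooth_fun_dderiv: "smooth_fun f \<Longrightarrow> smooth_fun (dderiv v f)"
  unfolding smooth_fun_def by (metis iter_dderiv_snoc)

text \<open>Smoothness is the largest class of differentiable functions closed under directional
  derivatives, so an invariant class suffices. The alternative
  \<open>smooth_fun (dderiv v g)\<close> admits derivatives that leave the class for functions
  already known to be smooth, as for antiderivatives.\<close>

lemma smooth_fun_coinduct:
  assumes "P f" "\<And>g x. P g \<Longrightarrow> g differentiable at x" "\<And>g v. P g \<Longrightarrow> P (dderiv v g) \<or> smooth_fun (dderiv v g)"
  shows "smooth_fun f"
proof -
  have "differentiable_upto n g" if "P g" for n g
    using that
  proof (induction n arbitrary: g)
    case (Suc n)
    have "differentiable_upto n (dderiv v g)" for v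
      using assms(3)[OF Suc.prems, of v] Suc.IH smooth_fun_iff_differentiable_upto by blast
    then show ?case using assms(2)[OF Suc.prems] by simp
  qed simp
  from this[OF assms(1)] show ?thesis by (simp add: smooth_fun_iff_differentiable_upto)
qed

lemma has_derivative_dderiv:
  assumes "f differentiable at x"
  shows "(f has_derivative (\<lambda>v. dderiv v f x)) (at x)"
  using assms by (simp add: dderiv_def frechet_derivative_works[symmetric])

lemma dderiv_eqI:
  assumes "(f has_derivative F) (at x)"
  shows "dderiv v f x = F v"
  using frechet_derivative_at[OF assms] by (simp add: dderiv_def)

lemma dderiv_const [simp]: "dderiv v (\<lambda>x. c) = (\<lambda>x. 0)"
  by (rule ext, rule dderiv_eqI) simp

lemma dderiv_add:
  assumes "f differentiable at x" "g differentiable at x"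
  shows "dderiv v (\<lambda>x. f x + g x) x = dderiv v f x + dderiv v g x"
  by (rule dderiv_eqI[OF has_derivative_add[OF assms[THEN has_derivative_dderiv]]])

lemma dderiv_diff:
  assumes "f differentiable at x" "g differentiable at x"
  shows "dderiv v (\<lambda>x. f x - g x) x = dderiv v f x - dderiv v g x"
  by (rule dderiv_eqI[OF has_derivative_diff[OF assms[THEN has_derivative_dderiv]]])

lemma dderiv_mult:
  assumes "f differentiable at x" "g differentiable at x"
  shows "dderiv v (\<lambda>x. f x * g x) x = f x * dderiv v g x + dderiv v f x * g x"
  by (rule dderiv_eqI[OF has_derivative_mult[OF assms[THEN has_derivative_dderiv]]])

lemma dderiv_cmult:
  assumes "f differentiable at x"
  shows "dderiv v (\<lambda>x. c * f x) x = c * dderiv v f x"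
  by (rule dderiv_eqI[OF has_derivative_mult_right[OF assms[THEN has_derivative_dderiv]]])

lemma dderiv_real:
  assumes "(f has_real_derivative D) (at x)"
  shows "dderiv v f x = D * v"
  by (rule dderiv_eqI) (use assms in \<open>simp add: has_field_derivative_def\<close>)

lemma dderiv_compose:
  fixes h :: "real \<Rightarrow> real"
  assumes "h differentiable at (f x)" "f differentiable at x"
  shows "dderiv v (\<lambda>x. h (f x)) x = dderiv 1 h (f x) * dderiv v f x"
proof -
  have "linear (\<lambda>v. dderiv v h (f x))"
    using has_derivative_dderiv[OF assms(1)] has_derivative_linear by blast
  then have lin: "dderiv t h (f x) = dderiv 1 h (f x) * t" for t
    using linear_scale[of "\<lambda>v. dderiv v h (f x)" t 1] by simp
  show ?thesis
    using dderiv_eqI[OF has_derivative_compose[OF has_derivative_dderiv[OF assms(2)]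
          has_derivative_dderiv[OF assms(1)]], of v]
    by (simp add: lin[of "dderiv v f x"])
qed

text \<open>Holds without differentiability: both functions have the same set of derivatives at
  \<open>x\<close>, so the choice inside \<open>frechet_derivative\<close> gives the same
  result.\<close>

lemma dderiv_cong_ev:
  assumes "\<forall>\<^sub>F y in nhds x. f y = g y"
  shows "dderiv v f x = dderiv v g x"
proof -
  have fg: "f x = g x" using assms by (rule eventually_nhds_x_imp_x)
  have ev: "\<forall>\<^sub>F y in at x. f y = g y" using assms by (simp add: eventually_at_filter eventually_mono)
  then have ev': "\<forall>\<^sub>F y in at x. g y = f y" by (simp add: eq_commute)
  have "(f has_derivative D) (at x) \<longleftrightarrow> (g has_derivative D) (at x)" for D
    using has_derivative_transform_eventually[OF _ ev fg]
      has_derivative_transform_eventually[OF _ ev' fg[symmetric]] by blast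
  then show ?thesis by (simp add: dderiv_def frechet_derivative_def)
qed

lemma differentiable_cong_ev:
  fixes f g :: "'a::euclidean_space \<Rightarrow> real"
  assumes "\<forall>\<^sub>F y in nhds x. f y = g y" "g differentiable at x"
  shows "f differentiable at x"
proof -
  have fg: "f x = g x" using assms(1) by (rule eventually_nhds_x_imp_x)
  have ev: "\<forall>\<^sub>F y in at x. g y = f y"
    using assms(1) by (auto simp: eventually_at_filter elim: eventually_mono)
  show ?thesis using assms(2) has_derivative_transform_eventually[OF _ ev fg[symmetric]]
    unfolding differentiable_def by blast
qed

section \<open>Smoothness of sums, products, compositions and antiderivatives\<close>

lemma differentiable_upto_mono: "differentiable_upto (Suc n) f \<Longrightarrow> differentiable_upto n f"
  unfolding differentiable_upto_iff by auto

lemma differentiable_upto_add: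
  "differentiable_upto n f \<Longrightarrow> differentiable_upto n g \<Longrightarrow> differentiable_upto n (\<lambda>x. f x + g x)"
proof (induction n arbitrary: f g)
  case (Suc n)
  then have "dderiv v (\<lambda>x. f x + g x) = (\<lambda>x. dderiv v f x + dderiv v g x)" for v
    by (intro ext dderiv_add) auto
  then show ?case using Suc by auto
qed simp

lemma differentiable_upto_mult:
  "differentiable_upto n f \<Longrightarrow> differentiable_upto n g \<Longrightarrow> differentiable_upto n (\<lambda>x. f x * g x)"
proof (induction n arbitrary: f g)
  case (Suc n)
  then have "dderiv v (\<lambda>x. f x * g x) = (\<lambda>x. f x * dderiv v g x + dderiv v f x * g x)" for v
    by (intro ext dderiv_mult) auto
  then show ?case
    using Suc differentiable_upto_mono[OF Suc.prems(1)] differentiable_upto_mono[OF Suc.prems(2)]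
    by (auto intro!: differentiable_upto_add)
qed simp

lemma differentiable_upto_compose:
  fixes h :: "real \<Rightarrow> real"
  shows "differentiable_upto n h \<Longrightarrow> differentiable_upto n f \<Longrightarrow> differentiable_upto n (\<lambda>x. h (f x))"
proof (induction n arbitrary: f h)
  case (Suc n)
  then have "dderiv v (\<lambda>x. h (f x)) = (\<lambda>x. dderiv 1 h (f x) * dderiv v f x)" for v
    by (intro ext dderiv_compose) auto
  moreover have "(\<lambda>x. h (f x)) differentiable at x" for x
    using Suc.prems differentiable_chain_at[of f x h] by (auto simp: o_def)
  ultimately show ?case
    using Suc differentiable_upto_mono[OF Suc.prems(2)]
    by (auto intro!: differentiable_upto_mult)
qed simp

lemma smooth_fun_add: "smooth_fun f \<Longrightarrow> smooth_fun g \<Longrightarrow> smooth_fun (\<lambda>x. f x + g x)"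
  by (simp add: smooth_fun_iff_differentiable_upto differentiable_upto_add)

lemma smooth_fun_mult: "smooth_fun f \<Longrightarrow> smooth_fun g \<Longrightarrow> smooth_fun (\<lambda>x. f x * g x)"
  by (simp add: smooth_fun_iff_differentiable_upto differentiable_upto_mult)

lemma smooth_fun_compose:
  fixes h :: "real \<Rightarrow> real"
  shows "smooth_fun h \<Longrightarrow> smooth_fun f \<Longrightarrow> smooth_fun (\<lambda>x. h (f x))"
  by (simp add: smooth_fun_iff_differentiable_upto differentiable_upto_compose)

lemma smooth_fun_const [simp]: "smooth_fun (\<lambda>x. c)"
  by (rule smooth_fun_coinduct[where P="\<lambda>f. \<exists>c. f = (\<lambda>x. c)"]) auto

lemma smooth_fun_diff: 
  assumes "smooth_fun f" "smooth_fun g" shows "smooth_fun (\<lambda>x. f x - g x)"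
  using smooth_fun_add[OF assms(1) smooth_fun_mult[OF smooth_fun_const[of "-1"] assms(2)]] by simp

lemma smooth_fun_sum: "(\<And>i. i \<in> I \<Longrightarrow> smooth_fun (f i)) \<Longrightarrow> smooth_fun (\<lambda>x. \<Sum>i\<in>I. f i x)"
  by (induction I rule: infinite_finite_induct) (auto intro: smooth_fun_add)

lemma smooth_fun_bounded_linear:
  assumes "bounded_linear f" shows "smooth_fun f"
proof (rule smooth_fun_coinduct[where P="bounded_linear"])
  fix g :: "'a \<Rightarrow> real" and v x assume g: "bounded_linear g"
  then show "g differentiable at x" by (rule bounded_linear_imp_differentiable)
  have "dderiv v g = (\<lambda>x. g v)"
    by (rule ext, rule dderiv_eqI[OF bounded_linear_imp_has_derivative[OF g]])
  then show "bounded_linear (dderiv v g) \<or> smooth_fun (dderiv v g)" by simp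
qed (rule assms)

lemma smooth_fun_id: "smooth_fun (\<lambda>x::real. x)"
  by (rule smooth_fun_bounded_linear) (rule bounded_linear_ident)

lemma smooth_fun_inner: "smooth_fun (\<lambda>x. x \<bullet> y)"
  by (rule smooth_fun_bounded_linear) (rule bounded_linear_inner_left)

lemma smooth_fun_norm_power2: "smooth_fun (\<lambda>x. (norm (x - y))\<^sup>2)"
proof -
  have "(\<lambda>x. (norm (x - y))\<^sup>2) = (\<lambda>x. \<Sum>i\<in>Basis. (x \<bullet> i - y \<bullet> i) * (x \<bullet> i - y \<bullet> i))"
    by (rule ext, subst power2_norm_eq_inner, subst euclidean_inner) (simp add: inner_diff_left)
  then show ?thesis
    by (auto intro!: smooth_fun_sum smooth_fun_mult smooth_fun_diff smooth_fun_inner)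
qed

lemma smooth_fun_real_polynomial: "real_polynomial_function f \<Longrightarrow> smooth_fun f"
  by (induction rule: real_polynomial_function.induct)
    (simp_all add: smooth_fun_bounded_linear smooth_fun_add smooth_fun_mult)

lemma smooth_fun_antiderivative:
  fixes F :: "real \<Rightarrow> real"
  assumes "\<And>x. (F has_real_derivative f x) (at x)" "smooth_fun f"
  shows "smooth_fun F"
proof (rule smooth_fun_coinduct[where P="\<lambda>g. g = F"])
  fix g :: "real \<Rightarrow> real" and v x assume g: "g = F"
  show "g differentiable at x"
    unfolding g differentiable_def using assms(1)[of x] has_field_derivative_def by blast
  have "dderiv v g = (\<lambda>x. f x * v)" unfolding g by (intro ext dderiv_real assms)
  then show "dderiv v g = F \<or> smooth_fun (dderiv v g)"
    using assms(2) by (simp add: smooth_fun_mult)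
qed simp

section \<open>Bump functions and cut-offs\<close>

text \<open>The flat function p(1/t) exp(-1/t), extended by 0. The polynomial is a parameter because
  this makes the family closed under differentiation; \<open>p = 1\<close> gives the standard bump
  profile.\<close>

definition exp_recip :: "real poly \<Rightarrow> real \<Rightarrow> real" where
  "exp_recip p t = (if t > 0 then poly p (1 / t) * exp (- (1 / t)) else 0)"

lemma exp_recip_tendsto_0:
  fixes p :: "real poly"
  shows "((\<lambda>t. poly p (1 / t) * exp (- (1 / t))) \<longlongrightarrow> 0) (at_right 0)"
proof -
  have "((\<lambda>x::real. poly p x / exp x) \<longlongrightarrow> 0) at_top"
  proof (induction p)
    case (pCons a p)
    have "((\<lambda>x::real. a / exp x) \<longlongrightarrow> 0) at_top" by real_asymp
    moreover have "((\<lambda>x. x * poly p x / exp x) \<longlongrightarrow> 0) at_top"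
    proof -
      have "((\<lambda>x::real. (\<Sum>i\<le>degree p. coeff p i * (x ^ Suc i / exp x))) \<longlongrightarrow> (\<Sum>i\<le>degree p. coeff p i * 0)) at_top"
        by (intro tendsto_intros tendsto_power_div_exp_0)
      then show ?thesis
        by (simp add: poly_altdef sum_divide_distrib sum_distrib_left mult_ac)
    qed
    ultimately have "((\<lambda>x. a / exp x + x * poly p x / exp x) \<longlongrightarrow> 0 + 0) at_top"
      by (rule tendsto_add)
    then show ?case by (simp add: add_divide_distrib)
  qed simp
  moreover have "filterlim (\<lambda>t::real. 1 / t) at_top (at_right 0)" by real_asymp
  ultimately have "((\<lambda>t. poly p (1 / t) / exp (1 / t)) \<longlongrightarrow> 0) (at_right 0)"
    by (rule filterlim_compose)
  then show ?thesis by (simp add: exp_minus field_simps)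
qed

text \<open>Differentiating p(1/t) exp(-1/t) gives (p - p')(1/t) exp(-1/t) / t^2, and
  \<open>[:0, 0, 1:]\<close> is the polynomial X^2 that supplies the factor 1/t^2.\<close>

lemma exp_recip_derivative:
  "(exp_recip p has_real_derivative exp_recip ([:0, 0, 1:] * (p - pderiv p)) t) (at t)"
proof -
  consider "t > 0" | "t < 0" | "t = 0" by linarith
  then show ?thesis
  proof cases
    case 1
    have "((\<lambda>t. poly p (1 / t) * exp (- (1 / t))) has_real_derivative
        exp_recip ([:0, 0, 1:] * (p - pderiv p)) t) (at t)"
      unfolding exp_recip_def using 1
      by (auto intro!: derivative_eq_intros poly_DERIV[THEN DERIV_chain2] simp: power2_eq_square field_simps)
    then show ?thesis
      by (rule has_field_derivative_transform_within_open[where S="{0<..}"]) (use 1 in \<open>auto simp: exp_recip_def\<close>)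
  next
    case 2
    have "((\<lambda>t. 0) has_real_derivative exp_recip ([:0, 0, 1:] * (p - pderiv p)) t) (at t)"
      using 2 by (simp add: exp_recip_def)
    then show ?thesis
      by (rule has_field_derivative_transform_within_open[where S="{..<0}"]) (use 2 in \<open>auto simp: exp_recip_def\<close>)
  next
    case 3
    have "((\<lambda>h. exp_recip p h / h) \<longlongrightarrow> 0) (at 0)"
      unfolding filterlim_at_split
    proof
      have "((\<lambda>h::real. 0) \<longlongrightarrow> 0) (at_left 0)" by simp
      then show "((\<lambda>h. exp_recip p h / h) \<longlongrightarrow> 0) (at_left 0)"
        by (rule Lim_transform_eventually)
          (auto simp: exp_recip_def eventually_at_left_field intro: exI[of _ "-1"])
      \<comment> \<open>Dividing by h multiplies the polynomial by X = \<open>[:0, 1:]\<close>, so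
        the difference quotient is again of the form whose limit is known.\<close>
      show "((\<lambda>h. exp_recip p h / h) \<longlongrightarrow> 0) (at_right 0)"
        using exp_recip_tendsto_0[of "[:0, 1:] * p"]
        by (rule Lim_transform_eventually)
          (auto simp: exp_recip_def eventually_at_right_field intro: exI[of _ 1])
    qed
    then show ?thesis
      unfolding 3 by (simp add: has_field_derivative_iff exp_recip_def)
  qed
qed

lemma smooth_exp_recip: "smooth_fun (exp_recip p)"
\<comment> \<open>The invariant carries a scalar \<open>c\<close> because \<open>dderiv v\<close>
  multiplies the derivative by \<open>v\<close>.\<close>
proof (rule smooth_fun_coinduct[where P="\<lambda>f. \<exists>c p. f = (\<lambda>t. c * exp_recip p t)"])
  show "\<exists>c q. exp_recip p = (\<lambda>t. c * exp_recip q t)" by (rule exI[of _ 1], rule exI[of _ p]) simp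
next
  fix g :: "real \<Rightarrow> real" and x assume "\<exists>c p. g = (\<lambda>t. c * exp_recip p t)"
  then obtain c p where g: "g = (\<lambda>t. c * exp_recip p t)" by blast
  show "g differentiable at x"
    unfolding g differentiable_def
    using DERIV_cmult[OF exp_recip_derivative[of p x]] has_field_derivative_def by blast
next
  fix g :: "real \<Rightarrow> real" and v assume "\<exists>c p. g = (\<lambda>t. c * exp_recip p t)"
  then obtain c p where g: "g = (\<lambda>t. c * exp_recip p t)" by blast
  have "dderiv v g = (\<lambda>x. (c * v) * exp_recip ([:0, 0, 1:] * (p - pderiv p)) x)"
    unfolding g
    by (rule ext, subst dderiv_real[OF DERIV_cmult[OF exp_recip_derivative]]) (simp add: mult_ac)
  then show "(\<exists>c p. dderiv v g = (\<lambda>t. c * exp_recip p t)) \<or> smooth_fun (dderiv v g)" by blast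
qed

section \<open>Smooth steps, smooth truncations and cut-off functions\<close>

lemma exp_recip_1: "0 \<le> exp_recip 1 t" "exp_recip 1 t > 0 \<longleftrightarrow> t > 0" "t \<le> 0 \<Longrightarrow> exp_recip 1 t = 0"
  by (auto simp: exp_recip_def)

lemma has_real_antiderivative:
  fixes f :: "real \<Rightarrow> real"
  assumes "\<And>x. isCont f x"
  obtains F where "\<And>x. (F has_real_derivative f x) (at x)"
  using einterval_antiderivative[of "-\<infinity>" "\<infinity>" f] assms
  by (auto simp: has_real_derivative_iff_has_vector_derivative)

lemma smooth_fun_isCont: "smooth_fun f \<Longrightarrow> isCont f x"
  by (simp add: smooth_fun_differentiable differentiable_imp_continuous_within)

lemma DERIV_zero_const_interval:
  fixes F :: "real \<Rightarrow> real"
  assumes "\<And>x. (F has_real_derivative f x) (at x)" "a \<le> b" "\<And>x. a < x \<Longrightarrow> x < b \<Longrightarrow> f x = 0"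
  shows "F a = F b"
proof (cases "a < b")
  case True
  have "isCont F x" for x using assms(1) DERIV_isCont by blast
  then have "continuous_on {a..b} F" by (simp add: continuous_at_imp_continuous_on)
  moreover have "\<And>x. a < x \<Longrightarrow> x < b \<Longrightarrow> DERIV F x :> 0" using assms(1,3) by metis
  ultimately show ?thesis using DERIV_isconst2[of a b F b] True by auto
qed (use assms in simp)

text \<open>The normalised antiderivative of a smooth bump that is positive exactly on the interval
  from 0 to 1.\<close>

lemma smooth_step_exists:
  obtains s :: "real \<Rightarrow> real" where "smooth_fun s" "\<And>t. 0 \<le> s t" "\<And>t. s t \<le> 1"
    "\<And>t. t \<le> 0 \<Longrightarrow> s t = 0" "\<And>t. t \<ge> 1 \<Longrightarrow> s t = 1"
proof -
  define b where "b t = exp_recip 1 t * exp_recip 1 (1 - t)" for t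
  have b: "smooth_fun b" unfolding b_def
    by (intro smooth_fun_mult smooth_exp_recip smooth_fun_compose[OF smooth_exp_recip] smooth_fun_diff smooth_fun_const smooth_fun_id)
  obtain F where F: "\<And>x. (F has_real_derivative b x) (at x)"
    using has_real_antiderivative[OF smooth_fun_isCont[OF b]] by blast
  have b0: "0 \<le> b t" for t by (simp add: b_def exp_recip_1)
  have mono: "F x \<le> F y" if "x \<le> y" for x y
    using that by (rule DERIV_nonneg_imp_nondecreasing) (use F b0 in blast)
  have left: "F t = F 0" if "t \<le> 0" for t
    using that by (intro DERIV_zero_const_interval[OF F]) (auto simp: b_def exp_recip_1(3))
  have right: "F t = F 1" if "t \<ge> 1" for t
    using that by (intro DERIV_zero_const_interval[OF F, symmetric]) (auto simp: b_def exp_recip_1(3))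
  have "F 0 < F 1"
  proof (rule DERIV_pos_imp_increasing_open[of 0 1 F])
    show "\<exists>y. (F has_real_derivative y) (at x) \<and> 0 < y" if "0 < x" "x < 1" for x
      using F that by (intro exI[of _ "b x"]) (auto simp: b_def exp_recip_1 intro!: mult_pos_pos)
    show "continuous_on {0..1} F" using F DERIV_isCont by (blast intro: continuous_at_imp_continuous_on)
  qed simp
  define s where "s t = inverse (F 1 - F 0) * (F t - F 0)" for t
  show ?thesis
  proof
    show "smooth_fun s" unfolding s_def
      by (intro smooth_fun_mult smooth_fun_diff smooth_fun_const smooth_fun_antiderivative[OF F b])
    fix t
    have t: "F 0 \<le> F t" "F t \<le> F 1"
      using mono[of 0 t] mono[of t 1] left[of t] right[of t] \<open>F 0 < F 1\<close> by linarith+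
    show "0 \<le> s t" "s t \<le> 1"
      using t \<open>F 0 < F 1\<close> by (auto simp: s_def field_simps)
    show "s t = 0" if "t \<le> 0" using left[OF that] by (simp add: s_def)
    show "s t = 1" if "t \<ge> 1" using right[OF that] \<open>F 0 < F 1\<close> by (simp add: s_def)
  qed
qed

text \<open>A smooth substitute for clamping to [-M, M]: the antiderivative of a plateau function
  with values between 0 and 1. Slope at most 1 keeps Dirichlet energies from growing under
  composition; together with T 0 = 0 and constancy beyond 2M it also gives the bound 2M.\<close>

lemma smooth_truncation_exists:
  fixes M :: real
  assumes "M > 0"
  obtains T T' where "smooth_fun T" "\<And>t. (T has_real_derivative T' t) (at t)"
    "\<And>t. 0 \<le> T' t" "\<And>t. T' t \<le> 1" "\<And>t. \<bar>t\<bar> \<le> M \<Longrightarrow> T t = t" "\<And>t. \<bar>T t\<bar> \<le> 2 * M"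
    "continuous_on UNIV T'"
proof -
  obtain s where s: "smooth_fun s" "\<And>t::real. 0 \<le> s t" "\<And>t. s t \<le> (1::real)"
    "\<And>t. t \<le> 0 \<Longrightarrow> s t = 0" "\<And>t. t \<ge> 1 \<Longrightarrow> s t = 1"
    using smooth_step_exists by blast
  \<comment> \<open>The square keeps \<open>k\<close> smooth at 0. The argument of \<open>s\<close>
    is at least 1 exactly for |t| \<le> M, and nonpositive from |t| = sqrt 2 * M on, hence beyond
    2M.\<close>
  define k where "k t = s (2 - inverse (M * M) * (t * t))" for t
  have k: "smooth_fun k" unfolding k_def
    by (intro smooth_fun_compose[OF s(1)] smooth_fun_diff smooth_fun_mult smooth_fun_const smooth_fun_id)
  obtain F where F: "\<And>x. (F has_real_derivative k x) (at x)"
    using has_real_antiderivative[OF smooth_fun_isCont[OF k]] by blast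
  define T where "T t = F t - F 0" for t
  have T: "(T has_real_derivative k x) (at x)" for x
    unfolding T_def using F by (auto intro!: derivative_eq_intros)
  have k1: "k t = 1" if "\<bar>t\<bar> \<le> M" for t
  proof -
    have "t * t \<le> M * M" using that by (metis abs_le_square_iff abs_of_pos assms power2_eq_square)
    then show ?thesis unfolding k_def using assms by (intro s(5)) (simp add: field_simps)
  qed
  have k0: "k t = 0" if "\<bar>t\<bar> \<ge> 2 * M" for t
  proof -
    have "(2 * M)\<^sup>2 \<le> t\<^sup>2" using that assms by (metis abs_le_square_iff abs_of_pos mult_pos_pos zero_less_numeral)
    then have "M * M * 4 \<le> t * t" by (simp add: power2_eq_square)
    moreover have "0 < M * M" using assms by simp
    ultimately have "2 * (M * M) \<le> t * t" by linarith
    then show ?thesis unfolding k_def using \<open>0 < M * M\<close> by (intro s(4)) (simp add: field_simps)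
  qed
  have Tid: "T t = t" if "\<bar>t\<bar> \<le> M" for t
  proof -
    have D: "((\<lambda>t. T t - t) has_real_derivative (k x - 1)) (at x)" for x
      using T by (auto intro!: derivative_eq_intros)
    have "T 0 - 0 = T t - t"
    proof (cases "t \<ge> 0")
      case True then show ?thesis using that k1 by (intro DERIV_zero_const_interval[OF D]) auto
    next
      case False then show ?thesis using that k1 by (intro DERIV_zero_const_interval[OF D, symmetric]) auto
    qed
    then show ?thesis by (simp add: T_def)
  qed
  have mono: "T x \<le> T y" if "x \<le> y" for x y
    using that by (rule DERIV_nonneg_imp_nondecreasing) (use T s(2) k_def in metis)
  have lip: "T y - T x \<le> y - x" if "x \<le> y" for x y
  proof -
    have D: "((\<lambda>t. t - T t) has_real_derivative (1 - k x)) (at x)" for x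
      using T by (auto intro!: derivative_eq_intros)
    have "x - T x \<le> y - T y" using that
      by (rule DERIV_nonneg_imp_nondecreasing) (metis D s(3) k_def diff_ge_0_iff_ge)
    then show ?thesis by simp
  qed
  have T0: "T 0 = 0" by (simp add: T_def)
  have hi: "T t \<le> 2 * M" for t
  proof (cases "t \<le> 2 * M")
    case True
    then show ?thesis using mono[of t 0] lip[of 0 t] T0 assms by (cases "t \<le> 0") auto
  next
    case False
    then have "T (2 * M) = T t" using k0 by (intro DERIV_zero_const_interval[OF T]) auto
    then show ?thesis using lip[of 0 "2*M"] T0 assms by auto
  qed
  have lo: "- (2 * M) \<le> T t" for t
  proof (cases "t \<ge> - 2 * M")
    case True
    then show ?thesis using mono[of 0 t] lip[of t 0] T0 assms by (cases "t \<ge> 0") auto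
  next
    case False
    then have "T t = T (- 2 * M)" using k0 by (intro DERIV_zero_const_interval[OF T]) auto
    then show ?thesis using lip[of "-2*M" 0] T0 assms by auto
  qed
  show ?thesis
  proof
    show "smooth_fun T" by (rule smooth_fun_antiderivative[OF T k])
    show "(T has_real_derivative k t) (at t)" for t by (rule T)
    show "0 \<le> k t" "k t \<le> 1" for t by (simp_all add: k_def s)
    show "T t = t" if "\<bar>t\<bar> \<le> M" for t by (rule Tid[OF that])
    show "\<bar>T t\<bar> \<le> 2 * M" for t using hi[of t] lo[of t] by auto
    show "continuous_on UNIV k" using smooth_fun_isCont[OF k] by (simp add: continuous_at_imp_continuous_on)
  qed
qed

lemma bump_smooth: "smooth_fun (\<lambda>x. exp_recip p (r\<^sup>2 - (norm (x - a))\<^sup>2))"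
  by (intro smooth_fun_compose[OF smooth_exp_recip] smooth_fun_diff smooth_fun_const smooth_fun_norm_power2)

lemma bump_pos: "r > 0 \<Longrightarrow> exp_recip 1 (r\<^sup>2 - (norm (x - a))\<^sup>2) > 0 \<longleftrightarrow> x \<in> ball a r"
proof -
  assume "r > 0"
  then have "(norm (x - a))\<^sup>2 < r\<^sup>2 \<longleftrightarrow> norm (x - a) < r"
    by (metis abs_norm_cancel abs_of_pos abs_square_less_1 norm_ge_zero order_less_le power2_less_imp_less power_strict_mono zero_less_numeral)
  then show ?thesis by (simp add: exp_recip_1 dist_norm norm_minus_commute)
qed

text \<open>A finite sum \<open>S\<close> of bumps on balls covering \<open>K\<close> is positive on
  \<open>K\<close> and vanishes off these balls, whose closures lie in \<Omega>. The smooth step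
  applied to \<open>S\<close> divided by its minimum over \<open>K\<close> flattens it to 1
  there.\<close>

lemma cutoff_exists:
  fixes K \<Omega> :: "'a::euclidean_space set"
  assumes "compact K" "open \<Omega>" "K \<subseteq> \<Omega>"
  obtains \<zeta> where "test_fun \<Omega> \<zeta>" "\<And>x. x \<in> K \<Longrightarrow> \<zeta> x = 1" "\<And>x. 0 \<le> \<zeta> x" "\<And>x. \<zeta> x \<le> 1"
proof -
  have "\<exists>r. \<forall>a\<in>K. r a > 0 \<and> cball a (r a) \<subseteq> \<Omega>"
    using assms open_contains_cball by (intro bchoice) blast
  then obtain r where r: "\<And>a. a \<in> K \<Longrightarrow> r a > 0 \<and> cball a (r a) \<subseteq> \<Omega>" by blast
  have "K \<subseteq> (\<Union>a\<in>K. ball a (r a))" using r by fastforce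
  then obtain A where A: "A \<subseteq> K" "finite A" "K \<subseteq> (\<Union>a\<in>A. ball a (r a))"
    using compactE_image[OF assms(1), of K "\<lambda>a. ball a (r a)"] by (metis open_ball)
  define S where "S x = (\<Sum>a\<in>A. exp_recip 1 ((r a)\<^sup>2 - (norm (x - a))\<^sup>2))" for x
  have S: "smooth_fun S" unfolding S_def by (intro smooth_fun_sum bump_smooth)
  have S0: "0 \<le> S x" for x unfolding S_def by (intro sum_nonneg exp_recip_1)
  have Spos: "S x > 0 \<longleftrightarrow> x \<in> (\<Union>a\<in>A. ball a (r a))" for x
  proof -
    have "S x = 0 \<longleftrightarrow> (\<forall>a\<in>A. exp_recip 1 ((r a)\<^sup>2 - (norm (x - a))\<^sup>2) = 0)"
      unfolding S_def by (intro sum_nonneg_eq_0_iff A exp_recip_1)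
    also have "\<dots> \<longleftrightarrow> (\<forall>a\<in>A. \<not> exp_recip 1 ((r a)\<^sup>2 - (norm (x - a))\<^sup>2) > 0)"
      using exp_recip_1(1) by (metis less_le)
    also have "\<dots> \<longleftrightarrow> (\<forall>a\<in>A. x \<notin> ball a (r a))"
      using bump_pos r A(1) by (intro ball_cong) blast+
    finally show ?thesis using S0[of x] by force
  qed
  \<comment> \<open>The minimum of \<open>S\<close> over \<open>K\<close>; for empty
    \<open>K\<close> any positive number will do.\<close>
  obtain m where m: "m > 0" "\<And>x. x \<in> K \<Longrightarrow> m \<le> S x"
  proof (cases "K = {}")
    case False
    have "continuous_on K S" using smooth_fun_isCont[OF S] by (simp add: continuous_at_imp_continuous_on)
    from continuous_attains_inf[OF assms(1) False this] obtain x where "x \<in> K" "\<forall>y\<in>K. S x \<le> S y" by blast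
    moreover from this have "S x > 0" unfolding Spos using A(3) by blast
    ultimately show ?thesis by (intro that[of "S x"]) auto
  qed (use that[of 1] in auto)
  obtain s where s: "smooth_fun s" "\<And>t::real. 0 \<le> s t" "\<And>t. s t \<le> (1::real)"
    "\<And>t. t \<le> 0 \<Longrightarrow> s t = 0" "\<And>t. t \<ge> 1 \<Longrightarrow> s t = 1"
    using smooth_step_exists by blast
  define \<zeta> where "\<zeta> x = s (inverse m * S x)" for x
  have z: "smooth_fun \<zeta>" unfolding \<zeta>_def
    by (intro smooth_fun_compose[OF s(1)] smooth_fun_mult smooth_fun_const S)
  have C: "compact (\<Union>a\<in>A. cball a (r a))" using A by (intro compact_UN) auto
  have "{x. \<zeta> x \<noteq> 0} \<subseteq> (\<Union>a\<in>A. cball a (r a))"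
  proof
    fix x assume "x \<in> {x. \<zeta> x \<noteq> 0}"
    then have "S x \<noteq> 0" using s(4)[of 0] by (auto simp: \<zeta>_def)
    then have "S x > 0" using S0[of x] by linarith
    then show "x \<in> (\<Union>a\<in>A. cball a (r a))" unfolding Spos using ball_subset_cball by blast
  qed
  then have cl: "closure {x. \<zeta> x \<noteq> 0} \<subseteq> (\<Union>a\<in>A. cball a (r a))"
    using C by (intro closure_minimal compact_imp_closed)
  show ?thesis
  proof
    show "test_fun \<Omega> \<zeta>"
      unfolding test_fun_def
    proof (intro conjI z)
      show "compact (closure {x. \<zeta> x \<noteq> 0})"
        using compact_Int_closed[OF C closed_closure, of "{x. \<zeta> x \<noteq> 0}"] cl by (simp only: Int_absorb1)
      show "closure {x. \<zeta> x \<noteq> 0} \<subseteq> \<Omega>" using cl r A(1) by blast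
    qed
    show "\<zeta> x = 1" if "x \<in> K" for x
      unfolding \<zeta>_def using m(1) m(2)[OF that] by (intro s(5)) (simp add: field_simps)
  qed (auto simp: \<zeta>_def s)
qed

section \<open>Continuously differentiable functions of compact support\<close>

abbreviation support :: "('a::topological_space \<Rightarrow> real) \<Rightarrow> 'a set" where
  "support f \<equiv> closure {x. f x \<noteq> 0}"

lemma notin_support: "x \<notin> support f \<Longrightarrow> f x = 0"
  using subsetD[OF closure_subset, of x "{x. f x \<noteq> 0}"] by (cases "f x = 0") simp_all

lemma notin_support_eventually: "x \<notin> support f \<Longrightarrow> \<forall>\<^sub>F y in nhds x. f y = 0"
  unfolding eventually_nhds
  by (intro exI[of _ "- support f"] conjI ballI open_Compl closed_closure notin_support) auto

lemma dderiv_notin_support: "x \<notin> support f \<Longrightarrow> dderiv v f x = 0"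
  using dderiv_cong_ev[OF notin_support_eventually] by (metis dderiv_const)

lemma support_dderiv: "support (dderiv v f) \<subseteq> support f"
  by (rule closure_minimal) (use dderiv_notin_support in auto)

definition C1_on :: "'a::euclidean_space set \<Rightarrow> ('a \<Rightarrow> real) \<Rightarrow> bool" where
  "C1_on S f \<longleftrightarrow> (\<forall>x\<in>S. f differentiable at x) \<and> (\<forall>i\<in>Basis. continuous_on S (dderiv i f))"

text \<open>Larger than the class of test functions because cut-off truncations of
  \<open>u + \<psi> n\<close> must belong to it, and of \<open>u\<close> only finitely many
  derivatives are at hand.\<close>

definition C1_compact :: "'a::euclidean_space set \<Rightarrow> ('a \<Rightarrow> real) \<Rightarrow> bool" where
  "C1_compact \<Omega> f \<longleftrightarrow> C1_on UNIV f \<and> compact (support f) \<and> support f \<subseteq> \<Omega>"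

definition laplacian :: "('a::euclidean_space \<Rightarrow> real) \<Rightarrow> 'a \<Rightarrow> real" where
  "laplacian f x = (\<Sum>i\<in>Basis. dderiv i (dderiv i f) x)"

lemma C1_on_continuous: "C1_on S f \<Longrightarrow> continuous_on S f"
  by (auto simp: C1_on_def intro!: continuous_at_imp_continuous_on differentiable_imp_continuous_within)

lemma C1_on_subset: "C1_on S f \<Longrightarrow> T \<subseteq> S \<Longrightarrow> C1_on T f"
  by (auto simp: C1_on_def intro: continuous_on_subset)

lemma C1_on_union: "C1_on S f \<Longrightarrow> C1_on T f \<Longrightarrow> open S \<Longrightarrow> open T \<Longrightarrow> C1_on (S \<union> T) f"
  by (auto simp: C1_on_def intro: continuous_on_open_Un)

lemma C1_on_notin_support: "C1_on (- support f) f"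
proof -
  have "f differentiable at x" if "x \<notin> support f" for x
    using differentiable_cong_ev[OF notin_support_eventually[OF that]] by simp
  moreover have "continuous_on (- support f) (dderiv i f)" for i
    by (subst continuous_on_cong[OF refl, where g="\<lambda>x. 0"]) (auto simp: dderiv_notin_support)
  ultimately show ?thesis by (auto simp: C1_on_def)
qed

lemma C1_on_add:
  assumes "C1_on S f" "C1_on S g"
  shows "C1_on S (\<lambda>x. f x + g x)"
proof -
  have "continuous_on S (dderiv i (\<lambda>x. f x + g x))" if "i \<in> Basis" for i
  proof (subst continuous_on_cong[OF refl])
    show "dderiv i (\<lambda>x. f x + g x) x = dderiv i f x + dderiv i g x" if "x \<in> S" for x
      using assms that by (intro dderiv_add) (auto simp: C1_on_def)
    show "continuous_on S (\<lambda>x. dderiv i f x + dderiv i g x)"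
      using assms that by (intro continuous_on_add) (auto simp: C1_on_def)
  qed
  moreover have "(\<lambda>x. f x + g x) differentiable at x" if "x \<in> S" for x
    using assms that by (intro differentiable_add) (auto simp: C1_on_def)
  ultimately show ?thesis by (auto simp: C1_on_def)
qed

lemma C1_on_mult:
  assumes "C1_on S f" "C1_on S g"
  shows "C1_on S (\<lambda>x. f x * g x)"
proof -
  have "continuous_on S (dderiv i (\<lambda>x. f x * g x))" if "i \<in> Basis" for i
  proof (subst continuous_on_cong[OF refl])
    show "dderiv i (\<lambda>x. f x * g x) x = f x * dderiv i g x + dderiv i f x * g x" if "x \<in> S" for x
      using assms that by (intro dderiv_mult) (auto simp: C1_on_def)
    show "continuous_on S (\<lambda>x. f x * dderiv i g x + dderiv i f x * g x)"
      using assms that C1_on_continuous[OF assms(1)] C1_on_continuous[OF assms(2)]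
      by (intro continuous_intros) (auto simp: C1_on_def)
  qed
  moreover have "(\<lambda>x. f x * g x) differentiable at x" if "x \<in> S" for x
    using assms that by (intro differentiable_mult) (auto simp: C1_on_def)
  ultimately show ?thesis by (auto simp: C1_on_def)
qed

lemma C1_on_compose:
  fixes h h' :: "real \<Rightarrow> real"
  assumes h: "\<And>t. (h has_real_derivative h' t) (at t)" "continuous_on UNIV h'" and "C1_on S f"
  shows "C1_on S (\<lambda>x. h (f x))" "\<And>x v. x \<in> S \<Longrightarrow> dderiv v (\<lambda>x. h (f x)) x = h' (f x) * dderiv v f x"
proof -
  have hd: "h differentiable at t" for t
    unfolding differentiable_def using h(1) has_field_derivative_def by blast
  show D: "dderiv v (\<lambda>x. h (f x)) x = h' (f x) * dderiv v f x" if "x \<in> S" for x v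
    using assms(3) that dderiv_real[OF h(1), of 1] by (subst dderiv_compose[OF hd]) (auto simp: C1_on_def)
  have "(\<lambda>x. h (f x)) differentiable at x" if "x \<in> S" for x
    using assms(3) that differentiable_chain_at[OF _ hd, of f x] by (auto simp: C1_on_def o_def)
  moreover have "continuous_on S (dderiv i (\<lambda>x. h (f x)))" if "i \<in> Basis" for i
  proof (subst continuous_on_cong[OF refl D])
    show "continuous_on S (\<lambda>x. h' (f x) * dderiv i f x)"
      using assms(3) that
      by (intro continuous_on_mult continuous_on_compose2[OF h(2) C1_on_continuous[OF assms(3)]])
        (auto simp: C1_on_def)
  qed
  ultimately show "C1_on S (\<lambda>x. h (f x))" by (auto simp: C1_on_def)
qed

lemma smooth_fun_C1_on: "smooth_fun f \<Longrightarrow> C1_on S f"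
  unfolding C1_on_def
  by (intro conjI ballI continuous_at_imp_continuous_on smooth_fun_differentiable smooth_fun_isCont smooth_fun_dderiv)

lemma compact_subset: "compact K \<Longrightarrow> closed S \<Longrightarrow> S \<subseteq> K \<Longrightarrow> compact S"
  by (metis Int_absorb1 compact_Int_closed)

text \<open>In \<Omega> the product rule applies, and off its support the product is locally zero.
  These two open sets cover the space, so the values of \<open>f\<close> outside \<Omega> do not
  matter.\<close>

lemma C1_compact_mult:
  assumes "open \<Omega>" "C1_on \<Omega> f" "C1_compact \<Omega> g"
  shows "C1_compact \<Omega> (\<lambda>x. f x * g x)"
proof -
  have sub: "support (\<lambda>x. f x * g x) \<subseteq> support g"
    by (rule closure_mono) auto
  have g: "C1_on UNIV g" "compact (support g)" "support g \<subseteq> \<Omega>" using assms(3) by (auto simp: C1_compact_def)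
  have "C1_on \<Omega> (\<lambda>x. f x * g x)"
    by (intro C1_on_mult assms C1_on_subset[OF g(1)]) auto
  then have "C1_on (\<Omega> \<union> - support (\<lambda>x. f x * g x)) (\<lambda>x. f x * g x)"
    using assms(1) by (intro C1_on_union C1_on_notin_support) auto
  moreover have "\<Omega> \<union> - support (\<lambda>x. f x * g x) = UNIV" using sub g(3) by blast
  moreover have "compact (support (\<lambda>x. f x * g x))"
    using g(2) closed_closure sub by (rule compact_subset)
  ultimately show ?thesis using sub g by (auto simp: C1_compact_def)
qed

lemma support_binop:
  assumes "\<And>x. f x = 0 \<Longrightarrow> g x = 0 \<Longrightarrow> h x = 0"
  shows "support h \<subseteq> support f \<union> support g"
  unfolding closure_Un[symmetric] by (rule closure_mono) (use assms in auto)

lemma test_fun_binop: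
  assumes "test_fun \<Omega> f" "test_fun \<Omega> g" "smooth_fun h" "\<And>x. f x = 0 \<Longrightarrow> g x = 0 \<Longrightarrow> h x = 0"
  shows "test_fun \<Omega> h"
proof -
  have "support h \<subseteq> support f \<union> support g" by (rule support_binop[OF assms(4)])
  moreover have "compact (support f \<union> support g)" using assms by (auto simp: test_fun_def)
  ultimately have "compact (support h)" by (metis closed_closure compact_subset)
  with \<open>support h \<subseteq> support f \<union> support g\<close> show ?thesis
    using assms by (auto simp: test_fun_def)
qed

lemma test_fun_add: "test_fun \<Omega> f \<Longrightarrow> test_fun \<Omega> g \<Longrightarrow> test_fun \<Omega> (\<lambda>x. f x + g x)"
  by (rule test_fun_binop[of \<Omega> f g]) (auto simp: test_fun_def intro: smooth_fun_add)

lemma test_fun_diff: "test_fun \<Omega> f \<Longrightarrow> test_fun \<Omega> g \<Longrightarrow> test_fun \<Omega> (\<lambda>x. f x - g x)"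
  by (rule test_fun_binop[of \<Omega> f g]) (auto simp: test_fun_def intro: smooth_fun_diff)

lemma test_fun_mult_left: "smooth_fun f \<Longrightarrow> test_fun \<Omega> g \<Longrightarrow> test_fun \<Omega> (\<lambda>x. f x * g x)"
  by (rule test_fun_binop[of \<Omega> g g]) (auto simp: test_fun_def intro: smooth_fun_mult)

lemma test_fun_zero: "test_fun \<Omega> (\<lambda>x. 0)"
  by (simp add: test_fun_def)

lemma test_fun_dderiv:
  assumes "test_fun \<Omega> f" shows "test_fun \<Omega> (dderiv v f)"
proof -
  have "compact (support (dderiv v f))"
    by (rule compact_subset[OF _ closed_closure support_dderiv]) (use assms in \<open>simp add: test_fun_def\<close>)
  then show ?thesis
    using assms support_dderiv[of v f] by (auto simp: test_fun_def smooth_fun_dderiv)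
qed

lemma test_fun_C1_compact: "test_fun \<Omega> f \<Longrightarrow> C1_compact \<Omega> f"
  by (auto simp: test_fun_def C1_compact_def smooth_fun_C1_on)

lemma C1_compact_diff:
  assumes "C1_compact \<Omega> f" "C1_compact \<Omega> g"
  shows "C1_compact \<Omega> (\<lambda>x. f x - g x)"
proof -
  have sub: "support (\<lambda>x. f x - g x) \<subseteq> support f \<union> support g" by (rule support_binop) auto
  moreover have "compact (support f \<union> support g)" using assms by (auto simp: C1_compact_def)
  ultimately have "compact (support (\<lambda>x. f x - g x))"
    by (metis closed_closure compact_subset)
  moreover have "C1_on UNIV (\<lambda>x. f x + (-1) * g x)"
    using assms by (intro C1_on_add C1_on_mult smooth_fun_C1_on[OF smooth_fun_const]) (auto simp: C1_compact_def)
  ultimately show ?thesis using sub assms by (auto simp: C1_compact_def)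
qed

lemma grad_inner_Basis: "i \<in> Basis \<Longrightarrow> grad f x \<bullet> i = dderiv i f x"
  by (simp add: grad_def)

lemma grad_inner: "grad f x \<bullet> grad g x = (\<Sum>i\<in>Basis. dderiv i f x * dderiv i g x)"
  by (subst euclidean_inner) (simp add: grad_inner_Basis)

lemma norm_dderiv_le_grad: "i \<in> Basis \<Longrightarrow> \<bar>dderiv i f x\<bar> \<le> norm (grad f x)"
  by (metis Basis_le_norm grad_inner_Basis)

lemma grad_add: "f differentiable at x \<Longrightarrow> g differentiable at x \<Longrightarrow> grad (\<lambda>x. f x + g x) x = grad f x + grad g x"
  by (simp add: grad_def dderiv_add scaleR_add_left sum.distrib)

lemma grad_diff: "f differentiable at x \<Longrightarrow> g differentiable at x \<Longrightarrow> grad (\<lambda>x. f x - g x) x = grad f x - grad g x"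
  by (simp add: grad_def dderiv_diff scaleR_diff_left sum_subtractf)

lemma grad_cmult: "f differentiable at x \<Longrightarrow> grad (\<lambda>x. c * f x) x = c *\<^sub>R grad f x"
  by (simp add: grad_def dderiv_cmult scaleR_sum_right)

lemma grad_mult: "f differentiable at x \<Longrightarrow> g differentiable at x \<Longrightarrow>
    grad (\<lambda>x. f x * g x) x = f x *\<^sub>R grad g x + g x *\<^sub>R grad f x"
  by (simp add: grad_def dderiv_mult scaleR_sum_right sum.distrib scaleR_add_left mult.commute[of "dderiv _ f x" "g x"])

lemma C1_on_continuous_grad: "C1_on S f \<Longrightarrow> continuous_on S (grad f)"
  unfolding grad_def[abs_def] by (intro continuous_intros) (auto simp: C1_on_def)

lemma laplacian_add: "smooth_fun f \<Longrightarrow> smooth_fun g \<Longrightarrow> laplacian (\<lambda>x. f x + g x) x = laplacian f x + laplacian g x"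
proof -
  assume *: "smooth_fun f" "smooth_fun g"
  have "dderiv i (\<lambda>x. f x + g x) = (\<lambda>x. dderiv i f x + dderiv i g x)" for i
    by (rule ext) (intro dderiv_add smooth_fun_differentiable *)
  then show ?thesis
    by (simp add: laplacian_def dderiv_add smooth_fun_differentiable smooth_fun_dderiv * sum.distrib)
qed

lemma laplacian_cmult: "smooth_fun f \<Longrightarrow> laplacian (\<lambda>x. c * f x) x = c * laplacian f x"
proof -
  assume *: "smooth_fun f"
  have "dderiv i (\<lambda>x. c * f x) = (\<lambda>x. c * dderiv i f x)" for i
    by (rule ext) (intro dderiv_cmult smooth_fun_differentiable *)
  then show ?thesis
    by (simp add: laplacian_def dderiv_cmult smooth_fun_differentiable smooth_fun_dderiv * sum_distrib_left)
qed

section \<open>Integrals of derivatives over the whole space\<close>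

lemma line_derivative:
  assumes "f differentiable at (x + t *\<^sub>R v)"
  shows "((\<lambda>t. f (x + t *\<^sub>R v)) has_real_derivative dderiv v f (x + t *\<^sub>R v)) (at t)"
proof -
  have lin: "linear (\<lambda>w. dderiv w f (x + t *\<^sub>R v))"
    using has_derivative_dderiv[OF assms] has_derivative_linear by blast
  have "((\<lambda>t. x + t *\<^sub>R v) has_derivative (\<lambda>t. t *\<^sub>R v)) (at t)"
    by (auto intro!: derivative_eq_intros)
  from has_derivative_compose[OF this has_derivative_dderiv[OF assms]]
  show ?thesis
    by (simp add: has_field_derivative_def linear_scale[OF lin] mult_commute_abs)
qed

lemma compact_support_bounded:
  fixes f :: "'a::euclidean_space \<Rightarrow> 'b::real_normed_vector"
  assumes "compact K" "continuous_on K f" "\<And>x. x \<in> S \<Longrightarrow> x \<notin> K \<Longrightarrow> f x = 0"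
  obtains B where "0 \<le> B" "\<And>x. x \<in> S \<Longrightarrow> norm (f x) \<le> B"
proof -
  have "bounded (f ` K)" using assms compact_continuous_image compact_imp_bounded by blast
  then obtain B where B: "\<And>x. x \<in> K \<Longrightarrow> norm (f x) \<le> B" unfolding bounded_iff by blast
  show ?thesis
  proof (rule that[of "max 0 B"])
    show "norm (f x) \<le> max 0 B" if "x \<in> S" for x
      using assms(3)[OF that] B[of x] by (cases "x \<in> K") auto
  qed simp
qed

lemma integral_translation:
  fixes f :: "'a::euclidean_space \<Rightarrow> real"
  assumes "f \<in> borel_measurable borel"
  shows "(\<integral>x. f (x + c) \<partial>lborel) = (\<integral>x. f x \<partial>lborel)"
proof -
  have "(\<integral>x. f x \<partial>lborel) = (\<integral>x. f x \<partial>distr lborel borel ((+) c))"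
    by (simp add: lborel_distr_plus)
  also have "\<dots> = (\<integral>x. f (c + x) \<partial>lborel)"
    using assms by (subst integral_distr) auto
  finally show ?thesis by (simp add: add.commute)
qed

lemma integrable_translation:
  fixes f :: "'a::euclidean_space \<Rightarrow> real"
  assumes "integrable lborel f"
  shows "integrable lborel (\<lambda>x. f (x + c))"
proof -
  have "integrable (distr lborel borel ((+) c)) f" using assms by (simp add: lborel_distr_plus)
  then show ?thesis
    using assms by (subst (asm) integrable_distr_eq) (auto simp: add.commute dest: borel_measurable_integrable)
qed

lemma integrable_lborel_compact_support:
  fixes f :: "'a::euclidean_space \<Rightarrow> real"
  assumes "continuous_on UNIV f" "compact K" "\<And>x. x \<notin> K \<Longrightarrow> f x = 0"
  shows "integrable lborel f"
proof -
  obtain B where B: "\<And>x. x \<in> UNIV \<Longrightarrow> norm (f x) \<le> B"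
    by (rule compact_support_bounded[OF assms(2) continuous_on_subset[OF assms(1)], of UNIV]) (auto simp: assms(3))
  show ?thesis
  proof (rule Bochner_Integration.integrable_bound)
    show "integrable lborel (\<lambda>x. B * indicator K x)"
      using emeasure_compact_finite[OF assms(2)] assms(2)
      by (intro integrable_mult_right integrable_real_indicator) (auto simp: borel_compact)
    show "f \<in> borel_measurable lborel" using assms(1) by (simp add: borel_measurable_continuous_onI)
    show "AE x in lborel. norm (f x) \<le> norm (B * indicator K x)"
      using B assms(3) by (intro AE_I2) (auto simp: indicator_def intro: order_trans[OF _ abs_ge_self])
  qed
qed

text \<open>Difference quotients have integral zero by translation invariance, and they converge
  dominatedly to the derivative, since the mean value theorem bounds them by the supremum
  \<open>B\<close> of the derivative.\<close>

lemma integral_dderiv_lborel: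
  fixes F :: "'a::euclidean_space \<Rightarrow> real"
  assumes F: "C1_on UNIV F" and K: "compact (support F)" and i: "i \<in> Basis"
  shows "(\<integral>x. dderiv i F x \<partial>lborel) = 0"
proof -
  have Fd: "F differentiable at x" for x using F by (auto simp: C1_on_def)
  have cont: "continuous_on UNIV (dderiv i F)" "continuous_on UNIV F"
    using F i C1_on_continuous by (auto simp: C1_on_def)
  obtain B where B: "0 \<le> B" "\<And>x. x \<in> UNIV \<Longrightarrow> norm (dderiv i F x) \<le> B"
    by (rule compact_support_bounded[OF K continuous_on_subset[OF cont(1)], of UNIV]) (auto simp: dderiv_notin_support)
  obtain R where R: "support F \<subseteq> cball 0 R"
    using bounded_subset_ballD[OF compact_imp_bounded[OF K], of 0] ball_subset_cball by (metis order_trans)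
  define t :: "nat \<Rightarrow> real" where "t n = inverse (real (Suc n))" for n
  have t: "t n > 0" "t n \<le> 1" for n by (auto simp: t_def inverse_le_1_iff)
  have tn0: "t n \<noteq> 0" for n using t(1)[of n] by simp
  have t0: "t \<longlonglongrightarrow> 0" unfolding t_def by (rule LIMSEQ_inverse_real_of_nat)
  have [measurable]: "F \<in> borel_measurable borel" "dderiv i F \<in> borel_measurable borel"
    using cont by (auto intro: borel_measurable_continuous_onI)
  define s where "s n x = (F (x + t n *\<^sub>R i) - F x) / t n" for n x
  have [measurable]: "s n \<in> borel_measurable borel" for n unfolding s_def by measurable
  have FI: "integrable lborel F"
    by (rule integrable_lborel_compact_support[OF cont(2) K]) (rule notin_support)
  have s0: "integral\<^sup>L lborel (s n) = 0" for n
    unfolding s_def by (simp add: FI integrable_translation integral_translation)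
  have D: "((\<lambda>t. F (x + t *\<^sub>R i)) has_real_derivative dderiv i F (x + r *\<^sub>R i)) (at r)" for x r
    by (rule line_derivative[OF Fd])
  have "(\<lambda>n. integral\<^sup>L lborel (s n)) \<longlonglongrightarrow> (\<integral>x. dderiv i F x \<partial>lborel)"
  proof (rule integral_dominated_convergence)
    \<comment> \<open>Radius \<open>R + 1\<close>, because steps of length
      \<open>t n \<le> 1\<close> move the support by at most 1.\<close>
    show "integrable lborel (\<lambda>x::'a. B * indicator (cball 0 (R + 1)) x :: real)"
      using emeasure_compact_finite[of "cball (0::'a) (R + 1)"]
      by (intro integrable_mult_right integrable_real_indicator) auto
    show "AE x in lborel. (\<lambda>n. s n x) \<longlonglongrightarrow> dderiv i F x"
    proof (rule AE_I2)
      fix x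
      have "((\<lambda>h. (F (x + (0 + h) *\<^sub>R i) - F (x + 0 *\<^sub>R i)) / h) \<longlongrightarrow> dderiv i F (x + 0 *\<^sub>R i)) (at 0)"
        using D[of x 0] by (simp add: DERIV_def)
      moreover have "filterlim t (at 0) sequentially"
        using t0 tn0 by (simp add: filterlim_at)
      ultimately have "(\<lambda>n. (F (x + (0 + t n) *\<^sub>R i) - F (x + 0 *\<^sub>R i)) / t n) \<longlonglongrightarrow> dderiv i F (x + 0 *\<^sub>R i)"
        by (rule filterlim_compose)
      then show "(\<lambda>n. s n x) \<longlonglongrightarrow> dderiv i F x" by (simp add: s_def)
    qed
    show "AE x in lborel. norm (s n x) \<le> B * indicator (cball 0 (R + 1)) x" for n
    proof (rule AE_I2)
      fix x
      show "norm (s n x) \<le> B * indicator (cball 0 (R + 1)) x"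
      proof (cases "x \<in> cball 0 (R + 1)")
        case True
        obtain z where "F (x + t n *\<^sub>R i) - F (x + 0 *\<^sub>R i) = (t n - 0) * dderiv i F (x + z *\<^sub>R i)"
          using MVT2[OF t(1)[of n] D[of x]] by auto
        then have "s n x = dderiv i F (x + z *\<^sub>R i)" using t(1)[of n] by (simp add: s_def)
        then show ?thesis using B True by simp
      next
        case False
        have "norm x \<le> norm (x + t n *\<^sub>R i) + norm (t n *\<^sub>R i)"
          using norm_triangle_ineq4[of "x + t n *\<^sub>R i" "t n *\<^sub>R i"] by simp
        moreover have "norm (t n *\<^sub>R i) \<le> 1" using i t[of n] by simp
        ultimately have "x + t n *\<^sub>R i \<notin> cball 0 R" "x \<notin> cball 0 R" using False by auto
        then have "F (x + t n *\<^sub>R i) = 0" "F x = 0" using R notin_support by blast+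
        then show ?thesis using False by (simp add: s_def)
      qed
    qed
  qed auto
  then show ?thesis unfolding s0 by (simp add: LIMSEQ_const_iff)
qed

lemma grad_notin_support: "x \<notin> support f \<Longrightarrow> grad f x = 0"
  by (simp add: grad_def dderiv_notin_support)

section \<open>Integration by parts and the Poincare inequality\<close>

locale bounded_open =
  fixes \<Omega> :: "'a::euclidean_space set"
  assumes open_dom: "open \<Omega>" and bounded_dom: "bounded \<Omega>"
begin

abbreviation M :: "'a measure" where "M \<equiv> lebesgue_on \<Omega>"

lemma lmeasurable_dom: "\<Omega> \<in> lmeasurable"
  by (intro lmeasurable_open bounded_dom open_dom)

lemma dom_sets: "\<Omega> \<in> sets lebesgue"
  using lmeasurable_dom by (rule fmeasurableD)

lemma finite_measure_dom: "finite_measure M"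
  by (rule finite_measure_lebesgue_on[OF lmeasurable_dom])

lemma measurable_continuous:
  fixes f :: "'a \<Rightarrow> 'b::euclidean_space"
  shows "continuous_on \<Omega> f \<Longrightarrow> f \<in> borel_measurable M"
  by (rule continuous_imp_measurable_on_sets_lebesgue[OF _ dom_sets])

lemma integrable_bounded:
  fixes f :: "'a \<Rightarrow> 'b::euclidean_space"
  assumes "f \<in> borel_measurable M" "\<And>x. x \<in> \<Omega> \<Longrightarrow> norm (f x) \<le> B"
  shows "integrable M f"
  using assms by (intro finite_measure.integrable_const_bound[OF finite_measure_dom, of _ B]) auto

lemma square_integrable_bounded:
  fixes f :: "'a \<Rightarrow> 'b::euclidean_space"
  assumes "f \<in> borel_measurable M" "\<And>x. x \<in> \<Omega> \<Longrightarrow> norm (f x) \<le> B"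
  shows "square_integrable M f"
  unfolding square_integrable_def
proof
  show "integrable M (\<lambda>x. (norm (f x))\<^sup>2)"
  proof (rule integrable_bounded[where B="B\<^sup>2"])
    show "(\<lambda>x. (norm (f x))\<^sup>2) \<in> borel_measurable M" using assms(1) by measurable
    show "norm ((norm (f x))\<^sup>2) \<le> B\<^sup>2" if "x \<in> \<Omega>" for x
      using power_mono[OF assms(2)[OF that] norm_ge_zero, of 2] by simp
  qed
qed (rule assms(1))

lemma square_integrable_const: "square_integrable M (\<lambda>x. c::real)"
  by (rule square_integrable_bounded[where B="\<bar>c\<bar>"]) auto

lemma square_integrable_integrable: "square_integrable M f \<Longrightarrow> integrable M (f :: 'a \<Rightarrow> real)"
  using square_integrable_inner[OF _ square_integrable_const[of 1], of f] by simp

lemma integrable_compact_support: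
  fixes f :: "'a \<Rightarrow> 'b::euclidean_space"
  assumes "continuous_on \<Omega> f" "compact K" "K \<subseteq> \<Omega>" "\<And>x. x \<in> \<Omega> \<Longrightarrow> x \<notin> K \<Longrightarrow> f x = 0"
  shows "integrable M f" "square_integrable M f"
proof -
  obtain B where B: "\<And>x. x \<in> \<Omega> \<Longrightarrow> norm (f x) \<le> B"
    using compact_support_bounded[OF assms(2) continuous_on_subset[OF assms(1,3)] assms(4)] by blast
  show "integrable M f" "square_integrable M f"
    using B measurable_continuous[OF assms(1)] by (auto intro: integrable_bounded square_integrable_bounded)
qed

lemma C1_compact_square_integrable:
  assumes "C1_compact \<Omega> f"
  shows "square_integrable M f" "square_integrable M (grad f)" "i \<in> Basis \<Longrightarrow> square_integrable M (dderiv i f)"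
proof -
  have c: "C1_on \<Omega> f" "compact (support f)" "support f \<subseteq> \<Omega>"
    using assms C1_on_subset[of UNIV f \<Omega>] by (auto simp: C1_compact_def)
  show "square_integrable M f"
    by (rule integrable_compact_support(2)[OF C1_on_continuous[OF c(1)] c(2,3)]) (rule notin_support)
  show "square_integrable M (grad f)"
    by (rule integrable_compact_support(2)[OF C1_on_continuous_grad[OF c(1)] c(2,3)])
      (simp add: grad_def dderiv_notin_support)
  show "square_integrable M (dderiv i f)" if "i \<in> Basis"
    by (rule integrable_compact_support(2)[OF _ c(2,3)])
      (use c(1) that in \<open>auto simp: C1_on_def dderiv_notin_support\<close>)
qed

lemma integral_dderiv_C1_compact:
  assumes "C1_compact \<Omega> F" "i \<in> Basis"
  shows "(\<integral>x. dderiv i F x \<partial>M) = 0"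
proof -
  have F: "C1_on UNIV F" "compact (support F)" "support F \<subseteq> \<Omega>" using assms by (auto simp: C1_compact_def)
  have "dderiv i F \<in> borel_measurable borel"
    using F assms(2) by (auto simp: C1_on_def intro: borel_measurable_continuous_onI)
  have "(\<integral>x. dderiv i F x \<partial>M) = (\<integral>x. indicator \<Omega> x *\<^sub>R dderiv i F x \<partial>lebesgue)"
    using dom_sets by (subst integral_restrict_space) auto
  also have "\<dots> = (\<integral>x. dderiv i F x \<partial>lebesgue)"
  proof (intro Bochner_Integration.integral_cong refl)
    fix x show "indicator \<Omega> x *\<^sub>R dderiv i F x = dderiv i F x"
      using F(3) dderiv_notin_support[of x F i] by (cases "x \<in> \<Omega>") auto
  qed
  also have "\<dots> = (\<integral>x. dderiv i F x \<partial>lborel)"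
    using \<open>dderiv i F \<in> borel_measurable borel\<close> by (subst integral_completion) auto
  also have "\<dots> = 0" by (rule integral_dderiv_lborel[OF F(1,2) assms(2)])
  finally show ?thesis .
qed

text \<open>The derivative of \<open>f * g\<close> integrates to zero. Only \<open>g\<close> has
  compact support, so \<open>f\<close> may be unbounded near the frontier, as a harmonic function
  can be.\<close>

lemma integration_by_parts:
  assumes "C1_on \<Omega> f" "C1_compact \<Omega> g" "i \<in> Basis"
  shows "integrable M (\<lambda>x. f x * dderiv i g x)" "integrable M (\<lambda>x. dderiv i f x * g x)"
    "(\<integral>x. f x * dderiv i g x \<partial>M) = - (\<integral>x. dderiv i f x * g x \<partial>M)"
proof -
  have g: "C1_on \<Omega> g" "compact (support g)" "support g \<subseteq> \<Omega>"
    using assms C1_on_subset[of UNIV g \<Omega>] by (auto simp: C1_compact_def)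
  note c = C1_on_continuous[OF assms(1)] C1_on_continuous[OF g(1)]
  have c': "continuous_on \<Omega> (dderiv i f)" "continuous_on \<Omega> (dderiv i g)"
    using assms g by (auto simp: C1_on_def)
  show 1: "integrable M (\<lambda>x. f x * dderiv i g x)"
    by (rule integrable_compact_support(1)[OF continuous_on_mult[OF c(1) c'(2)] g(2,3)])
      (simp add: dderiv_notin_support)
  show 2: "integrable M (\<lambda>x. dderiv i f x * g x)"
    by (rule integrable_compact_support(1)[OF continuous_on_mult[OF c'(1) c(2)] g(2,3)])
      (metis mult_zero_right notin_support)
  have "0 = (\<integral>x. dderiv i (\<lambda>x. f x * g x) x \<partial>M)"
    using integral_dderiv_C1_compact[OF C1_compact_mult[OF open_dom assms(1,2)] assms(3)] by simp
  also have "\<dots> = (\<integral>x. f x * dderiv i g x + dderiv i f x * g x \<partial>M)"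
    using assms(1) g(1) by (intro Bochner_Integration.integral_cong dderiv_mult) (auto simp: C1_on_def)
  also have "\<dots> = (\<integral>x. f x * dderiv i g x \<partial>M) + (\<integral>x. dderiv i f x * g x \<partial>M)"
    using 1 2 by simp
  finally show "(\<integral>x. f x * dderiv i g x \<partial>M) = - (\<integral>x. dderiv i f x * g x \<partial>M)" by simp
qed

text \<open>Both derivatives end up on \<open>w\<close>, so the right-hand side keeps its meaning
  for functions \<open>f\<close> without derivatives. This is how L2 limits of \<open>f\<close> will
  be taken.\<close>

lemma Green_test_fun:
  assumes "C1_on \<Omega> f" "test_fun \<Omega> w"
  shows "l2_inner M (grad f) (grad w) = - (\<integral>x. f x * laplacian w x \<partial>M)"
proof -
  have w: "C1_compact \<Omega> (dderiv i w)" for i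
    by (intro test_fun_C1_compact test_fun_dderiv assms(2))
  have "(\<integral>x. f x * laplacian w x \<partial>M) = (\<integral>x. (\<Sum>i\<in>Basis. f x * dderiv i (dderiv i w) x) \<partial>M)"
    by (simp add: laplacian_def sum_distrib_left)
  also have "\<dots> = (\<Sum>i\<in>Basis. \<integral>x. f x * dderiv i (dderiv i w) x \<partial>M)"
    by (intro Bochner_Integration.integral_sum integration_by_parts(1)[OF assms(1) w])
  also have "\<dots> = - (\<Sum>i\<in>Basis. \<integral>x. dderiv i f x * dderiv i w x \<partial>M)"
    unfolding sum_negf[symmetric] by (intro sum.cong refl integration_by_parts(3)[OF assms(1) w])
  also have "(\<Sum>i\<in>Basis. \<integral>x. dderiv i f x * dderiv i w x \<partial>M) = (\<integral>x. (\<Sum>i\<in>Basis. dderiv i f x * dderiv i w x) \<partial>M)"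
    by (intro Bochner_Integration.integral_sum[symmetric] integration_by_parts(2)[OF assms(1) w])
  also have "\<dots> = l2_inner M (grad f) (grad w)" by (simp add: l2_inner_def grad_inner)
  finally show ?thesis by simp
qed

lemma harmonic_on_C1:
  assumes "harmonic_on \<Omega> u"
  shows "C1_on \<Omega> u" "i \<in> Basis \<Longrightarrow> C1_on \<Omega> (dderiv i u)"
  using assms
  by (auto simp: harmonic_on_def C1_on_def intro!: continuous_at_imp_continuous_on differentiable_imp_continuous_within)

text \<open>Here the second derivative falls on \<open>u\<close>. Compact support of
  \<open>w\<close> makes all integrals finite even where \<open>grad u\<close> is not square
  integrable on \<Omega>.\<close>

lemma Green_harmonic:
  assumes "harmonic_on \<Omega> u" "C1_compact \<Omega> w"
  shows "l2_inner M (grad u) (grad w) = 0"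
proof -
  note u = harmonic_on_C1(2)[OF assms(1)]
  have "l2_inner M (grad u) (grad w) = (\<integral>x. (\<Sum>i\<in>Basis. dderiv i u x * dderiv i w x) \<partial>M)"
    by (simp add: l2_inner_def grad_inner)
  also have "\<dots> = (\<Sum>i\<in>Basis. \<integral>x. dderiv i u x * dderiv i w x \<partial>M)"
    by (intro Bochner_Integration.integral_sum integration_by_parts(1)[OF u assms(2)])
  also have "\<dots> = - (\<Sum>i\<in>Basis. \<integral>x. dderiv i (dderiv i u) x * w x \<partial>M)"
    unfolding sum_negf[symmetric] by (intro sum.cong refl integration_by_parts(3)[OF u assms(2)])
  also have "(\<Sum>i\<in>Basis. \<integral>x. dderiv i (dderiv i u) x * w x \<partial>M) = (\<integral>x. (\<Sum>i\<in>Basis. dderiv i (dderiv i u) x * w x) \<partial>M)"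
    by (intro Bochner_Integration.integral_sum[symmetric] integration_by_parts(2)[OF u assms(2)])
  also have "\<dots> = (\<integral>x. 0 \<partial>M)"
    using assms(1) by (intro Bochner_Integration.integral_cong) (auto simp: harmonic_on_def sum_distrib_right[symmetric])
  finally show ?thesis by simp
qed

text \<open>Integrating by parts with the factor x_i, whose i-th derivative is 1, gives that the
  integral of f^2 equals -2 times that of x_i f \<partial>_i f. With |x_i| \<le> R on \<Omega>,
  Cauchy-Schwarz gives the constant 2R.\<close>

lemma Poincare:
  obtains C where "C > 0" "\<And>f. C1_compact \<Omega> f \<Longrightarrow> l2_norm M f \<le> C * l2_norm M (grad f)"
proof -
  obtain R where R: "R > 0" "\<And>x. x \<in> \<Omega> \<Longrightarrow> norm x < R"
    using bounded_subset_ballD[OF bounded_dom, of 0] by (metis mem_ball_0 subsetD)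
  obtain i :: 'a where i: "i \<in> Basis" by (meson nonempty_Basis ex_in_conv)
  have "l2_norm M f \<le> (2 * R) * l2_norm M (grad f)" if f: "C1_compact \<Omega> f" for f
  proof -
    note sq = C1_compact_square_integrable[OF f] 
    note sqi = sq(3)[OF i]
    have x: "smooth_fun (\<lambda>x. x \<bullet> i)" by (rule smooth_fun_inner)
    have dx: "dderiv i (\<lambda>x. x \<bullet> i) x = 1" for x
      using i by (subst dderiv_eqI[OF bounded_linear_imp_has_derivative[OF bounded_linear_inner_left]]) simp
    have g: "C1_compact \<Omega> (\<lambda>x. (x \<bullet> i) * f x)"
      by (rule C1_compact_mult[OF open_dom smooth_fun_C1_on[OF x] f])
    note sg = C1_compact_square_integrable(1)[OF g]
    have fd: "f differentiable at x" for x using f by (auto simp: C1_compact_def C1_on_def)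
    have eq: "dderiv i (\<lambda>x. (x \<bullet> i) * f x) x = (x \<bullet> i) * dderiv i f x + f x" for x
      by (simp add: dderiv_mult[OF smooth_fun_differentiable[OF x] fd] dx)
    have "(\<integral>x. ((x \<bullet> i) * f x) * dderiv i f x \<partial>M) = - (\<integral>x. dderiv i (\<lambda>x. (x \<bullet> i) * f x) x * f x \<partial>M)"
      by (rule integration_by_parts(3)[OF C1_on_subset f i]) (use g in \<open>auto simp: C1_compact_def\<close>)
    also have "(\<integral>x. dderiv i (\<lambda>x. (x \<bullet> i) * f x) x * f x \<partial>M)
        = (\<integral>x. ((x \<bullet> i) * f x) * dderiv i f x + f x * f x \<partial>M)"
      unfolding eq by (simp add: algebra_simps)
    also have "\<dots> = (\<integral>x. ((x \<bullet> i) * f x) * dderiv i f x \<partial>M) + (\<integral>x. f x * f x \<partial>M)"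
      using square_integrable_inner[OF sg sqi] square_integrable_inner[OF sq(1) sq(1)]
      by (intro Bochner_Integration.integral_add) auto
    finally have "l2_inner M f f = - 2 * l2_inner M (\<lambda>x. (x \<bullet> i) * f x) (dderiv i f)"
      by (simp add: l2_inner_def)
    also have "\<dots> \<le> 2 * (l2_norm M (\<lambda>x. (x \<bullet> i) * f x) * l2_norm M (dderiv i f))"
      using l2_inner_Cauchy_Schwarz[OF sg sqi] by linarith
    also have "l2_norm M (\<lambda>x. (x \<bullet> i) * f x) \<le> l2_norm M (\<lambda>x. R *\<^sub>R f x)"
    proof (rule l2_norm_mono[OF sg square_integrable_scaleR[OF sq(1)]])
      fix x assume "x \<in> space M"
      then have "\<bar>x \<bullet> i\<bar> \<le> R" using R(2)[of x] Basis_le_norm[OF i, of x] by auto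
      then show "norm ((x \<bullet> i) * f x) \<le> norm (R *\<^sub>R f x)"
        using R(1) by (simp add: abs_mult mult_right_mono)
    qed
    also have "l2_norm M (\<lambda>x. R *\<^sub>R f x) = R * l2_norm M f"
      using R(1) unfolding l2_norm_scaleR by simp
    also have "l2_norm M (dderiv i f) \<le> l2_norm M (grad f)"
      by (rule l2_norm_mono[OF sqi sq(2)]) (use norm_dderiv_le_grad[OF i] in auto)
    finally have "(l2_norm M f)\<^sup>2 \<le> 2 * (R * l2_norm M f * l2_norm M (grad f))"
      using R(1) by (simp add: l2_norm_power2 mult_right_mono mult_left_mono)
    then have "l2_norm M f * l2_norm M f \<le> l2_norm M f * ((2 * R) * l2_norm M (grad f))"
      by (simp add: power2_eq_square mult_ac)
    then show ?thesis
      using R(1) by (cases "l2_norm M f = 0") (auto simp: mult_le_cancel_left order_less_le)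
  qed
  then show ?thesis using R(1) by (intro that[of "2 * R"]) auto
qed

end

section \<open>Dirichlet's principle\<close>

context bounded_open begin

lemma test_fun_square_integrable:
  assumes "test_fun \<Omega> w"
  shows "square_integrable M w" "square_integrable M (grad w)" "square_integrable M (laplacian w)"
    "i \<in> Basis \<Longrightarrow> square_integrable M (dderiv i w)"
proof -
  show "square_integrable M w" "square_integrable M (grad w)" "i \<in> Basis \<Longrightarrow> square_integrable M (dderiv i w)"
    using C1_compact_square_integrable[OF test_fun_C1_compact[OF assms]] by auto
  show "square_integrable M (laplacian w)"
    unfolding laplacian_def[abs_def]
    by (intro square_integrable_sum C1_compact_square_integrable test_fun_C1_compact test_fun_dderiv assms)
qed

section \<open>Near-minimisers of the Dirichlet functional\<close>

lemma grad_add_cmult: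
  assumes "test_fun \<Omega> f" "test_fun \<Omega> g"
  shows "grad (\<lambda>x. f x + t * g x) = (\<lambda>x. grad f x + t *\<^sub>R grad g x)"
proof
  fix x
  have d: "f differentiable at x" "g differentiable at x" "(\<lambda>x. t * g x) differentiable at x"
    using assms by (auto simp: test_fun_def smooth_fun_differentiable)
  show "grad (\<lambda>x. f x + t * g x) x = grad f x + t *\<^sub>R grad g x"
    using grad_add[OF d(1,3)] grad_cmult[OF d(2)] by simp
qed

lemma test_fun_add_cmult: "test_fun \<Omega> f \<Longrightarrow> test_fun \<Omega> g \<Longrightarrow> test_fun \<Omega> (\<lambda>x. f x + t * g x)"
  by (intro test_fun_add test_fun_mult_left smooth_fun_const)

lemma grad_diff_test_fun:
  assumes "test_fun \<Omega> f" "test_fun \<Omega> g"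
  shows "grad (\<lambda>x. f x - g x) = (\<lambda>x. grad f x - grad g x)"
  using assms by (intro ext grad_diff) (auto simp: test_fun_def smooth_fun_differentiable)

text \<open>Twice the usual Dirichlet functional with linear term \<open>F\<close>: for linear
  \<open>F\<close>, criticality of \<psi> means that the inner product of \<open>grad \<psi>\<close>
  and \<open>grad w\<close> equals -F w for all w.\<close>

definition energy :: "(('a \<Rightarrow> real) \<Rightarrow> real) \<Rightarrow> ('a \<Rightarrow> real) \<Rightarrow> real" where
  "energy F \<psi> = l2_inner M (grad \<psi>) (grad \<psi>) + 2 * F \<psi>"

text \<open>Comparing \<psi> with \<psi> + t w for every real t gives a nonnegative quadratic in t
  with constant term e^2. Its discriminant is the claim, which is why the tolerance is a
  square.\<close>

lemma near_minimiser_almost_critical: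
  assumes lin: "\<And>f g t. test_fun \<Omega> f \<Longrightarrow> test_fun \<Omega> g \<Longrightarrow> F (\<lambda>x. f x + t * g x) = F f + t * F g"
    and min: "\<And>w. test_fun \<Omega> w \<Longrightarrow> energy F \<psi> - e\<^sup>2 \<le> energy F w"
    and "test_fun \<Omega> \<psi>" "test_fun \<Omega> w" "0 \<le> e"
  shows "\<bar>l2_inner M (grad \<psi>) (grad w) + F w\<bar> \<le> e * l2_norm M (grad w)"
proof -
  note sq = test_fun_square_integrable(2)[OF assms(3)] test_fun_square_integrable(2)[OF assms(4)]
  have "0 \<le> e\<^sup>2 + 2 * t * (l2_inner M (grad \<psi>) (grad w) + F w) + t\<^sup>2 * l2_inner M (grad w) (grad w)" for t
  proof -
    have "energy F (\<lambda>x. \<psi> x + t * w x)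
        = energy F \<psi> + 2 * t * (l2_inner M (grad \<psi>) (grad w) + F w) + t\<^sup>2 * l2_inner M (grad w) (grad w)"
      unfolding energy_def grad_add_cmult[OF assms(3,4)] lin[OF assms(3,4)]
      using sq by (simp add: l2_inner_add_left l2_inner_add_right square_integrable_add square_integrable_scaleR
          l2_inner_scaleR_left l2_inner_scaleR_right l2_inner_commute[of M "grad w" "grad \<psi>"] power2_eq_square algebra_simps)
    then show ?thesis using min[OF test_fun_add_cmult[OF assms(3,4), of t]] by simp
  qed
  from nonneg_quadratic_discriminant[OF this]
  have "(l2_inner M (grad \<psi>) (grad w) + F w)\<^sup>2 \<le> (e * l2_norm M (grad w))\<^sup>2"
    by (simp add: power_mult_distrib l2_norm_power2)
  then show ?thesis
    using assms(5) by (metis abs_le_square_iff abs_of_nonneg mult_nonneg_nonneg l2_norm_nonneg)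
qed

lemma near_minimiser_exists:
  assumes bound: "\<And>w. test_fun \<Omega> w \<Longrightarrow> \<bar>F w\<bar> \<le> C * l2_norm M (grad w)" and "0 < e"
  obtains \<psi> where "test_fun \<Omega> \<psi>" "\<And>w. test_fun \<Omega> w \<Longrightarrow> energy F \<psi> - e\<^sup>2 \<le> energy F w"
proof -
  define E where "E = energy F ` {w. test_fun \<Omega> w}"
  have "- (C\<^sup>2) \<le> energy F w" if "test_fun \<Omega> w" for w
  proof -
    \<comment> \<open>Completing the square: the energy is at least N^2 - 2 C N \<ge> -C^2, where N
      is the norm of \<open>grad w\<close>.\<close>
    have "0 \<le> (l2_norm M (grad w) - C)\<^sup>2" by simp
    then show ?thesis using bound[OF that] by (simp add: energy_def l2_norm_power2[symmetric] power2_diff algebra_simps)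
  qed
  then have bdd: "bdd_below E" unfolding E_def by (intro bdd_belowI[of _ "- (C\<^sup>2)"]) auto
  have "E \<noteq> {}" unfolding E_def using test_fun_zero by blast
  moreover have "Inf E < Inf E + e\<^sup>2" using assms(2) by simp
  ultimately obtain y where y: "y \<in> E" "y < Inf E + e\<^sup>2" by (meson cInf_lessD)
  then obtain \<psi> where \<psi>: "test_fun \<Omega> \<psi>" "y = energy F \<psi>" by (auto simp: E_def)
  show ?thesis
  proof (rule that[OF \<psi>(1)])
    fix w assume "test_fun \<Omega> w"
    then have "Inf E \<le> energy F w" using bdd by (intro cInf_lower) (auto simp: E_def)
    then show "energy F \<psi> - e\<^sup>2 \<le> energy F w" using y \<psi>(2) by simp
  qed
qed

section \<open>A continuous extension of the boundary values with bounded Laplacian\<close>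

lemma continuous_closure_bounded:
  fixes f :: "'a \<Rightarrow> 'b::euclidean_space"
  assumes "continuous_on (closure \<Omega>) f"
  obtains B where "0 \<le> B" "\<And>x. x \<in> closure \<Omega> \<Longrightarrow> norm (f x) \<le> B"
  by (rule compact_support_bounded[of "closure \<Omega>" f "closure \<Omega>"]) (use assms bounded_dom in auto)

lemma square_integrable_continuous_closure:
  fixes f :: "'a \<Rightarrow> 'b::euclidean_space"
  assumes "continuous_on (closure \<Omega>) f"
  shows "square_integrable M f"
proof -
  obtain B where "\<And>x. x \<in> closure \<Omega> \<Longrightarrow> norm (f x) \<le> B" using continuous_closure_bounded[OF assms] by metis
  then have "norm (f x) \<le> B" if "x \<in> \<Omega>" for x using that closure_subset[of \<Omega>] by auto
  then show ?thesis
    using measurable_continuous[OF continuous_on_subset[OF assms closure_subset]]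
    by (rule square_integrable_bounded[rotated])
qed

text \<open>Truncating a near-minimiser of the Dirichlet energy does not increase its energy and does not
  change it near the boundary, so near-minimisers may be taken bounded by the boundary values.\<close>

lemma bounded_almost_harmonic_extension:
  assumes G: "smooth_fun G" and m: "\<And>x. x \<in> frontier \<Omega> \<Longrightarrow> \<bar>G x\<bar> < m" "m > 0" and e: "e > 0"
  obtains \<psi> where "test_fun \<Omega> \<psi>" "\<And>x. x \<in> closure \<Omega> \<Longrightarrow> \<bar>G x + \<psi> x\<bar> \<le> 2 * m"
    "\<And>w. test_fun \<Omega> w \<Longrightarrow> \<bar>l2_inner M (grad (\<lambda>x. G x + \<psi> x)) (grad w)\<bar> \<le> e * l2_norm M (grad w)"
proof -
  have Gs: "square_integrable M (grad G)"
    by (intro square_integrable_continuous_closure C1_on_continuous_grad smooth_fun_C1_on G)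
  define F where "F w = l2_inner M (grad G) (grad w)" for w
  have lin: "F (\<lambda>x. f x + t * g x) = F f + t * F g" if "test_fun \<Omega> f" "test_fun \<Omega> g" for f g t
    unfolding F_def grad_add_cmult[OF that]
    by (simp add: l2_inner_add_right l2_inner_scaleR_right square_integrable_scaleR Gs test_fun_square_integrable that)
  have bound: "\<bar>F w\<bar> \<le> l2_norm M (grad G) * l2_norm M (grad w)" if "test_fun \<Omega> w" for w
    unfolding F_def by (intro l2_inner_Cauchy_Schwarz Gs test_fun_square_integrable that)
  have gradG: "grad (\<lambda>x. G x + w x) = (\<lambda>x. grad G x + grad w x)" if "test_fun \<Omega> w" for w
    using that G by (intro ext grad_add) (auto simp: test_fun_def smooth_fun_differentiable)
  \<comment> \<open>Up to a constant, \<open>energy F w\<close> is the Dirichlet energy of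
    \<open>G + w\<close>, the quantity that truncation controls.\<close>
  have energyG: "energy F w = (l2_norm M (grad (\<lambda>x. G x + w x)))\<^sup>2 - (l2_norm M (grad G))\<^sup>2" if "test_fun \<Omega> w" for w
    unfolding gradG[OF that] l2_norm_power2 energy_def F_def using Gs test_fun_square_integrable[OF that]
    by (simp add: l2_inner_add_left l2_inner_add_right square_integrable_add l2_inner_commute[of M "grad w" "grad G"])
  obtain \<psi> where \<psi>: "test_fun \<Omega> \<psi>" "\<And>w. test_fun \<Omega> w \<Longrightarrow> energy F \<psi> - e\<^sup>2 \<le> energy F w"
    using near_minimiser_exists[OF bound e] by blast
  obtain T T' where T: "smooth_fun T" "\<And>t. (T has_real_derivative T' t) (at t)"
    "\<And>t. 0 \<le> T' t" "\<And>t. T' t \<le> 1" "\<And>t. \<bar>t\<bar> \<le> m \<Longrightarrow> T t = t" "\<And>t. \<bar>T t\<bar> \<le> 2 * m"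
    "continuous_on UNIV T'"
    using smooth_truncation_exists[OF m(2)] by blast
  define v where "v x = G x + \<psi> x" for x
  have v: "smooth_fun v" unfolding v_def using G \<psi>(1) by (intro smooth_fun_add) (auto simp: test_fun_def)
  \<comment> \<open>In \<Omega> off \<open>K\<close> the correction \<psi> vanishes and |G| \<le> m,
    so truncation changes nothing there. The strict inequality |G| < m on the frontier makes
    \<open>K\<close> a compact subset of \<Omega>.\<close>
  define K where "K = support \<psi> \<union> {x \<in> closure \<Omega>. m \<le> \<bar>G x\<bar>}"
  have "compact {x \<in> closure \<Omega>. m \<le> \<bar>G x\<bar>}"
  proof (rule compact_subset[of "closure \<Omega>"])
    show "closed {x \<in> closure \<Omega>. m \<le> \<bar>G x\<bar>}"
      by (intro closed_Collect_conj closed_Collect_le continuous_intros C1_on_continuous smooth_fun_C1_on G) auto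
  qed (use bounded_dom in auto)
  then have K: "compact K" using \<psi>(1) by (auto simp: K_def test_fun_def)
  have fr: "closure \<Omega> = \<Omega> \<union> frontier \<Omega>" using open_dom by (simp add: frontier_def interior_open closure_def)
  have K\<Omega>: "K \<subseteq> \<Omega>" using \<psi>(1) m(1) fr unfolding K_def test_fun_def by fastforce
  obtain \<zeta> where \<zeta>: "test_fun \<Omega> \<zeta>" "\<And>x. x \<in> K \<Longrightarrow> \<zeta> x = 1"
    using cutoff_exists[OF K open_dom K\<Omega>] by metis
  \<comment> \<open>\<open>T (v x) - G x\<close> already vanishes in \<Omega> off \<open>K\<close>,
    but perhaps not outside \<Omega>. The cut-off turns it into a test function without changing it
    in \<Omega>.\<close>
  define \<psi>1 where "\<psi>1 x = (T (v x) - G x) * \<zeta> x" for x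
  have \<psi>1: "test_fun \<Omega> \<psi>1" unfolding \<psi>1_def
    by (intro test_fun_mult_left smooth_fun_diff smooth_fun_compose[OF T(1) v] G \<zeta>)
  have eq: "G x + \<psi>1 x = T (v x)" if "x \<in> \<Omega>" for x
  proof (cases "x \<in> K")
    case False
    have "\<bar>G x\<bar> \<le> m" using False that closure_subset[of \<Omega>] by (auto simp: K_def)
    moreover have "\<psi> x = 0" using False notin_support[of x \<psi>] by (auto simp: K_def)
    ultimately show ?thesis by (simp add: \<psi>1_def v_def T(5))
  qed (simp add: \<psi>1_def \<zeta>(2))
  have le_2m: "\<bar>G x + \<psi>1 x\<bar> \<le> 2 * m" if "x \<in> closure \<Omega>" for x
  proof (cases "x \<in> \<Omega>")
    case False
    then have "\<psi>1 x = 0" using \<psi>1 notin_support[of x \<psi>1] by (auto simp: test_fun_def)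
    moreover have "\<bar>G x\<bar> < m" using m(1) False that fr by blast
    ultimately show ?thesis using m(2) by simp
  qed (simp add: eq T(6))
  have gradT: "grad (\<lambda>x. G x + \<psi>1 x) x = T' (v x) *\<^sub>R grad v x" if "x \<in> \<Omega>" for x
  proof -
    have "\<forall>\<^sub>F y in nhds x. G y + \<psi>1 y = T (v y)"
      using eq open_dom that by (auto simp: eventually_nhds)
    then have "dderiv i (\<lambda>x. G x + \<psi>1 x) x = T' (v x) * dderiv i v x" for i
      using C1_on_compose(2)[OF T(2) T(7) smooth_fun_C1_on[OF v], of x UNIV i] by (simp add: dderiv_cong_ev)
    then show ?thesis by (simp add: grad_def scaleR_sum_right)
  qed
  have "l2_norm M (grad (\<lambda>x. G x + \<psi>1 x)) \<le> l2_norm M (grad v)"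
  proof (rule l2_norm_mono)
    show "square_integrable M (grad (\<lambda>x. G x + \<psi>1 x))"
      unfolding gradG[OF \<psi>1] by (intro square_integrable_add Gs test_fun_square_integrable \<psi>1)
    show "square_integrable M (grad v)"
      unfolding v_def[abs_def] gradG[OF \<psi>(1)] by (intro square_integrable_add Gs test_fun_square_integrable \<psi>)
    show "norm (grad (\<lambda>x. G x + \<psi>1 x) x) \<le> norm (grad v x)" if "x \<in> space M" for x
      using that gradT[of x] T(3,4)[of "v x"] by (simp add: mult_left_le_one_le)
  qed
  then have "energy F \<psi>1 \<le> energy F \<psi>"
    unfolding energyG[OF \<psi>1] energyG[OF \<psi>(1)] v_def[abs_def] by (simp add: power_mono)
  then have min: "energy F \<psi>1 - e\<^sup>2 \<le> energy F w" if "test_fun \<Omega> w" for w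
    using \<psi>(2)[OF that] by linarith
  have "\<bar>l2_inner M (grad (\<lambda>x. G x + \<psi>1 x)) (grad w)\<bar> \<le> e * l2_norm M (grad w)" if "test_fun \<Omega> w" for w
  proof -
    have "l2_inner M (grad (\<lambda>x. G x + \<psi>1 x)) (grad w) = l2_inner M (grad \<psi>1) (grad w) + F w"
      unfolding gradG[OF \<psi>1] F_def using Gs test_fun_square_integrable \<psi>1 that by (simp add: l2_inner_add_left)
    moreover have "\<bar>l2_inner M (grad \<psi>1) (grad w) + F w\<bar> \<le> e * l2_norm M (grad w)"
    proof (rule near_minimiser_almost_critical[of F])
      show "F (\<lambda>x. f x + t * g x) = F f + t * F g" if "test_fun \<Omega> f" "test_fun \<Omega> g" for f g t
        by (rule lin[OF that])
    qed (use min \<psi>1 that e in simp_all)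
    ultimately show ?thesis by (simp only:)
  qed
  with \<psi>1 le_2m show ?thesis by (rule that)
qed

lemma extension_with_bounded_laplacian:
  assumes \<phi>: "continuous_on (frontier \<Omega>) \<phi>"
  obtains \<Phi> :: "'a \<Rightarrow> real" where "continuous_on (closure \<Omega>) \<Phi>" "\<And>x. x \<in> frontier \<Omega> \<Longrightarrow> \<Phi> x = \<phi> x"
    "\<And>w. test_fun \<Omega> w \<Longrightarrow> \<bar>\<integral>x. \<Phi> x * laplacian w x \<partial>M\<bar> \<le> 2 * l2_norm M (grad w)"
proof -
  have cf: "compact (frontier \<Omega>)" using bounded_dom by (simp add: compact_frontier_bounded)
  have pos: "(1/2::real)^k > 0" for k by simp
  have "\<exists>p. real_polynomial_function p \<and> (\<forall>x\<in>frontier \<Omega>. \<bar>\<phi> x - p x\<bar> < (1/2)^k)" for k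
  proof -
    obtain q where "real_polynomial_function q" "\<And>x. x \<in> frontier \<Omega> \<Longrightarrow> \<bar>\<phi> x - q x\<bar> < (1/2)^k"
      using Stone_Weierstrass_real_polynomial_function[OF cf \<phi> pos] by blast
    then show ?thesis by blast
  qed
  then obtain p where p: "\<And>k. real_polynomial_function (p k)" "\<And>k x. x \<in> frontier \<Omega> \<Longrightarrow> \<bar>\<phi> x - p k x\<bar> < (1/2)^k"
    by metis
  have ps: "smooth_fun (p k)" for k by (rule smooth_fun_real_polynomial[OF p(1)])
  define G where "G k x = (case k of 0 \<Rightarrow> p 0 x | Suc j \<Rightarrow> p (Suc j) x - p j x)" for k x
  have G: "smooth_fun (G k)" for k
    unfolding G_def[abs_def] by (cases k) (auto intro: ps smooth_fun_diff)
  have Gsum: "(\<Sum>k<Suc n. G k x) = p n x" for n x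
    by (induction n) (auto simp: G_def)
  obtain B where B: "0 \<le> B" "\<And>x. x \<in> closure \<Omega> \<Longrightarrow> norm (p 0 x) \<le> B"
    using continuous_closure_bounded[OF C1_on_continuous[OF smooth_fun_C1_on[OF ps]]] by metis
  \<comment> \<open>On the frontier consecutive polynomials differ by less than (1/2)^(j+1) +
    (1/2)^j = 3 (1/2)^(j+1), and the term with k = 0 is at most \<open>B\<close>. The constant
    \<open>B + 4\<close> covers both cases strictly.\<close>
  define m where "m k = (B + 4) * (1/2)^k" for k :: nat
  have m0: "m k > 0" for k using B(1) by (simp add: m_def)
  have summ: "summable (\<lambda>k. 2 * m k)"
    unfolding m_def by (intro summable_mult summable_geometric) simp
  have Gm: "\<bar>G k x\<bar> < m k" if "x \<in> frontier \<Omega>" for k x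
  proof (cases k)
    case 0
    have "x \<in> closure \<Omega>" using that by (simp add: frontier_def)
    then show ?thesis using B(2)[of x] 0 by (simp add: G_def m_def)
  next
    case (Suc j)
    have "\<bar>p (Suc j) x - p j x\<bar> < (1/2)^Suc j + (1/2)^j"
      using p(2)[OF that, of "Suc j"] p(2)[OF that, of j] by linarith
    also have "\<dots> \<le> m k" using B(1) by (simp add: m_def Suc field_simps)
    finally show ?thesis by (simp add: G_def Suc)
  qed
  define Q where "Q k \<psi> \<longleftrightarrow> test_fun \<Omega> \<psi> \<and> (\<forall>x\<in>closure \<Omega>. \<bar>G k x + \<psi> x\<bar> \<le> 2 * m k) \<and>
      (\<forall>w. test_fun \<Omega> w \<longrightarrow> \<bar>l2_inner M (grad (\<lambda>x. G k x + \<psi> x)) (grad w)\<bar> \<le> (1/2)^k * l2_norm M (grad w))" for k \<psi>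
  have "\<exists>\<psi>. Q k \<psi>" for k
    unfolding Q_def by (rule bounded_almost_harmonic_extension[OF G Gm m0 pos]) blast+
  then obtain \<psi> where "\<And>k. Q k (\<psi> k)" by metis
  then have \<psi>: "\<And>k. test_fun \<Omega> (\<psi> k)" "\<And>k x. x \<in> closure \<Omega> \<Longrightarrow> \<bar>G k x + \<psi> k x\<bar> \<le> 2 * m k"
    "\<And>k w. test_fun \<Omega> w \<Longrightarrow> \<bar>l2_inner M (grad (\<lambda>x. G k x + \<psi> k x)) (grad w)\<bar> \<le> (1/2)^k * l2_norm M (grad w)"
    unfolding Q_def by blast+
  define P where "P k x = G k x + \<psi> k x" for k x
  have Ps: "smooth_fun (P k)" for k
    unfolding P_def using \<psi>(1) by (intro smooth_fun_add G) (simp add: test_fun_def)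
  have Pc: "continuous_on S (P k)" for k S by (rule C1_on_continuous[OF smooth_fun_C1_on[OF Ps]])
  have Pm: "norm (P k x) \<le> 2 * m k" if "x \<in> closure \<Omega>" for k x using \<psi>(2)[OF that] by (simp add: P_def)
  define \<Phi> where "\<Phi> x = (\<Sum>k. P k x)" for x
  define S where "S n x = (\<Sum>k<n. P k x)" for n x
  have ul: "uniform_limit (closure \<Omega>) S \<Phi> sequentially"
    unfolding S_def \<Phi>_def by (rule Weierstrass_m_test[OF Pm summ])
  have \<Phi>c: "continuous_on (closure \<Omega>) \<Phi>"
    by (rule uniform_limit_theorem[OF _ ul])
      (auto simp: S_def intro!: always_eventually continuous_on_sum Pc)
  have SL: "(\<lambda>n. S n x) \<longlonglongrightarrow> \<Phi> x" if "x \<in> closure \<Omega>" for x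
    by (rule tendsto_uniform_limitI[OF ul that])
  have \<Phi>b: "\<Phi> x = \<phi> x" if x: "x \<in> frontier \<Omega>" for x
  proof -
    have xc: "x \<in> closure \<Omega>" using x by (simp add: frontier_def)
    have "x \<notin> \<Omega>" using x open_dom by (simp add: frontier_def interior_open)
    then have "\<psi> k x = 0" for k using \<psi>(1)[of k] notin_support[of x "\<psi> k"] by (auto simp: test_fun_def)
    \<comment> \<open>At frontier points all corrections vanish and the differences
      telescope.\<close>
    then have "S (Suc n) x = p n x" for n unfolding S_def P_def using Gsum[of x n] by simp
    then have "(\<lambda>n. p n x) \<longlonglongrightarrow> \<Phi> x" using LIMSEQ_Suc[OF SL[OF xc]] by simp
    moreover have "(\<lambda>n. p n x) \<longlonglongrightarrow> \<phi> x"
    proof (rule LIMSEQ_I)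
      fix r :: real assume "r > 0"
      then obtain N where N: "(1/2)^N < r" using real_arch_pow_inv[of r "1/2"] by auto
      have "norm (p n x - \<phi> x) < r" if "n \<ge> N" for n
      proof -
        have "(1/2::real)^n \<le> (1/2)^N" using that by (intro power_decreasing) auto
        then show ?thesis using p(2)[OF x, of n] N unfolding real_norm_def by linarith
      qed
      then show "\<exists>no. \<forall>n\<ge>no. norm (p n x - \<phi> x) < r" by blast
    qed
    ultimately show ?thesis by (rule LIMSEQ_unique)
  qed
  have "\<bar>\<integral>x. \<Phi> x * laplacian w x \<partial>M\<bar> \<le> 2 * l2_norm M (grad w)" if w: "test_fun \<Omega> w" for w
  proof -
    note lw = test_fun_square_integrable(3)[OF w]
    have lmeas [measurable]: "laplacian w \<in> borel_measurable M" by (rule square_integrable_measurable[OF lw])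
    have clo: "x \<in> closure \<Omega>" if "x \<in> \<Omega>" for x using that closure_subset by blast
    have PI: "integrable M (\<lambda>x. P k x * laplacian w x)" for k
      using square_integrable_inner[OF square_integrable_continuous_closure[OF Pc] lw] by simp
    have [measurable]: "P k \<in> borel_measurable M" "\<Phi> \<in> borel_measurable M" for k
      by (auto intro!: square_integrable_measurable square_integrable_continuous_closure Pc \<Phi>c)
    have "integrable M (\<lambda>x. norm (laplacian w x))"
      by (rule integrable_norm[OF square_integrable_integrable[OF lw]])
    have SI: "(\<integral>x. S n x * laplacian w x \<partial>M) = - (\<Sum>k<n. l2_inner M (grad (P k)) (grad w))" for n
    proof -
      have "(\<integral>x. S n x * laplacian w x \<partial>M) = (\<integral>x. (\<Sum>k<n. P k x * laplacian w x) \<partial>M)"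
        by (simp add: S_def sum_distrib_right)
      also have "\<dots> = (\<Sum>k<n. \<integral>x. P k x * laplacian w x \<partial>M)"
        by (intro Bochner_Integration.integral_sum PI)
      also have "\<dots> = - (\<Sum>k<n. l2_inner M (grad (P k)) (grad w))"
        unfolding sum_negf[symmetric] using Green_test_fun[OF smooth_fun_C1_on[OF Ps] w] by (intro sum.cong) auto
      finally show ?thesis .
    qed
    have geo: "(\<Sum>k<n. (1/2::real)^k) \<le> 2" for n
      using sum_le_suminf[OF summable_geometric[of "1/2::real"], of "{..<n}"] suminf_geometric[of "1/2::real"] by simp
    have le: "\<bar>\<integral>x. S n x * laplacian w x \<partial>M\<bar> \<le> 2 * l2_norm M (grad w)" for n
    proof -
      have "\<bar>\<integral>x. S n x * laplacian w x \<partial>M\<bar> \<le> (\<Sum>k<n. \<bar>l2_inner M (grad (P k)) (grad w)\<bar>)"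
        unfolding SI by (simp add: sum_abs)
      also have "\<dots> \<le> (\<Sum>k<n. (1/2)^k * l2_norm M (grad w))"
        unfolding P_def by (intro sum_mono \<psi>(3) w)
      also have "\<dots> \<le> 2 * l2_norm M (grad w)"
        unfolding sum_distrib_right[symmetric] by (intro mult_right_mono geo l2_norm_nonneg)
      finally show ?thesis .
    qed
    have "(\<lambda>n. \<integral>x. S n x * laplacian w x \<partial>M) \<longlonglongrightarrow> (\<integral>x. \<Phi> x * laplacian w x \<partial>M)"
    proof (rule integral_dominated_convergence)
      show "integrable M (\<lambda>x. (\<Sum>k. 2 * m k) * norm (laplacian w x))"
        using \<open>integrable M (\<lambda>x. norm (laplacian w x))\<close> by (intro integrable_mult_right)
      show "AE x in M. (\<lambda>n. S n x * laplacian w x) \<longlonglongrightarrow> \<Phi> x * laplacian w x"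
        by (intro AE_I2 tendsto_mult_right SL clo) simp
      show "AE x in M. norm (S n x * laplacian w x) \<le> (\<Sum>k. 2 * m k) * norm (laplacian w x)" for n
      proof (rule AE_I2)
        fix x assume "x \<in> space M"
        then have x: "x \<in> closure \<Omega>" using clo by simp
        have "norm (S n x) \<le> (\<Sum>k<n. norm (P k x))" unfolding S_def by (rule norm_sum)
        also have "\<dots> \<le> (\<Sum>k<n. 2 * m k)" by (intro sum_mono Pm x)
        also have "\<dots> \<le> (\<Sum>k. 2 * m k)" using m0 by (intro sum_le_suminf summ) (auto intro: less_imp_le)
        finally show "norm (S n x * laplacian w x) \<le> (\<Sum>k. 2 * m k) * norm (laplacian w x)"
          unfolding norm_mult by (rule mult_right_mono) simp
      qed
    qed (auto simp: S_def)
    then show ?thesis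
      by (intro LIMSEQ_le_const2[OF tendsto_rabs]) (use le in auto)
  qed
  then show ?thesis using that \<Phi>c \<Phi>b by blast
qed

text \<open>The gradients of ever better near-minimisers form a Cauchy sequence, and by Poincare's
  inequality so do the functions. Almost-criticality becomes exact in the limit: since the inner
  product of \<open>grad (\<psi> n)\<close> and \<open>grad w\<close> is minus the integral of
  \<psi> n \<Delta>w, the limit \<open>h\<close> has the same weak Laplacian as \<Phi>.\<close>

lemma Dirichlet_correction:
  assumes \<Phi>: "continuous_on (closure \<Omega>) \<Phi>"
    and bound: "\<And>w. test_fun \<Omega> w \<Longrightarrow> \<bar>\<integral>x. \<Phi> x * laplacian w x \<partial>M\<bar> \<le> C * l2_norm M (grad w)"
  obtains \<psi> h g where "\<And>n. test_fun \<Omega> (\<psi> n)" "square_integrable M h" "square_integrable M g"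
    "(\<lambda>n. l2_norm M (\<lambda>x. \<psi> n x - h x)) \<longlonglongrightarrow> 0" "(\<lambda>n. l2_norm M (\<lambda>x. grad (\<psi> n) x - g x)) \<longlonglongrightarrow> 0"
    "\<And>w. test_fun \<Omega> w \<Longrightarrow> (\<integral>x. (\<Phi> x - h x) * laplacian w x \<partial>M) = 0"
proof -
  define F where "F w = (\<integral>x. \<Phi> x * laplacian w x \<partial>M)" for w
  note \<Phi>s = square_integrable_continuous_closure[OF \<Phi>]
  have Fip: "F w = l2_inner M \<Phi> (laplacian w)" for w by (simp add: F_def l2_inner_def)
  have lin: "F (\<lambda>x. f x + t * g x) = F f + t * F g" if "test_fun \<Omega> f" "test_fun \<Omega> g" for f g t
  proof -
    have s: "smooth_fun f" "smooth_fun g" "smooth_fun (\<lambda>x. t * g x)"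
      using that by (auto simp: test_fun_def intro: smooth_fun_mult)
    have "laplacian (\<lambda>x. f x + t * g x) = (\<lambda>x. laplacian f x + t *\<^sub>R laplacian g x)"
      by (rule ext) (simp add: laplacian_add[OF s(1,3)] laplacian_cmult[OF s(2)])
    then show ?thesis
      unfolding Fip using \<Phi>s that
      by (simp add: l2_inner_add_right square_integrable_scaleR test_fun_square_integrable l2_inner_scaleR_right del: real_scaleR_def)
  qed
  have "\<exists>\<psi>. test_fun \<Omega> \<psi> \<and> (\<forall>w. test_fun \<Omega> w \<longrightarrow> \<bar>l2_inner M (grad \<psi>) (grad w) + F w\<bar> \<le> inverse (real (Suc n)) * l2_norm M (grad w))" for n
  proof -
    obtain \<psi> where \<psi>: "test_fun \<Omega> \<psi>" "\<And>w. test_fun \<Omega> w \<Longrightarrow> energy F \<psi> - (inverse (real (Suc n)))\<^sup>2 \<le> energy F w"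
      using near_minimiser_exists[of F C "inverse (real (Suc n))"] bound unfolding F_def by auto
    have "\<bar>l2_inner M (grad \<psi>) (grad w) + F w\<bar> \<le> inverse (real (Suc n)) * l2_norm M (grad w)" if "test_fun \<Omega> w" for w
    proof (rule near_minimiser_almost_critical[of F])
      show "F (\<lambda>x. f x + t * g x) = F f + t * F g" if "test_fun \<Omega> f" "test_fun \<Omega> g" for f g t
        by (rule lin[OF that])
      show "energy F \<psi> - (inverse (real (Suc n)))\<^sup>2 \<le> energy F w" if "test_fun \<Omega> w" for w
        by (rule \<psi>(2)[OF that])
    qed (use \<psi>(1) that in auto)
    with \<psi>(1) show ?thesis by blast
  qed
  then obtain \<psi> where \<psi>: "\<And>n. test_fun \<Omega> (\<psi> n)"
    "\<And>n w. test_fun \<Omega> w \<Longrightarrow> \<bar>l2_inner M (grad (\<psi> n)) (grad w) + F w\<bar> \<le> inverse (real (Suc n)) * l2_norm M (grad w)"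
    by metis
  note sq = test_fun_square_integrable[OF \<psi>(1)]
  \<comment> \<open>The difference of two near-minimisers is itself an admissible \<open>w\<close>.
    Subtracting the two criticality estimates bounds the square of its gradient norm by the sum of
    the tolerances times that norm.\<close>
  have diff: "l2_norm M (\<lambda>x. grad (\<psi> m) x - grad (\<psi> n) x) \<le> inverse (real (Suc m)) + inverse (real (Suc n))" for m n
  proof -
    define w where "w x = \<psi> m x - \<psi> n x" for x
    have w: "test_fun \<Omega> w" unfolding w_def by (intro test_fun_diff \<psi>)
    have gw: "grad w = (\<lambda>x. grad (\<psi> m) x - grad (\<psi> n) x)" unfolding w_def by (intro grad_diff_test_fun \<psi>)
    have "(l2_norm M (grad w))\<^sup>2 = l2_inner M (grad (\<psi> m)) (grad w) - l2_inner M (grad (\<psi> n)) (grad w)"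
      unfolding l2_norm_power2 using test_fun_square_integrable(2)[OF w] sq
      by (subst (1) gw) (simp add: l2_inner_diff_left)
    also have "\<dots> \<le> (inverse (real (Suc m)) + inverse (real (Suc n))) * l2_norm M (grad w)"
      using \<psi>(2)[OF w, of m] \<psi>(2)[OF w, of n] unfolding distrib_right by linarith
    finally have "l2_norm M (grad w) * l2_norm M (grad w) \<le> l2_norm M (grad w) * (inverse (real (Suc m)) + inverse (real (Suc n)))"
      by (simp only: power2_eq_square mult.commute)
    then have "l2_norm M (grad w) \<le> inverse (real (Suc m)) + inverse (real (Suc n))"
      by (cases "l2_norm M (grad w) = 0") (auto simp: mult_le_cancel_left order_less_le)
    then show ?thesis by (simp add: gw)
  qed
  have small: "\<exists>N. \<forall>m\<ge>N. \<forall>n\<ge>N. l2_norm M (\<lambda>x. grad (\<psi> m) x - grad (\<psi> n) x) \<le> e" if e: "e > 0" for e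
  proof -
    obtain N where N: "inverse (real (Suc N)) < e / 2" using reals_Archimedean[OF half_gt_zero[OF e]] by blast
    have "l2_norm M (\<lambda>x. grad (\<psi> m) x - grad (\<psi> n) x) \<le> e" if "m \<ge> N" "n \<ge> N" for m n
    proof -
      have "inverse (real (Suc k)) \<le> inverse (real (Suc N))" if "k \<ge> N" for k
        using that by (intro le_imp_inverse_le) auto
      from this[OF that(1)] this[OF that(2)] show ?thesis using diff[of m n] N by linarith
    qed
    then show ?thesis by blast
  qed
  obtain g where g: "square_integrable M g" "(\<lambda>n. l2_norm M (\<lambda>x. grad (\<psi> n) x - g x)) \<longlonglongrightarrow> 0"
    using square_integrable_complete[OF sq(2) small] by blast
  obtain c where c: "c > 0" "\<And>f. C1_compact \<Omega> f \<Longrightarrow> l2_norm M f \<le> c * l2_norm M (grad f)"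
    using Poincare by blast
  have small': "\<exists>N. \<forall>m\<ge>N. \<forall>n\<ge>N. l2_norm M (\<lambda>x. \<psi> m x - \<psi> n x) \<le> e" if "e > 0" for e
  proof -
    have "e / c > 0" using that c(1) by simp
    from small[OF this] obtain N where N: "\<And>m n. m \<ge> N \<Longrightarrow> n \<ge> N \<Longrightarrow> l2_norm M (\<lambda>x. grad (\<psi> m) x - grad (\<psi> n) x) \<le> e / c"
      by blast
    have "l2_norm M (\<lambda>x. \<psi> m x - \<psi> n x) \<le> e" if "m \<ge> N" "n \<ge> N" for m n
    proof -
      have "l2_norm M (\<lambda>x. \<psi> m x - \<psi> n x) \<le> c * l2_norm M (grad (\<lambda>x. \<psi> m x - \<psi> n x))"
        by (intro c(2) test_fun_C1_compact test_fun_diff \<psi>)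
      also have "\<dots> = c * l2_norm M (\<lambda>x. grad (\<psi> m) x - grad (\<psi> n) x)" by (simp add: grad_diff_test_fun[OF \<psi>(1) \<psi>(1)])
      also have "\<dots> \<le> c * (e / c)" using N[OF that] c(1) by (intro mult_left_mono) auto
      finally show ?thesis using c(1) by simp
    qed
    then show ?thesis by blast
  qed
  obtain h where h: "square_integrable M h" "(\<lambda>n. l2_norm M (\<lambda>x. \<psi> n x - h x)) \<longlonglongrightarrow> 0"
    using square_integrable_complete[of M \<psi>, OF sq(1) small'] by blast
  show ?thesis
  proof (rule that[OF \<psi>(1) h(1) g(1) h(2) g(2)])
    fix w assume w: "test_fun \<Omega> w"
    note lw = test_fun_square_integrable(3)[OF w]
    have "(\<lambda>n. inverse (real (Suc n)) * l2_norm M (grad w)) \<longlonglongrightarrow> 0"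
      by (intro tendsto_mult_left_zero LIMSEQ_inverse_real_of_nat)
    then have "(\<lambda>n. l2_inner M (grad (\<psi> n)) (grad w) + F w) \<longlonglongrightarrow> 0"
      by (rule Lim_null_comparison[rotated]) (use \<psi>(2)[OF w] in auto)
    moreover have "l2_inner M (grad (\<psi> n)) (grad w) = - l2_inner M (\<psi> n) (laplacian w)" for n
      using Green_test_fun[OF C1_on_subset w, of UNIV "\<psi> n"] \<psi>(1)[of n]
      by (simp add: l2_inner_def test_fun_def smooth_fun_C1_on)
    moreover have "(\<lambda>n. - l2_inner M (\<psi> n) (laplacian w) + F w) \<longlonglongrightarrow> - l2_inner M h (laplacian w) + F w"
      by (intro tendsto_intros tendsto_l2_inner_left sq h lw)
    ultimately have "- l2_inner M h (laplacian w) + F w = 0" using LIMSEQ_unique by fastforce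
    moreover have "(\<integral>x. (\<Phi> x - h x) * laplacian w x \<partial>M) = l2_inner M (\<lambda>x. \<Phi> x - h x) (laplacian w)"
      by (simp add: l2_inner_def)
    ultimately show "(\<integral>x. (\<Phi> x - h x) * laplacian w x \<partial>M) = 0"
      using \<Phi>s h(1) lw by (simp add: l2_inner_diff_left Fip)
  qed
qed

text \<open>Integration by parts holds for each \<psi> n, and both sides are continuous under L2
  convergence.\<close>

lemma weak_gradient_limit:
  assumes "\<And>n. test_fun \<Omega> (\<psi> n)" "square_integrable M h" "square_integrable M g"
    "(\<lambda>n. l2_norm M (\<lambda>x. \<psi> n x - h x)) \<longlonglongrightarrow> 0" "(\<lambda>n. l2_norm M (\<lambda>x. grad (\<psi> n) x - g x)) \<longlonglongrightarrow> 0"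
  shows "weak_gradient \<Omega> h g"
  unfolding weak_gradient_def
proof (intro allI impI ballI)
  fix w and i :: 'a assume w: "test_fun \<Omega> w" and i: "i \<in> Basis"
  note sq = test_fun_square_integrable[OF assms(1)] test_fun_square_integrable[OF w]
  \<comment> \<open>The vector field w i picks out the i-th component of a gradient, so the
    vector-valued limit lemma applies unchanged.\<close>
  have wi: "square_integrable M (\<lambda>x. w x *\<^sub>R i)"
  proof -
    have "(\<lambda>x. w x *\<^sub>R i) \<in> borel_measurable M" using square_integrable_measurable[OF sq(5)] by measurable
    then show ?thesis using sq(5) i by (simp add: square_integrable_def)
  qed
  have "l2_inner M (\<psi> n) (dderiv i w) = - l2_inner M (grad (\<psi> n)) (\<lambda>x. w x *\<^sub>R i)" for n
    using integration_by_parts(3)[OF smooth_fun_C1_on test_fun_C1_compact[OF w] i, of "\<psi> n"] assms(1)[of n] i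
    by (simp add: test_fun_def l2_inner_def grad_inner_Basis mult.commute)
  then have "(\<lambda>n. - l2_inner M (grad (\<psi> n)) (\<lambda>x. w x *\<^sub>R i)) \<longlonglongrightarrow> l2_inner M h (dderiv i w)"
    using tendsto_l2_inner_left[OF sq(1) assms(2) sq(8)[OF i] assms(4)] by simp
  moreover have "(\<lambda>n. - l2_inner M (grad (\<psi> n)) (\<lambda>x. w x *\<^sub>R i)) \<longlonglongrightarrow> - l2_inner M g (\<lambda>x. w x *\<^sub>R i)"
    by (intro tendsto_minus tendsto_l2_inner_left sq assms wi)
  ultimately have "l2_inner M h (dderiv i w) = - l2_inner M g (\<lambda>x. w x *\<^sub>R i)" by (rule LIMSEQ_unique)
  then show "(\<integral>x. h x * dderiv i w x \<partial>M) = - (\<integral>x. (g x \<bullet> i) * w x \<partial>M)"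
    by (simp add: l2_inner_def mult.commute)
qed

end

section \<open>Parametric integrals and radial kernels\<close>

lemma integrable_mult_bounded:
  fixes v q :: "'y \<Rightarrow> real"
  assumes "integrable M v" "q \<in> borel_measurable M" "\<And>y. y \<in> space M \<Longrightarrow> \<bar>q y\<bar> \<le> B"
  shows "integrable M (\<lambda>y. v y * q y)"
proof (rule Bochner_Integration.integrable_bound)
  show "integrable M (\<lambda>y. B * v y)" using assms(1) by simp
  show "(\<lambda>y. v y * q y) \<in> borel_measurable M" using assms(1,2) by measurable
  have "norm (v y * q y) \<le> norm (B * v y)" if "y \<in> space M" for y
  proof -
    have "\<bar>v y\<bar> * \<bar>q y\<bar> \<le> \<bar>v y\<bar> * \<bar>B\<bar>" using assms(3)[OF that] by (intro mult_left_mono) auto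
    then show ?thesis by (simp add: abs_mult mult.commute)
  qed
  then show "AE y in M. norm (v y * q y) \<le> norm (B * v y)" by (rule AE_I2)
qed

text \<open>Differentiation under the integral sign for a merely integrable \<open>v\<close>. The
  mean value inequality on the ball gives a Lipschitz constant \<open>L\<close>, so the normalised
  remainder is dominated by 2 L |v|. A bound on \<open>k\<close> itself at \<open>p0\<close>
  suffices, as the Lipschitz estimate spreads it over the ball.\<close>

lemma has_derivative_parametric_integral:
  fixes k :: "'p::euclidean_space \<Rightarrow> 'y \<Rightarrow> real"
  assumes v: "integrable M v" and r: "r > 0"
    and meas: "\<And>p. k p \<in> borel_measurable M" "\<And>h. (\<lambda>y. D p0 y h) \<in> borel_measurable M"
    and deriv: "\<And>y p. y \<in> space M \<Longrightarrow> p \<in> ball p0 r \<Longrightarrow> ((\<lambda>p. k p y) has_derivative D p y) (at p)"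
    and bound: "\<And>y p h. y \<in> space M \<Longrightarrow> p \<in> ball p0 r \<Longrightarrow> \<bar>D p y h\<bar> \<le> L * norm h"
    and bound0: "\<And>y. y \<in> space M \<Longrightarrow> \<bar>k p0 y\<bar> \<le> B"
  shows "((\<lambda>p. \<integral>y. v y * k p y \<partial>M) has_derivative (\<lambda>h. \<integral>y. v y * D p0 y h \<partial>M)) (at p0)"
proof -
  have [measurable]: "v \<in> borel_measurable M" "\<And>p. k p \<in> borel_measurable M" "\<And>h. (\<lambda>y. D p0 y h) \<in> borel_measurable M"
    using v meas by auto
  have p0: "p0 \<in> ball p0 r" using r by simp
  have lip: "\<bar>k (p0 + h) y - k p0 y\<bar> \<le> L * norm h" if "y \<in> space M" "norm h < r" for y h
  proof -
    have "norm (k (p0 + h) y - k p0 y) \<le> L * norm ((p0 + h) - p0)"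
    proof (rule differentiable_bound[of "ball p0 r" "\<lambda>p. k p y" "\<lambda>p. D p y" L])
      fix p assume p: "p \<in> ball p0 r"
      show "((\<lambda>p. k p y) has_derivative D p y) (at p within ball p0 r)"
        using deriv[OF that(1) p] by (rule has_derivative_at_withinI)
      show "onorm (D p y) \<le> L"
        by (rule onorm_le) (use bound[OF that(1) p] in simp)
    qed (use that r in \<open>auto simp: dist_norm\<close>)
    then show ?thesis by simp
  qed
  have intD: "integrable M (\<lambda>y. v y * D p0 y h)" for h
    by (rule integrable_mult_bounded[OF v meas(2)]) (rule bound[OF _ p0])
  have intk0: "integrable M (\<lambda>y. v y * k p0 y)"
    by (rule integrable_mult_bounded[OF v meas(1)]) (rule bound0)
  have intk: "integrable M (\<lambda>y. v y * k (p0 + h) y)" if "norm h < r" for h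
  proof -
    have "\<bar>k (p0 + h) y\<bar> \<le> L * norm h + B" if "y \<in> space M" for y
      using lip[OF that \<open>norm h < r\<close>] bound0[OF that] by linarith
    then show ?thesis by (rule integrable_mult_bounded[OF v meas(1)])
  qed
  have lin: "linear (D p0 y)" if "y \<in> space M" for y
    using deriv[OF that p0] has_derivative_linear by blast
  show ?thesis
    unfolding has_derivative_at
  proof
    show "bounded_linear (\<lambda>h. \<integral>y. v y * D p0 y h \<partial>M)"
    proof (rule bounded_linear_intro)
      fix g h :: 'p and c :: real
      have "(\<integral>y. v y * D p0 y (g + h) \<partial>M) = (\<integral>y. v y * D p0 y g + v y * D p0 y h \<partial>M)"
        by (intro Bochner_Integration.integral_cong refl) (simp add: linear_add[OF lin] algebra_simps)
      then show "(\<integral>y. v y * D p0 y (g + h) \<partial>M) = (\<integral>y. v y * D p0 y g \<partial>M) + (\<integral>y. v y * D p0 y h \<partial>M)"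
        by (simp add: intD)
      have "(\<integral>y. v y * D p0 y (c *\<^sub>R h) \<partial>M) = (\<integral>y. c * (v y * D p0 y h) \<partial>M)"
        by (intro Bochner_Integration.integral_cong refl) (simp add: linear_scale[OF lin])
      then show "(\<integral>y. v y * D p0 y (c *\<^sub>R h) \<partial>M) = c *\<^sub>R (\<integral>y. v y * D p0 y h \<partial>M)" by simp
      have "norm (\<integral>y. v y * D p0 y h \<partial>M) \<le> (\<integral>y. \<bar>v y\<bar> * (L * norm h) \<partial>M)"
      proof -
        have "norm (\<integral>y. v y * D p0 y h \<partial>M) \<le> (\<integral>y. norm (v y * D p0 y h) \<partial>M)"
          by (rule Bochner_Integration.integral_norm_bound)
        also have "\<dots> \<le> (\<integral>y. \<bar>v y\<bar> * (L * norm h) \<partial>M)"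
        proof (rule integral_mono)
          show "integrable M (\<lambda>y. norm (v y * D p0 y h))" by (rule integrable_norm[OF intD])
          show "integrable M (\<lambda>y. \<bar>v y\<bar> * (L * norm h))" using v by simp
          show "norm (v y * D p0 y h) \<le> \<bar>v y\<bar> * (L * norm h)" if "y \<in> space M" for y
            using bound[OF that p0, of h] by (simp add: abs_mult mult_left_mono)
        qed
        finally show ?thesis .
      qed
      also have "\<dots> = norm h * ((\<integral>y. \<bar>v y\<bar> \<partial>M) * L)" by simp
      finally show "norm (\<integral>y. v y * D p0 y h \<partial>M) \<le> norm h * ((\<integral>y. \<bar>v y\<bar> \<partial>M) * L)" .
    qed
    show "(\<lambda>h. norm ((\<integral>y. v y * k (p0 + h) y \<partial>M) - (\<integral>y. v y * k p0 y \<partial>M) - (\<integral>y. v y * D p0 y h \<partial>M)) / norm h) \<midarrow>0\<rightarrow> 0"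
      unfolding tendsto_at_iff_sequentially
    proof (intro allI impI)
      fix X :: "nat \<Rightarrow> 'p" assume X: "\<forall>i. X i \<in> UNIV - {0}" "X \<longlonglongrightarrow> 0"
      \<comment> \<open>The increments lie in the ball only from some index on, so the sequence is
        shifted.\<close>
      obtain N where N: "\<And>n. n \<ge> N \<Longrightarrow> norm (X n) < r" using LIMSEQ_D[OF X(2) r] by auto
      define Y where "Y n = X (n + N)" for n
      have Y: "Y n \<noteq> 0" "norm (Y n) < r" for n using X(1) N by (auto simp: Y_def)
      have Y0: "Y \<longlonglongrightarrow> 0" unfolding Y_def by (rule LIMSEQ_ignore_initial_segment[OF X(2)])
      \<comment> \<open>|v| times the normalised remainder: it tends to 0 at each point by
        differentiability in the parameter.\<close>
      define s where "s n y = \<bar>v y\<bar> * (\<bar>k (p0 + Y n) y - k p0 y - D p0 y (Y n)\<bar> / norm (Y n))" for n y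
      have [measurable]: "s n \<in> borel_measurable M" for n unfolding s_def by measurable
      have sb: "norm (s n y) \<le> \<bar>v y\<bar> * (2 * L)" if "y \<in> space M" for n y
      proof -
        have "\<bar>k (p0 + Y n) y - k p0 y - D p0 y (Y n)\<bar> \<le> 2 * L * norm (Y n)"
          using lip[OF that Y(2)[of n]] bound[OF that p0, of "Y n"] unfolding mult.assoc by linarith
        then have "\<bar>k (p0 + Y n) y - k p0 y - D p0 y (Y n)\<bar> / norm (Y n) \<le> 2 * L"
          using Y(1)[of n] by (simp add: divide_le_eq)
        from mult_left_mono[OF this abs_ge_zero[of "v y"]] show ?thesis unfolding s_def by (simp add: abs_mult)
      qed
      have "(\<lambda>n. integral\<^sup>L M (s n)) \<longlonglongrightarrow> (\<integral>y. 0 \<partial>M)"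
      proof (rule integral_dominated_convergence)
        show "integrable M (\<lambda>y. \<bar>v y\<bar> * (2 * L))" using v by simp
        show "AE y in M. (\<lambda>n. s n y) \<longlonglongrightarrow> 0"
        proof (rule AE_I2)
          fix y assume y: "y \<in> space M"
          have "(\<lambda>h. norm (k (p0 + h) y - k p0 y - D p0 y h) / norm h) \<midarrow>0\<rightarrow> 0"
            using deriv[OF y p0] unfolding has_derivative_at by blast
          moreover have "filterlim Y (at 0) sequentially" using Y0 Y(1) by (simp add: filterlim_at)
          ultimately have "(\<lambda>n. norm (k (p0 + Y n) y - k p0 y - D p0 y (Y n)) / norm (Y n)) \<longlonglongrightarrow> 0"
            by (rule filterlim_compose)
          then show "(\<lambda>n. s n y) \<longlonglongrightarrow> 0" unfolding s_def real_norm_def by (rule tendsto_mult_right_zero)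
        qed
        show "AE y in M. norm (s n y) \<le> \<bar>v y\<bar> * (2 * L)" for n by (intro AE_I2 sb)
      qed auto
      then have lim: "(\<lambda>n. integral\<^sup>L M (s n)) \<longlonglongrightarrow> 0" by simp
      have le: "norm ((\<integral>y. v y * k (p0 + Y n) y \<partial>M) - (\<integral>y. v y * k p0 y \<partial>M) - (\<integral>y. v y * D p0 y (Y n) \<partial>M)) / norm (Y n)
          \<le> integral\<^sup>L M (s n)" for n
      proof -
        have "(\<integral>y. v y * k (p0 + Y n) y \<partial>M) - (\<integral>y. v y * k p0 y \<partial>M) - (\<integral>y. v y * D p0 y (Y n) \<partial>M)
            = (\<integral>y. v y * (k (p0 + Y n) y - k p0 y - D p0 y (Y n)) \<partial>M)"
          using intk[OF Y(2), of n] intk0 intD[of "Y n"] by (simp add: right_diff_distrib)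
        also have "norm \<dots> \<le> (\<integral>y. norm (v y * (k (p0 + Y n) y - k p0 y - D p0 y (Y n))) \<partial>M)"
          by (rule Bochner_Integration.integral_norm_bound)
        also have "\<dots> = (\<integral>y. norm (Y n) * s n y \<partial>M)"
          using Y(1)[of n] by (intro Bochner_Integration.integral_cong refl) (simp add: s_def abs_mult)
        also have "\<dots> = norm (Y n) * integral\<^sup>L M (s n)" by simp
        finally show ?thesis using Y(1)[of n] by (simp add: divide_le_eq mult.commute)
      qed
      have "(\<lambda>n. norm ((\<integral>y. v y * k (p0 + Y n) y \<partial>M) - (\<integral>y. v y * k p0 y \<partial>M) - (\<integral>y. v y * D p0 y (Y n) \<partial>M)) / norm (Y n)) \<longlonglongrightarrow> 0"
        by (rule Lim_null_comparison[OF _ lim]) (use le in auto)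
      then show "((\<lambda>h. norm ((\<integral>y. v y * k (p0 + h) y \<partial>M) - (\<integral>y. v y * k p0 y \<partial>M) - (\<integral>y. v y * D p0 y h \<partial>M)) / norm h) \<circ> X) \<longlonglongrightarrow> 0"
        unfolding Y_def by (simp add: o_def) (rule LIMSEQ_offset)
    qed
  qed
qed

section \<open>Radial kernels and their Laplacians\<close>

definition exp_recip_deriv :: "real poly \<Rightarrow> real poly" where
  "exp_recip_deriv p = [:0, 0, 1:] * (p - pderiv p)"

text \<open>For positive \<tau> the kernel lives on the ball of radius 1 / sqrt \<tau>. The scale
  enters as an inverse squared radius because 1 - \<tau> |z|^2 is affine in \<tau>: derivatives in
  \<tau> and in z then lead to the same profile.\<close>

definition bump_kernel :: "real poly \<Rightarrow> real \<Rightarrow> 'a::euclidean_space \<Rightarrow> real" where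
  "bump_kernel p \<tau> z = exp_recip p (1 - \<tau> * (norm z)\<^sup>2)"

lemma exp_recip_has_derivative:
  "(exp_recip p has_real_derivative exp_recip (exp_recip_deriv p) t) (at t)"
  unfolding exp_recip_deriv_def by (rule exp_recip_derivative)

lemma exp_recip_bounded:
  obtains B where "0 \<le> B" "\<And>t. t \<le> 1 \<Longrightarrow> \<bar>exp_recip p t\<bar> \<le> B"
proof -
  have "continuous_on {0..1} (exp_recip p)"
    using smooth_fun_isCont[OF smooth_exp_recip] by (simp add: continuous_at_imp_continuous_on)
  then obtain B where "0 \<le> B" "\<And>t. t \<in> {..1} \<Longrightarrow> norm (exp_recip p t) \<le> B"
    by (rule compact_support_bounded[OF compact_Icc, where S="{..1}"]) (auto simp: exp_recip_def)
  then show ?thesis using that by auto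
qed

lemma kernel_bounded:
  obtains B where "0 \<le> B" "\<And>\<tau> z::'a::euclidean_space. 0 \<le> \<tau> \<Longrightarrow> \<bar>bump_kernel p \<tau> z\<bar> \<le> B"
proof -
  obtain B where B: "0 \<le> B" "\<And>t. t \<le> 1 \<Longrightarrow> \<bar>exp_recip p t\<bar> \<le> B" using exp_recip_bounded by blast
  show ?thesis by (rule that[OF B(1)]) (simp add: bump_kernel_def B(2))
qed

lemma smooth_kernel: "smooth_fun (bump_kernel p \<tau>)"
proof -
  have "smooth_fun (\<lambda>z::'a. exp_recip p (1 - \<tau> * (norm (z - 0))\<^sup>2))"
    by (intro smooth_fun_compose[OF smooth_exp_recip] smooth_fun_diff smooth_fun_mult smooth_fun_const smooth_fun_norm_power2)
  then show ?thesis by (simp add: bump_kernel_def[abs_def])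
qed

lemma smooth_kernel_shift: "smooth_fun (\<lambda>y. bump_kernel p \<tau> (x - y))"
proof -
  have "smooth_fun (\<lambda>y. exp_recip p (1 - \<tau> * (norm (y - x))\<^sup>2))"
    by (intro smooth_fun_compose[OF smooth_exp_recip] smooth_fun_diff smooth_fun_mult smooth_fun_const smooth_fun_norm_power2)
  then show ?thesis by (simp add: bump_kernel_def[abs_def] norm_minus_commute)
qed

lemma kernel_eq_0:
  assumes "r > 0" "1 / r\<^sup>2 \<le> \<tau>" "norm z \<ge> r"
  shows "bump_kernel p \<tau> z = 0"
proof -
  have "1 / r\<^sup>2 * r\<^sup>2 \<le> \<tau> * (norm z)\<^sup>2"
    using assms by (intro mult_mono power_mono) (auto intro: order_trans[OF _ assms(2)])
  then show ?thesis using assms(1) by (simp add: bump_kernel_def exp_recip_def)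
qed

lemma support_subset_cball:
  fixes f :: "'a::euclidean_space \<Rightarrow> real"
  assumes "\<And>y. y \<notin> cball x r \<Longrightarrow> f y = 0"
  shows "support f \<subseteq> cball x r" "compact (support f)"
proof -
  show "support f \<subseteq> cball x r" by (rule closure_minimal) (use assms in blast, rule closed_cball)
  then show "compact (support f)" by (rule compact_subset[OF compact_cball closed_closure])
qed

lemma test_fun_kernel:
  assumes "r > 0" "1 / r\<^sup>2 \<le> \<tau>"
  shows "test_fun UNIV (bump_kernel p \<tau>)" "cball x r \<subseteq> \<Omega> \<Longrightarrow> test_fun \<Omega> (\<lambda>y. bump_kernel p \<tau> (x - y))"
proof -
  have "support (bump_kernel p \<tau> :: 'a \<Rightarrow> real) \<subseteq> cball 0 r" "compact (support (bump_kernel p \<tau> :: 'a \<Rightarrow> real))"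
    by (rule support_subset_cball[of 0 r], rule kernel_eq_0[OF assms], simp)+
  then show "test_fun UNIV (bump_kernel p \<tau> :: 'a \<Rightarrow> real)" by (simp add: test_fun_def smooth_kernel)
  have "support (\<lambda>y. bump_kernel p \<tau> (x - y)) \<subseteq> cball x r" "compact (support (\<lambda>y. bump_kernel p \<tau> (x - y)))"
    by (rule support_subset_cball[of x r], rule kernel_eq_0[OF assms], simp add: dist_norm)+
  then show "test_fun \<Omega> (\<lambda>y. bump_kernel p \<tau> (x - y))" if "cball x r \<subseteq> \<Omega>"
    using that by (auto simp: test_fun_def smooth_kernel_shift)
qed

lemma has_derivative_kernel:
  "(bump_kernel p \<tau> has_derivative (\<lambda>h. bump_kernel (exp_recip_deriv p) \<tau> z * (- 2 * \<tau> * (z \<bullet> h)))) (at z)"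
proof -
  have "((\<lambda>z. 1 - \<tau> * (z \<bullet> z)) has_derivative (\<lambda>h. - 2 * \<tau> * (z \<bullet> h))) (at z)"
    by (auto intro!: derivative_eq_intros simp: inner_commute algebra_simps)
  from has_derivative_compose[OF this exp_recip_has_derivative[unfolded has_field_derivative_def]]
  show ?thesis by (simp add: bump_kernel_def[abs_def] power2_norm_eq_inner)
qed

lemma dderiv_kernel: "dderiv h (bump_kernel p \<tau>) z = bump_kernel (exp_recip_deriv p) \<tau> z * (- 2 * \<tau> * (z \<bullet> h))"
  by (rule dderiv_eqI[OF has_derivative_kernel])

text \<open>Write E for \<open>exp_recip p\<close>, evaluated at 1 - \<tau> |z|^2; its gradient is
  -2 \<tau> E' z. Since the \<tau>-derivative of E' is -|z|^2 E'', the first term equals -4 \<tau>^2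
  times that derivative, the identity behind \<open>conv_kernel_ODE\<close>.\<close>

lemma laplacian_kernel:
  fixes z :: "'a::euclidean_space" and \<tau> :: real
  shows "laplacian (bump_kernel p \<tau>) z
    = 4 * \<tau>\<^sup>2 * ((norm z)\<^sup>2 * bump_kernel (exp_recip_deriv (exp_recip_deriv p)) \<tau> z)
      - 2 * DIM('a) * \<tau> * bump_kernel (exp_recip_deriv p) \<tau> z"
proof -
  let ?k1 = "bump_kernel (exp_recip_deriv p) \<tau> :: 'a \<Rightarrow> real"
  let ?k2 = "bump_kernel (exp_recip_deriv (exp_recip_deriv p)) \<tau> :: 'a \<Rightarrow> real"
  have "dderiv i (dderiv i (bump_kernel p \<tau>)) z = 4 * \<tau>\<^sup>2 * ?k2 z * (z \<bullet> i)\<^sup>2 - 2 * \<tau> * ?k1 z" if i: "i \<in> Basis" for i :: 'a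
  proof -
    have "((\<lambda>z. ?k1 z * (- 2 * \<tau> * (z \<bullet> i))) has_derivative
        (\<lambda>h. ?k1 z * (- 2 * \<tau> * (h \<bullet> i)) + (?k2 z * (- 2 * \<tau> * (z \<bullet> h))) * (- 2 * \<tau> * (z \<bullet> i)))) (at z)"
      by (intro has_derivative_mult has_derivative_kernel has_derivative_mult_right has_derivative_inner_left has_derivative_ident)
    moreover have "dderiv i (bump_kernel p \<tau>) = (\<lambda>z. ?k1 z * (- 2 * \<tau> * (z \<bullet> i)))"
      by (rule ext) (rule dderiv_kernel)
    ultimately show ?thesis
      using i by (simp add: dderiv_eqI power2_eq_square algebra_simps)
  qed
  then have "laplacian (bump_kernel p \<tau>) z = 4 * \<tau>\<^sup>2 * ?k2 z * (\<Sum>i\<in>Basis. (z \<bullet> i)\<^sup>2) - (\<Sum>i\<in>(Basis::'a set). 2 * \<tau> * ?k1 z)"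
    by (simp add: laplacian_def sum_subtractf sum_distrib_left)
  also have "(\<Sum>i\<in>Basis. (z \<bullet> i)\<^sup>2) = (norm z)\<^sup>2"
    unfolding power2_norm_eq_inner by (subst euclidean_inner) (simp add: power2_eq_square)
  finally show ?thesis by (simp add: mult_ac)
qed

lemma dderiv_reflect:
  assumes "g differentiable at (x - y)"
  shows "dderiv v (\<lambda>y. g (x - y)) y = - dderiv v g (x - y)"
proof -
  have "((\<lambda>y. x - y) has_derivative (\<lambda>h. - h)) (at y)" by (auto intro!: derivative_eq_intros)
  from has_derivative_compose[OF this has_derivative_dderiv[OF assms]]
  have "dderiv v (\<lambda>y. g (x - y)) y = dderiv (- v) g (x - y)" by (rule dderiv_eqI)
  moreover have "linear (\<lambda>v. dderiv v g (x - y))"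
    using has_derivative_dderiv[OF assms] has_derivative_linear by blast
  ultimately show ?thesis using linear_neg by fastforce
qed

lemma laplacian_reflect:
  assumes "smooth_fun g"
  shows "laplacian (\<lambda>y. g (x - y)) y = laplacian g (x - y)"
proof -
  have d: "h differentiable at z" if "smooth_fun h" for h :: "'a \<Rightarrow> real" and z by (rule smooth_fun_differentiable[OF that])
  have 1: "dderiv i (\<lambda>y. g (x - y)) = (\<lambda>y. (-1) * dderiv i g (x - y))" for i
    by (rule ext) (simp add: dderiv_reflect d assms)
  have "(\<lambda>y. dderiv i g (x - y)) differentiable at y" for i
    using differentiable_chain_at[of "\<lambda>y. x - y" y "dderiv i g"] d[OF smooth_fun_dderiv[OF assms]]
    by (simp add: o_def)
  then have "dderiv i (dderiv i (\<lambda>y. g (x - y))) y = dderiv i (dderiv i g) (x - y)" for i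
    unfolding 1 by (subst dderiv_cmult) (simp_all add: dderiv_reflect d smooth_fun_dderiv assms)
  then show ?thesis by (simp add: laplacian_def)
qed

lemma dderiv_inner_grad:
  assumes "f differentiable at x"
  shows "dderiv h f x = grad f x \<bullet> h"
proof -
  have lin: "linear (\<lambda>h. dderiv h f x)"
    using has_derivative_dderiv[OF assms] has_derivative_linear by blast
  have "dderiv h f x = dderiv (\<Sum>i\<in>Basis. (h \<bullet> i) *\<^sub>R i) f x" by (simp add: euclidean_representation)
  also have "\<dots> = (\<Sum>i\<in>Basis. (h \<bullet> i) * dderiv i f x)"
    using linear_sum[OF lin, of "\<lambda>i. (h \<bullet> i) *\<^sub>R i" Basis] linear_scale[OF lin] by simp
  also have "\<dots> = grad f x \<bullet> h" by (subst euclidean_inner) (simp add: grad_inner_Basis mult.commute)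
  finally show ?thesis .
qed

section \<open>Weyl's lemma\<close>

lemma eventually_nhds_open: "open T \<Longrightarrow> x \<in> T \<Longrightarrow> (\<And>y. y \<in> T \<Longrightarrow> P y) \<Longrightarrow> \<forall>\<^sub>F y in nhds x. P y"
  by (auto simp: eventually_nhds)

text \<open>The comparison function \<open>U\<close> may depend on the point. This suits a function
  given by means whose radius varies from point to point, but which near each point agrees with the
  means of one fixed radius.\<close>

lemma harmonic_on_local:
  assumes "\<And>x. x \<in> S \<Longrightarrow> \<exists>T U. open T \<and> x \<in> T \<and> harmonic_on T U \<and> (\<forall>y\<in>T. u y = U y)"
  shows "harmonic_on S u"
proof -
  have *: "u differentiable at x \<and> (\<forall>i\<in>Basis. dderiv i u differentiable at x) \<and>
      (\<forall>i\<in>Basis. \<forall>j\<in>Basis. isCont (dderiv j (dderiv i u)) x) \<and> (\<Sum>i\<in>Basis. dderiv i (dderiv i u) x) = 0"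
    if xS: "x \<in> S" for x
  proof -
    obtain T U where T: "open T" "x \<in> T" "harmonic_on T U" "\<forall>y\<in>T. u y = U y"
      using assms[OF xS] by blast
    have 1: "dderiv i u y = dderiv i U y" if "y \<in> T" for i y
      using T that by (intro dderiv_cong_ev eventually_nhds_open[of T]) auto
    have 2: "dderiv j (dderiv i u) y = dderiv j (dderiv i U) y" if "y \<in> T" for i j y
      using T that 1 by (intro dderiv_cong_ev eventually_nhds_open[of T]) auto
    have "u differentiable at x"
      by (rule differentiable_cong_ev[of u U]) (use T in \<open>auto simp: harmonic_on_def intro: eventually_nhds_open[of T]\<close>)
    moreover have "dderiv i u differentiable at x" if "i \<in> Basis" for i
      by (rule differentiable_cong_ev[of _ "dderiv i U"])
        (use T that 1 in \<open>auto simp: harmonic_on_def intro: eventually_nhds_open[of T]\<close>)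
    moreover have "isCont (dderiv j (dderiv i u)) x" if "i \<in> Basis" "j \<in> Basis" for i j
    proof -
      have "isCont (dderiv j (dderiv i U)) x"
        using T that by (auto simp: harmonic_on_def continuous_on_eq_continuous_at)
      moreover have "\<forall>\<^sub>F y in nhds x. dderiv j (dderiv i u) y = dderiv j (dderiv i U) y"
        using T 2 by (intro eventually_nhds_open[of T]) auto
      ultimately show ?thesis using isCont_cong by blast
    qed
    moreover have "(\<Sum>i\<in>Basis. dderiv i (dderiv i u) x) = 0"
      using T 2[OF T(2)] by (simp add: harmonic_on_def)
    ultimately show ?thesis by blast
  qed
  show ?thesis
    unfolding harmonic_on_def using * by (auto intro!: continuous_at_imp_continuous_on)
qed

text \<open>The averaging kernel thus has the profile exp(-1/t) / t^2, the derivative of the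
  standard bump. It is nonnegative, so it can serve as a weight.\<close>

lemma exp_recip_deriv_1: "exp_recip_deriv 1 = [:0, 0, 1:]"
  by (simp add: exp_recip_deriv_def)

lemma bump_kernel_deriv_1_nonneg: "0 \<le> bump_kernel (exp_recip_deriv 1) \<tau> z"
  by (simp add: bump_kernel_def exp_recip_deriv_1 exp_recip_def)

lemma bump_kernel_deriv_1_at_0: "0 < bump_kernel (exp_recip_deriv 1) \<tau> 0"
  by (simp add: bump_kernel_def exp_recip_deriv_1 exp_recip_def)

lemma bump_kernel_minus: "bump_kernel p \<tau> (x - y) = bump_kernel p \<tau> (y - x)"
  by (simp add: bump_kernel_def norm_minus_commute)

context bounded_open begin

text \<open>The set where a continuous function differs from zero is open, and an open null set is
  empty.\<close>

lemma AE_zero_imp_zero: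
  assumes "continuous_on \<Omega> f" "AE x in M. f x = (0::real)" "x \<in> \<Omega>"
  shows "f x = 0"
proof -
  define S where "S = {x \<in> \<Omega>. f x \<in> - {0}}"
  have S: "open S"
    unfolding S_def using continuous_open_preimage[OF assms(1) open_dom, of "- {0}"] by (auto simp: vimage_def Int_def)
  have "AE x in lebesgue. x \<in> \<Omega> \<longrightarrow> f x = 0"
    using assms(2) dom_sets by (subst (asm) AE_restrict_space_iff) auto
  then have "AE x in lebesgue. x \<notin> S" by (auto simp: S_def)
  moreover have "S \<in> sets lebesgue" using S by (intro sets_completionI_sets) auto
  ultimately have "S \<in> null_sets lebesgue" using AE_iff_null_sets by blast
  then have "negligible S" by (simp add: negligible_iff_null_sets)
  then have "S = {}" using open_not_negligible[OF S] by blast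
  then show ?thesis using assms(3) by (auto simp: S_def)
qed

text \<open>The integral runs over \<Omega> only, so \<open>v\<close> needs no extension. Where the
  kernel centred at \<open>x\<close> lives inside \<Omega>, this is the ordinary
  convolution.\<close>

definition conv :: "('a \<Rightarrow> real) \<Rightarrow> ('a \<Rightarrow> real) \<Rightarrow> 'a \<Rightarrow> real" where
  "conv v g x = (\<integral>y. v y * g (x - y) \<partial>M)"

lemma measurable_shift:
  fixes g :: "'a \<Rightarrow> real"
  assumes "smooth_fun g" shows "(\<lambda>y. g (x - y)) \<in> borel_measurable M"
proof (rule measurable_continuous)
  have "continuous_on UNIV g" by (rule C1_on_continuous[OF smooth_fun_C1_on[OF assms]])
  then show "continuous_on \<Omega> (\<lambda>y. g (x - y))"
    by (rule continuous_on_compose2) (auto intro: continuous_intros)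
qed

lemma test_fun_bounded:
  assumes "test_fun UNIV g"
  obtains B where "0 \<le> B" "\<And>z. \<bar>g z\<bar> \<le> B"
proof -
  have "continuous_on (support g) g" "compact (support g)"
    using assms by (auto simp: test_fun_def intro!: C1_on_continuous smooth_fun_C1_on)
  then obtain B where "0 \<le> B" "\<And>x. x \<in> UNIV \<Longrightarrow> norm (g x) \<le> B"
    using compact_support_bounded[of "support g" g UNIV] notin_support[of _ g] by metis
  then show ?thesis using that by simp
qed

lemma test_fun_dderiv_bounded:
  assumes "test_fun UNIV g"
  obtains L where "0 \<le> L" "\<And>h z. \<bar>dderiv h g z\<bar> \<le> L * norm h"
proof -
  have s: "smooth_fun g" using assms by (simp add: test_fun_def)
  have "continuous_on (support g) (grad g)" "compact (support g)"
    using assms by (auto simp: test_fun_def intro!: C1_on_continuous_grad smooth_fun_C1_on)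
  moreover have "grad g z = 0" if "z \<notin> support g" for z using that by (simp add: grad_def dderiv_notin_support)
  ultimately obtain L where L: "0 \<le> L" "\<And>z. z \<in> UNIV \<Longrightarrow> norm (grad g z) \<le> L"
    using compact_support_bounded[of "support g" "grad g" UNIV] by metis
  show ?thesis
  proof (rule that[OF L(1)])
    fix h z
    have "\<bar>dderiv h g z\<bar> \<le> norm (grad g z) * norm h"
      unfolding dderiv_inner_grad[OF smooth_fun_differentiable[OF s]] by (rule Cauchy_Schwarz_ineq2)
    also have "\<dots> \<le> L * norm h" using L(2) by (intro mult_right_mono) auto
    finally show "\<bar>dderiv h g z\<bar> \<le> L * norm h" .
  qed
qed

lemma integrable_conv:
  assumes "integrable M v" "test_fun UNIV g"
  shows "integrable M (\<lambda>y. v y * g (x - y))"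
proof -
  obtain B where "\<And>z. \<bar>g z\<bar> \<le> B" using test_fun_bounded[OF assms(2)] by metis
  then show ?thesis
    using assms by (intro integrable_mult_bounded[where B=B] measurable_shift) (auto simp: test_fun_def)
qed

lemma has_derivative_conv:
  assumes v: "integrable M v" and g: "test_fun UNIV g"
  shows "(conv v g has_derivative (\<lambda>h. conv v (dderiv h g) x)) (at x)"
proof -
  have s: "smooth_fun g" using g by (simp add: test_fun_def)
  obtain B where B: "\<And>z. \<bar>g z\<bar> \<le> B" using test_fun_bounded[OF g] by metis
  obtain L where L: "\<And>h z. \<bar>dderiv h g z\<bar> \<le> L * norm h" using test_fun_dderiv_bounded[OF g] by metis
  have "((\<lambda>p. \<integral>y. v y * g (p - y) \<partial>M) has_derivative (\<lambda>h. \<integral>y. v y * dderiv h g (x - y) \<partial>M)) (at x)"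
  proof (rule has_derivative_parametric_integral[where D="\<lambda>p y h. dderiv h g (p - y)" and r=1 and L=L and B=B])
    show "((\<lambda>p. g (p - y)) has_derivative (\<lambda>h. dderiv h g (p - y))) (at p)" for y p
    proof -
      have "((\<lambda>p. p - y) has_derivative (\<lambda>h. h)) (at p)" by (auto intro!: derivative_eq_intros)
      from has_derivative_compose[OF this has_derivative_dderiv[OF smooth_fun_differentiable[OF s]]]
      show ?thesis .
    qed
  qed (use v L B in \<open>auto intro!: measurable_shift s smooth_fun_dderiv\<close>)
  then show ?thesis by (simp add: conv_def[abs_def])
qed

lemma conv_differentiable: "integrable M v \<Longrightarrow> test_fun UNIV g \<Longrightarrow> conv v g differentiable at x"
  using has_derivative_conv unfolding differentiable_def by blast

lemma dderiv_conv: "integrable M v \<Longrightarrow> test_fun UNIV g \<Longrightarrow> dderiv h (conv v g) = conv v (dderiv h g)"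
  by (rule ext) (rule dderiv_eqI[OF has_derivative_conv])

lemma sum_dderiv_conv:
  assumes v: "integrable M v" and g: "test_fun UNIV g"
  shows "(\<Sum>i\<in>Basis. dderiv i (dderiv i (conv v g)) x) = (\<integral>y. v y * laplacian g (x - y) \<partial>M)"
proof -
  have g2: "test_fun UNIV (dderiv i (dderiv i g))" for i by (intro test_fun_dderiv g)
  have "(\<Sum>i\<in>Basis. dderiv i (dderiv i (conv v g)) x) = (\<Sum>i\<in>Basis. conv v (dderiv i (dderiv i g)) x)"
    by (simp add: dderiv_conv[OF v] g test_fun_dderiv)
  also have "\<dots> = (\<integral>y. (\<Sum>i\<in>Basis. v y * dderiv i (dderiv i g) (x - y)) \<partial>M)"
    unfolding conv_def by (intro Bochner_Integration.integral_sum[symmetric] integrable_conv v g2)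
  finally show ?thesis by (simp add: laplacian_def sum_distrib_left)
qed

section \<open>Weakly harmonic functions and their kernel means\<close>

definition weakly_harmonic :: "('a \<Rightarrow> real) \<Rightarrow> bool" where
  "weakly_harmonic v \<longleftrightarrow> integrable M v \<and> (\<forall>w. test_fun \<Omega> w \<longrightarrow> (\<integral>x. v x * laplacian w x \<partial>M) = 0)"

lemma weakly_harmonic_cmult: "weakly_harmonic v \<Longrightarrow> weakly_harmonic (\<lambda>x. c * v x)"
  by (simp add: weakly_harmonic_def mult.assoc)

lemma weakly_harmonic_1: "weakly_harmonic (\<lambda>x. 1)"
  unfolding weakly_harmonic_def
proof (intro conjI allI impI)
  show "integrable M (\<lambda>x. 1::real)" by (rule integrable_bounded[where B=1]) auto
  fix w assume w: "test_fun \<Omega> w"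
  have "(\<integral>x. 1 * laplacian w x \<partial>M) = - l2_inner M (grad (\<lambda>x. 1)) (grad w)"
    using Green_test_fun[OF smooth_fun_C1_on[OF smooth_fun_const] w] by simp
  also have "\<dots> = 0" by (simp add: l2_inner_def grad_def)
  finally show "(\<integral>x. 1 * laplacian w x \<partial>M) = 0" .
qed

lemma weakly_harmonic_kernel:
  assumes "weakly_harmonic v" "r > 0" "1 / r\<^sup>2 \<le> \<tau>" "cball x r \<subseteq> \<Omega>"
  shows "(\<integral>y. v y * laplacian (bump_kernel p \<tau>) (x - y) \<partial>M) = 0"
  using assms(1) test_fun_kernel(2)[OF assms(2-4)]
  unfolding weakly_harmonic_def laplacian_reflect[OF smooth_kernel, symmetric] by blast

text \<open>Let E be \<open>exp_recip 1\<close> at 1 - \<tau> |x - y|^2, a the convolution with E',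
  s the integral of v |x - y|^2 E'', and d the dimension. Differentiation in \<tau> gives a' = -s,
  and testing \<open>v\<close> with E gives 0 = 4 \<tau>^2 s - 2 d \<tau> a. Hence a' = -(d / (2
  \<tau>)) a. The test function uses the profile \<open>1\<close>, the mean its derivative.\<close>

lemma conv_kernel_ODE:
  assumes v: "weakly_harmonic v" and r: "r > 0" "1 / r\<^sup>2 \<le> \<tau>" "cball x r \<subseteq> \<Omega>"
  shows "((\<lambda>\<tau>. conv v (bump_kernel (exp_recip_deriv 1) \<tau>) x) has_real_derivative
    - (DIM('a) / (2 * \<tau>)) * conv v (bump_kernel (exp_recip_deriv 1) \<tau>) x) (at \<tau>)"
proof -
  let ?p = "exp_recip_deriv 1" let ?q = "exp_recip_deriv ?p"
  have vi: "integrable M v" using v by (simp add: weakly_harmonic_def)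
  have "0 < 1 / r\<^sup>2" using r by simp
  then have \<tau>: "0 < \<tau>" using r(2) by linarith
  obtain R where R: "\<And>y. y \<in> \<Omega> \<Longrightarrow> norm y < R"
    using bounded_subset_ballD[OF bounded_dom, of 0] by (metis mem_ball_0 subsetD)
  have R2: "(norm (x - y))\<^sup>2 \<le> (norm x + R)\<^sup>2" if "y \<in> \<Omega>" for y
    using norm_triangle_ineq4[of x y] R[OF that] by (intro power_mono) auto
  obtain B where B: "0 \<le> B" "\<And>\<tau> z::'a. 0 \<le> \<tau> \<Longrightarrow> \<bar>bump_kernel ?p \<tau> z\<bar> \<le> B"
    using kernel_bounded[of ?p] by metis
  obtain B' where B': "0 \<le> B'" "\<And>\<tau> z::'a. 0 \<le> \<tau> \<Longrightarrow> \<bar>bump_kernel ?q \<tau> z\<bar> \<le> B'"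
    using kernel_bounded[of ?q] by metis
  define s where "s = (\<integral>y. v y * ((norm (x - y))\<^sup>2 * bump_kernel ?q \<tau> (x - y)) \<partial>M)"
  have cn: "(\<lambda>y. (norm (x - y))\<^sup>2) \<in> borel_measurable M"
    by (rule measurable_continuous) (intro continuous_intros)
  have meas: "(\<lambda>y. (norm (x - y))\<^sup>2 * bump_kernel ?q \<tau> (x - y)) \<in> borel_measurable M"
    using cn measurable_shift[OF smooth_kernel, of ?q \<tau> x] by measurable
  have bd: "\<bar>(norm (x - y))\<^sup>2 * bump_kernel ?q t (x - y)\<bar> \<le> (norm x + R)\<^sup>2 * B'" if "y \<in> \<Omega>" "0 \<le> t" for y t
    unfolding abs_mult using R2[OF that(1)] B'(2)[OF that(2), of "x - y"] by (intro mult_mono) auto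
  have si: "integrable M (\<lambda>y. v y * ((norm (x - y))\<^sup>2 * bump_kernel ?q \<tau> (x - y)))"
    by (rule integrable_mult_bounded[OF vi meas, where B="(norm x + R)\<^sup>2 * B'"]) (use bd \<tau> in auto)
  have ci: "integrable M (\<lambda>y. v y * bump_kernel ?p \<tau> (x - y))"
    by (rule integrable_conv[OF vi test_fun_kernel(1)[OF r(1,2)]])
  have "((\<lambda>t. \<integral>y. v y * bump_kernel ?p t (x - y) \<partial>M) has_derivative
      (\<lambda>h. \<integral>y. v y * (- ((norm (x - y))\<^sup>2 * bump_kernel ?q \<tau> (x - y)) * h) \<partial>M)) (at \<tau>)"
  \<comment> \<open>The radius \<tau> keeps the nearby scales nonnegative, where the kernels are
    bounded uniformly in the scale.\<close>
  proof (rule has_derivative_parametric_integral[where r=\<tau> and B=B and L="(norm x + R)\<^sup>2 * B'"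
        and D="\<lambda>t y h. - ((norm (x - y))\<^sup>2 * bump_kernel ?q t (x - y)) * h"])
    show "((\<lambda>t. bump_kernel ?p t (x - y)) has_derivative
        (\<lambda>h. - ((norm (x - y))\<^sup>2 * bump_kernel ?q t (x - y)) * h)) (at t)" for y t
    proof -
      have "((\<lambda>t. 1 - t * (norm (x - y))\<^sup>2) has_real_derivative - ((norm (x - y))\<^sup>2)) (at t)"
        by (auto intro!: derivative_eq_intros)
      from DERIV_chain2[OF exp_recip_has_derivative[of ?p] this]
      have "((\<lambda>t. bump_kernel ?p t (x - y)) has_real_derivative
          - ((norm (x - y))\<^sup>2 * bump_kernel ?q t (x - y))) (at t)"
        unfolding bump_kernel_def by (simp add: mult.commute)
      then show ?thesis by (simp only: has_field_derivative_def)
    qed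
    show "\<bar>- ((norm (x - y))\<^sup>2 * bump_kernel ?q t (x - y)) * h\<bar> \<le> (norm x + R)\<^sup>2 * B' * norm h"
      if "y \<in> space M" "t \<in> ball \<tau> \<tau>" for y t h
    proof -
      have "0 \<le> t" using that(2) by (simp add: dist_real_def)
      then have "\<bar>(norm (x - y))\<^sup>2 * bump_kernel ?q t (x - y)\<bar> * \<bar>h\<bar> \<le> (norm x + R)\<^sup>2 * B' * \<bar>h\<bar>"
        using that(1) by (intro mult_right_mono bd) auto
      then show ?thesis by (simp add: abs_mult)
    qed
    show "(\<lambda>y. - ((norm (x - y))\<^sup>2 * bump_kernel ?q \<tau> (x - y)) * h) \<in> borel_measurable M" for h
      using meas by measurable
  qed (use vi \<tau> B in \<open>auto intro!: measurable_shift smooth_kernel\<close>)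
  moreover have "(\<integral>y. v y * (- ((norm (x - y))\<^sup>2 * bump_kernel ?q \<tau> (x - y)) * h) \<partial>M) = (- s) * h" for h
  proof -
    have "(\<integral>y. v y * (- ((norm (x - y))\<^sup>2 * bump_kernel ?q \<tau> (x - y)) * h) \<partial>M)
        = (\<integral>y. (- h) * (v y * ((norm (x - y))\<^sup>2 * bump_kernel ?q \<tau> (x - y))) \<partial>M)"
      by (intro Bochner_Integration.integral_cong refl) (simp add: mult_ac)
    then show ?thesis by (simp add: s_def)
  qed
  ultimately have D: "((\<lambda>\<tau>. conv v (bump_kernel ?p \<tau>) x) has_real_derivative - s) (at \<tau>)"
    by (simp only: conv_def has_field_derivative_def)
  have "0 = (\<integral>y. v y * laplacian (bump_kernel 1 \<tau>) (x - y) \<partial>M)"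
    using weakly_harmonic_kernel[OF v r] by simp
  also have "\<dots> = (\<integral>y. 4 * \<tau>\<^sup>2 * (v y * ((norm (x - y))\<^sup>2 * bump_kernel ?q \<tau> (x - y)))
      - 2 * DIM('a) * \<tau> * (v y * bump_kernel ?p \<tau> (x - y)) \<partial>M)"
    unfolding laplacian_kernel by (intro Bochner_Integration.integral_cong refl) (simp add: algebra_simps)
  also have "\<dots> = 4 * \<tau>\<^sup>2 * s - 2 * DIM('a) * \<tau> * conv v (bump_kernel ?p \<tau>) x"
    unfolding s_def conv_def using si ci by (subst Bochner_Integration.integral_diff) auto
  finally have "2 * \<tau> * (2 * \<tau> * s) = 2 * \<tau> * (DIM('a) * conv v (bump_kernel ?p \<tau>) x)"
    by (simp add: power2_eq_square)
  then have "s = DIM('a) / (2 * \<tau>) * conv v (bump_kernel ?p \<tau>) x"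
    using \<tau> by (simp add: field_simps)
  with D show ?thesis by simp
qed

definition kernel_mass :: "real \<Rightarrow> real" where
  "kernel_mass \<tau> = (\<integral>z. bump_kernel (exp_recip_deriv 1) \<tau> (z::'a) \<partial>lborel)"

lemma kernel_borel: "(\<lambda>z::'a. bump_kernel p \<tau> z) \<in> borel_measurable borel"
  by (intro borel_measurable_continuous_onI C1_on_continuous smooth_fun_C1_on smooth_kernel)

text \<open>The ball carries the whole kernel, so the integral over \<Omega> is one over the whole
  space and does not depend on \<open>x\<close>. Hence \<open>kernel_mass\<close> inherits the
  differential equation of the weakly harmonic function 1.\<close>

lemma conv_1_kernel:
  assumes r: "r > 0" "1 / r\<^sup>2 \<le> \<tau>" "cball x r \<subseteq> \<Omega>"
  shows "conv (\<lambda>y. 1) (bump_kernel (exp_recip_deriv 1) \<tau>) x = kernel_mass \<tau>"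
proof -
  let ?k = "bump_kernel (exp_recip_deriv 1) \<tau> :: 'a \<Rightarrow> real"
  have [measurable]: "?k \<in> borel_measurable borel" by (rule kernel_borel)
  have "conv (\<lambda>y. 1) ?k x = (\<integral>y. ?k (x - y) \<partial>M)" by (simp add: conv_def)
  also have "\<dots> = (\<integral>y. indicator \<Omega> y *\<^sub>R ?k (x - y) \<partial>lebesgue)"
    using dom_sets by (subst integral_restrict_space) auto
  also have "\<dots> = (\<integral>y. ?k (x - y) \<partial>lebesgue)"
  proof (intro Bochner_Integration.integral_cong refl)
    fix y show "indicator \<Omega> y *\<^sub>R ?k (x - y) = ?k (x - y)"
    proof (cases "y \<in> \<Omega>")
      case False
      then have "y \<notin> cball x r" using r(3) by blast
      then have "r \<le> norm (x - y)" by (simp add: dist_norm)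
      then show ?thesis by (simp add: kernel_eq_0[OF r(1,2)])
    qed simp
  qed
  also have "\<dots> = (\<integral>y. ?k (x - y) \<partial>lborel)" by (subst integral_completion) auto
  also have "\<dots> = (\<integral>y. ?k (y + (- x)) \<partial>lborel)" by (simp add: bump_kernel_minus[of _ _ x])
  also have "\<dots> = kernel_mass \<tau>" unfolding kernel_mass_def by (rule integral_translation) simp
  finally show ?thesis .
qed

text \<open>The kernel is nonnegative and continuous, and it is positive at its centre.\<close>

lemma kernel_mass_pos:
  assumes r: "r > 0" "1 / r\<^sup>2 \<le> \<tau>" "cball x r \<subseteq> \<Omega>"
  shows "kernel_mass \<tau> > 0"
proof -
  let ?k = "bump_kernel (exp_recip_deriv 1) \<tau> :: 'a \<Rightarrow> real"
  have eq: "kernel_mass \<tau> = (\<integral>y. ?k (x - y) \<partial>M)" using conv_1_kernel[OF r] by (simp add: conv_def)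
  have int: "integrable M (\<lambda>y. ?k (x - y))"
    using integrable_conv[of "\<lambda>y. 1", OF _ test_fun_kernel(1)[OF r(1,2)]] weakly_harmonic_1
    by (simp add: weakly_harmonic_def)
  have x: "x \<in> \<Omega>" using r by auto
  have "kernel_mass \<tau> \<noteq> 0"
  proof
    assume "kernel_mass \<tau> = 0"
    then have "AE y in M. ?k (x - y) = 0"
      using int unfolding eq by (subst (asm) integral_nonneg_eq_0_iff_AE) (auto simp: bump_kernel_deriv_1_nonneg)
    moreover have "continuous_on \<Omega> (\<lambda>y. ?k (x - y))"
      by (rule C1_on_continuous[OF smooth_fun_C1_on[OF smooth_kernel_shift]])
    ultimately have "?k (x - x) = 0" using x by (intro AE_zero_imp_zero[of "\<lambda>y. ?k (x - y)"]) 
    then show False using bump_kernel_deriv_1_at_0[of \<tau>, where 'a='a] by simp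
  qed
  moreover have "kernel_mass \<tau> \<ge> 0"
    unfolding eq by (intro Bochner_Integration.integral_nonneg) (rule bump_kernel_deriv_1_nonneg)
  ultimately show ?thesis by simp
qed

text \<open>Numerator and denominator solve the same linear equation in the scale, so their quotient,
  the mean of a weakly harmonic function, does not depend on the scale.\<close>

lemma weakly_harmonic_mean_constant:
  assumes v: "weakly_harmonic v" and r: "r > 0" "cball x r \<subseteq> \<Omega>" and t: "1 / r\<^sup>2 \<le> \<sigma>" "1 / r\<^sup>2 \<le> \<tau>"
  shows "conv v (bump_kernel (exp_recip_deriv 1) \<sigma>) x / kernel_mass \<sigma>
    = conv v (bump_kernel (exp_recip_deriv 1) \<tau>) x / kernel_mass \<tau>"
proof -
  define a where "a t = conv v (bump_kernel (exp_recip_deriv 1) t) x" for t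
  define n where "n t = conv (\<lambda>y. 1) (bump_kernel (exp_recip_deriv 1) t) x" for t
  have n: "n t = kernel_mass t" if "1 / r\<^sup>2 \<le> t" for t unfolding n_def by (rule conv_1_kernel[OF r(1) that r(2)])
  have "((\<lambda>t. a t / n t) has_real_derivative 0) (at t within {1 / r\<^sup>2..})" if "t \<in> {1 / r\<^sup>2..}" for t
  proof -
    have t: "1 / r\<^sup>2 \<le> t" using that by simp
    have a': "(a has_real_derivative - (DIM('a) / (2 * t)) * a t) (at t)"
      unfolding a_def by (rule conv_kernel_ODE[OF v r(1) t r(2)])
    have n': "(n has_real_derivative - (DIM('a) / (2 * t)) * n t) (at t)"
      unfolding n_def by (rule conv_kernel_ODE[OF weakly_harmonic_1 r(1) t r(2)])
    have "n t \<noteq> 0" using n[OF t] kernel_mass_pos[OF r(1) t r(2)] by simp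
    from DERIV_divide[OF a' n' this] have "((\<lambda>t. a t / n t) has_real_derivative 0) (at t)" by (simp add: mult_ac)
    then show ?thesis by (rule has_field_derivative_at_within)
  qed
  from has_field_derivative_zero_constant[OF convex_real_interval(1) this]
  obtain c where "\<And>t. t \<in> {1 / r\<^sup>2..} \<Longrightarrow> a t / n t = c" by blast
  then have "a \<sigma> / n \<sigma> = a \<tau> / n \<tau>" using t by simp
  then show ?thesis using n t by (simp add: a_def)
qed

section \<open>Convergence of the means and Weyl's lemma\<close>

lemma nn_integral_kernel_le:
  assumes "r > 0" "1 / r\<^sup>2 \<le> \<tau>"
  shows "(\<integral>\<^sup>+x. ennreal (bump_kernel (exp_recip_deriv 1) \<tau> (x - y)) \<partial>M) \<le> ennreal (kernel_mass \<tau>)"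
proof -
  let ?k = "bump_kernel (exp_recip_deriv 1) \<tau> :: 'a \<Rightarrow> real"
  have [measurable]: "?k \<in> borel_measurable borel" by (rule kernel_borel)
  have t: "test_fun UNIV ?k" by (rule test_fun_kernel(1)[OF assms])
  have int: "integrable lborel ?k"
    by (rule integrable_lborel_compact_support[where K="support ?k"])
      (use t in \<open>auto simp: test_fun_def intro!: C1_on_continuous smooth_fun_C1_on notin_support[of _ ?k]\<close>)
  have "(\<integral>\<^sup>+x. ennreal (?k (x - y)) \<partial>M) = (\<integral>\<^sup>+x. ennreal (?k (x - y)) * indicator \<Omega> x \<partial>lebesgue)"
    using dom_sets by (subst nn_integral_restrict_space) auto
  also have "\<dots> \<le> (\<integral>\<^sup>+x. ennreal (?k (x - y)) \<partial>lebesgue)"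
    by (intro nn_integral_mono) (auto simp: indicator_def)
  also have "\<dots> = (\<integral>\<^sup>+x. ennreal (?k (x - y)) \<partial>lborel)"
    by (subst nn_integral_completion) auto
  also have "\<dots> = (\<integral>\<^sup>+x. ennreal (?k (- y + x)) \<partial>lborel)" by (simp add: add.commute)
  also have "\<dots> = (\<integral>\<^sup>+x. ennreal (?k x) \<partial>distr lborel borel ((+) (- y)))"
    by (subst nn_integral_distr) auto
  also have "\<dots> = (\<integral>\<^sup>+x. ennreal (?k x) \<partial>lborel)" by (simp add: lborel_distr_plus)
  also have "\<dots> = ennreal (kernel_mass \<tau>)"
    unfolding kernel_mass_def using int by (intro nn_integral_eq_integral) (auto simp: bump_kernel_deriv_1_nonneg)
  finally show ?thesis .
qed

text \<open>Young's inequality in L1, by exchanging the integrals. After division by the mass,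
  averaging does not increase the L1 distance between two functions, whatever the scale.\<close>

lemma nn_integral_conv_le:
  assumes f: "integrable M f" "\<And>y. 0 \<le> f y" and r: "r > 0" "1 / r\<^sup>2 \<le> \<tau>"
  shows "(\<integral>\<^sup>+x. ennreal (conv f (bump_kernel (exp_recip_deriv 1) \<tau>) x) \<partial>M)
    \<le> ennreal (kernel_mass \<tau>) * ennreal (\<integral>y. f y \<partial>M)"
proof -
  let ?k = "bump_kernel (exp_recip_deriv 1) \<tau> :: 'a \<Rightarrow> real"
  interpret F: finite_measure M by (rule finite_measure_dom)
  interpret P: pair_sigma_finite M M by standard
  have id [measurable]: "(\<lambda>x. x) \<in> borel_measurable M" by (rule measurable_continuous) (rule continuous_on_id)
  have [measurable]: "?k \<in> borel_measurable borel" by (rule kernel_borel)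
  have [measurable]: "f \<in> borel_measurable M" using f by auto
  have [measurable]: "fst \<in> borel_measurable (M \<Otimes>\<^sub>M M)" "snd \<in> borel_measurable (M \<Otimes>\<^sub>M M)"
    using measurable_compose[OF measurable_fst id] measurable_compose[OF measurable_snd id] by auto
  have t: "test_fun UNIV ?k" by (rule test_fun_kernel(1)[OF r])
  have "(\<integral>\<^sup>+x. ennreal (conv f ?k x) \<partial>M) = (\<integral>\<^sup>+x. \<integral>\<^sup>+y. ennreal (f y * ?k (x - y)) \<partial>M \<partial>M)"
    unfolding conv_def using f(2) integrable_conv[OF f(1) t]
    by (intro nn_integral_cong nn_integral_eq_integral[symmetric]) (auto simp: bump_kernel_deriv_1_nonneg)
  also have "\<dots> = (\<integral>\<^sup>+y. \<integral>\<^sup>+x. ennreal (f y * ?k (x - y)) \<partial>M \<partial>M)"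
  proof (rule P.Fubini'[symmetric])
    have "(\<lambda>z. f (snd z) * ?k (fst z - snd z)) \<in> borel_measurable (M \<Otimes>\<^sub>M M)"
      by measurable
    then show "(\<lambda>(x, y). ennreal (f y * ?k (x - y))) \<in> borel_measurable (M \<Otimes>\<^sub>M M)"
      by (simp add: case_prod_beta')
  qed
  also have "\<dots> = (\<integral>\<^sup>+y. ennreal (f y) * (\<integral>\<^sup>+x. ennreal (?k (x - y)) \<partial>M) \<partial>M)"
  proof (intro nn_integral_cong)
    fix y
    have "(\<lambda>x. ?k (x - y)) \<in> borel_measurable M" by measurable
    then show "(\<integral>\<^sup>+x. ennreal (f y * ?k (x - y)) \<partial>M) = ennreal (f y) * (\<integral>\<^sup>+x. ennreal (?k (x - y)) \<partial>M)"
      using f(2) by (subst nn_integral_cmult[symmetric]) (auto simp: ennreal_mult bump_kernel_deriv_1_nonneg)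
  qed
  also have "\<dots> \<le> (\<integral>\<^sup>+y. ennreal (f y) * ennreal (kernel_mass \<tau>) \<partial>M)"
    by (intro nn_integral_mono mult_left_mono nn_integral_kernel_le[OF r]) simp
  also have "\<dots> = (\<integral>\<^sup>+y. ennreal (f y) \<partial>M) * ennreal (kernel_mass \<tau>)"
    by (rule nn_integral_multc) measurable
  also have "\<dots> = ennreal (kernel_mass \<tau>) * ennreal (\<integral>y. f y \<partial>M)"
    using f by (subst nn_integral_eq_integral) (auto simp: mult.commute)
  finally show ?thesis .
qed

lemma cball_subset_dom:
  assumes "r < infdist x (- \<Omega>)"
  shows "cball x r \<subseteq> \<Omega>"
proof
  fix y assume "y \<in> cball x r"
  then show "y \<in> \<Omega>" using infdist_le[of y "- \<Omega>" x] assms by (cases "y \<in> \<Omega>") auto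
qed

lemma harmonic_on_mean:
  assumes v: "weakly_harmonic v" and r: "r > 0" "1 / r\<^sup>2 \<le> \<tau>" and B: "\<And>x. x \<in> S \<Longrightarrow> cball x r \<subseteq> \<Omega>"
  shows "harmonic_on S (\<lambda>x. conv v (bump_kernel (exp_recip_deriv 1) \<tau>) x / kernel_mass \<tau>)"
proof -
  let ?k = "bump_kernel (exp_recip_deriv 1) \<tau> :: 'a \<Rightarrow> real"
  \<comment> \<open>The normalising factor is moved into \<open>v\<close>, so that the mean is
    itself a convolution and inherits the derivative formulas.\<close>
  define v' where "v' y = inverse (kernel_mass \<tau>) * v y" for y
  have v': "weakly_harmonic v'" unfolding v'_def by (rule weakly_harmonic_cmult[OF v])
  then have vi: "integrable M v'" by (simp add: weakly_harmonic_def)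
  have k: "test_fun UNIV ?k" by (rule test_fun_kernel(1)[OF r])
  have eq: "(\<lambda>x. conv v ?k x / kernel_mass \<tau>) = conv v' ?k"
    by (rule ext) (simp only: conv_def v'_def mult.assoc integral_mult_right_zero divide_inverse mult.commute[of _ "inverse _"])
  show ?thesis
    unfolding eq harmonic_on_def
  proof (intro conjI ballI)
    fix x assume "x \<in> S"
    then show "(\<Sum>i\<in>Basis. dderiv i (dderiv i (conv v' ?k)) x) = 0"
      unfolding sum_dderiv_conv[OF vi k] by (intro weakly_harmonic_kernel[OF v' r B])
  next
    fix i j :: 'a
    show "continuous_on S (dderiv j (dderiv i (conv v' ?k)))"
      by (intro continuous_at_imp_continuous_on ballI differentiable_imp_continuous_within)
        (simp add: dderiv_conv[OF vi] k test_fun_dderiv conv_differentiable[OF vi])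
  qed (simp_all add: dderiv_conv[OF vi] k test_fun_dderiv conv_differentiable[OF vi])
qed

text \<open>The distance from the mean of \<open>v\<close> to the value f x splits into the mean of
  |v - f| and the oscillation \<open>e\<close> of \<open>f\<close> on the ball. The first part is
  estimated in L1, the second uniformly.\<close>

lemma mean_near:
  assumes v: "weakly_harmonic v" and r: "r > 0" "cball x r \<subseteq> \<Omega>" and f: "continuous_on (closure \<Omega>) f"
    and e: "\<And>y. y \<in> \<Omega> \<Longrightarrow> dist x y < r \<Longrightarrow> \<bar>f y - f x\<bar> \<le> e"
  shows "\<bar>conv v (bump_kernel (exp_recip_deriv 1) (1 / r\<^sup>2)) x / kernel_mass (1 / r\<^sup>2) - f x\<bar>
    \<le> conv (\<lambda>y. \<bar>v y - f y\<bar>) (bump_kernel (exp_recip_deriv 1) (1 / r\<^sup>2)) x / kernel_mass (1 / r\<^sup>2) + e"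
proof -
  let ?k = "bump_kernel (exp_recip_deriv 1) (1 / r\<^sup>2) :: 'a \<Rightarrow> real"
  let ?N = "kernel_mass (1 / r\<^sup>2)"
  have N: "?N > 0" by (rule kernel_mass_pos[OF r(1) order_refl r(2)])
  have k: "test_fun UNIV ?k" by (rule test_fun_kernel(1)[OF r(1) order_refl])
  have vi: "integrable M v" using v by (simp add: weakly_harmonic_def)
  have one: "integrable M (\<lambda>y. 1::real)" using weakly_harmonic_1 by (simp add: weakly_harmonic_def)
  have fi: "integrable M f"
    by (rule square_integrable_integrable[OF square_integrable_continuous_closure[OF f]])
  have ki: "integrable M (\<lambda>y. ?k (x - y))" using integrable_conv[OF one k, of x] by simp
  have mass: "(\<integral>y. ?k (x - y) \<partial>M) = ?N"
    using conv_1_kernel[OF r(1) order_refl r(2)] by (simp add: conv_def)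
  have "conv v ?k x - ?N * f x = (\<integral>y. v y * ?k (x - y) \<partial>M) - (\<integral>y. f x * ?k (x - y) \<partial>M)"
    by (simp add: conv_def mass)
  also have "\<dots> = (\<integral>y. v y * ?k (x - y) - f x * ?k (x - y) \<partial>M)"
    using integrable_conv[OF vi k, of x] ki by (intro Bochner_Integration.integral_diff[symmetric]) auto
  finally have "\<bar>conv v ?k x - ?N * f x\<bar> \<le> (\<integral>y. norm (v y * ?k (x - y) - f x * ?k (x - y)) \<partial>M)"
    using Bochner_Integration.integral_norm_bound[of M "\<lambda>y. v y * ?k (x - y) - f x * ?k (x - y)"] by simp
  also have "\<dots> \<le> (\<integral>y. \<bar>v y - f y\<bar> * ?k (x - y) + e * ?k (x - y) \<partial>M)"
  proof (rule integral_mono)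
    show "integrable M (\<lambda>y. norm (v y * ?k (x - y) - f x * ?k (x - y)))"
      using integrable_conv[OF vi k, of x] ki by (intro integrable_norm Bochner_Integration.integrable_diff) auto
    show "integrable M (\<lambda>y. \<bar>v y - f y\<bar> * ?k (x - y) + e * ?k (x - y))"
      using integrable_conv[OF _ k, of "\<lambda>y. \<bar>v y - f y\<bar>" x] ki vi fi
      by (intro Bochner_Integration.integrable_add) auto
    fix y assume "y \<in> space M"
    then have y: "y \<in> \<Omega>" by simp
    have k0: "0 \<le> ?k (x - y)" by (rule bump_kernel_deriv_1_nonneg)
    show "norm (v y * ?k (x - y) - f x * ?k (x - y)) \<le> \<bar>v y - f y\<bar> * ?k (x - y) + e * ?k (x - y)"
    proof (cases "dist x y < r")
      case True
      have "\<bar>v y - f x\<bar> \<le> \<bar>v y - f y\<bar> + e" using e[OF y True] by linarith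
      then have "\<bar>v y - f x\<bar> * ?k (x - y) \<le> (\<bar>v y - f y\<bar> + e) * ?k (x - y)" using k0 by (rule mult_right_mono)
      then show ?thesis using k0 by (simp add: left_diff_distrib[symmetric] abs_mult distrib_right)
    next
      case False
      then have "?k (x - y) = 0" by (intro kernel_eq_0[OF r(1) order_refl]) (simp add: dist_norm)
      then show ?thesis by simp
    qed
  qed
  also have "\<dots> = conv (\<lambda>y. \<bar>v y - f y\<bar>) ?k x + e * ?N"
    unfolding conv_def mass[symmetric] using integrable_conv[OF _ k, of "\<lambda>y. \<bar>v y - f y\<bar>" x] ki vi fi
    by (subst Bochner_Integration.integral_add) auto
  finally have "\<bar>conv v ?k x - ?N * f x\<bar> / ?N \<le> (conv (\<lambda>y. \<bar>v y - f y\<bar>) ?k x + e * ?N) / ?N"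
    using N by (intro divide_right_mono) auto
  moreover have "\<bar>conv v ?k x - ?N * f x\<bar> / ?N = \<bar>conv v ?k x / ?N - f x\<bar>"
  proof -
    have "conv v ?k x / ?N - f x = (conv v ?k x - ?N * f x) / ?N" using N by (simp add: diff_divide_distrib)
    then show ?thesis using N by (simp only: abs_divide abs_of_pos)
  qed
  ultimately show ?thesis using N by (simp add: add_divide_distrib)
qed

text \<open>\<open>u\<close> is the scale-independent mean of \<open>v\<close>. To see that it
  equals \<open>v\<close> almost everywhere, both are compared with a continuous \<open>f\<close>
  close to \<open>v\<close> in L1. The hypothesis \<open>approx\<close> asks for such functions; for
  \<open>\<Phi> - h\<close> they are the functions \<open>\<Phi> - \<psi> n\<close>.\<close>

lemma Weyl:
  assumes v: "weakly_harmonic v"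
    and approx: "\<And>e. e > 0 \<Longrightarrow> \<exists>f. continuous_on (closure \<Omega>) f \<and> (\<integral>y. \<bar>v y - f y\<bar> \<partial>M) \<le> e"
  obtains u where "harmonic_on \<Omega> u" "AE x in M. v x = u x"
proof -
  let ?k = "\<lambda>\<tau>. bump_kernel (exp_recip_deriv 1) \<tau> :: 'a \<Rightarrow> real"
  have vi: "integrable M v" using v by (simp add: weakly_harmonic_def)
  have "\<exists>\<rho>. \<forall>x\<in>\<Omega>. \<rho> x > 0 \<and> cball x (\<rho> x) \<subseteq> \<Omega>"
    using open_dom open_contains_cball by (intro bchoice) blast
  then obtain \<rho> where \<rho>: "\<And>x. x \<in> \<Omega> \<Longrightarrow> \<rho> x > 0" "\<And>x. x \<in> \<Omega> \<Longrightarrow> cball x (\<rho> x) \<subseteq> \<Omega>" by blast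
  define U where "U \<tau> x = conv v (?k \<tau>) x / kernel_mass \<tau>" for \<tau> x
  define u where "u x = U (1 / (\<rho> x)\<^sup>2) x" for x
  have uU: "u x = U (1 / r\<^sup>2) x" if x: "x \<in> \<Omega>" and r: "r > 0" "cball x r \<subseteq> \<Omega>" for x r
  proof -
    \<comment> \<open>The larger of the two radii: both scales then lie in the range in which the
      means at \<open>x\<close> are constant.\<close>
    define R where "R = max r (\<rho> x)"
    have "0 < R" "cball x R \<subseteq> \<Omega>" using r \<rho>[OF x] by (auto simp: R_def max_def)
    moreover have "1 / R\<^sup>2 \<le> 1 / s\<^sup>2" if "0 < s" "s \<le> R" for s
      using that by (intro divide_left_mono power_mono mult_pos_pos zero_less_power) auto
    ultimately show ?thesis
      unfolding u_def U_def using r \<rho>(1)[OF x]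
      by (intro weakly_harmonic_mean_constant[OF v, of R]) (auto simp: R_def)
  qed
  have harm: "harmonic_on \<Omega> u"
  proof (rule harmonic_on_local)
    fix x0 assume x0: "x0 \<in> \<Omega>"
    \<comment> \<open>Half the radius, so that balls of radius \<open>r\<close> about points of
      \<open>ball x0 r\<close> stay inside the ball of radius \<rho> x0 about x0.\<close>
    define r where "r = \<rho> x0 / 2"
    have r: "r > 0" using \<rho>(1)[OF x0] by (simp add: r_def)
    have sub: "cball x r \<subseteq> \<Omega>" if "x \<in> ball x0 r" for x
    proof -
      have "cball x r \<subseteq> cball x0 (\<rho> x0)"
      proof
        fix y assume "y \<in> cball x r"
        then show "y \<in> cball x0 (\<rho> x0)" using that dist_triangle[of x0 y x] by (simp add: r_def)
      qed
      then show ?thesis using \<rho>(2)[OF x0] by blast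
    qed
    then have dom: "x \<in> \<Omega>" if "x \<in> ball x0 r" for x using that r by force
    show "\<exists>T U. open T \<and> x0 \<in> T \<and> harmonic_on T U \<and> (\<forall>y\<in>T. u y = U y)"
    proof (intro exI conjI)
      show "open (ball x0 r)" "x0 \<in> ball x0 r" using r by auto
      show "harmonic_on (ball x0 r) (U (1 / r\<^sup>2))"
        unfolding U_def using sub by (intro harmonic_on_mean[OF v r]) auto
      show "\<forall>y\<in>ball x0 r. u y = U (1 / r\<^sup>2) y" using uU[OF dom r sub] by blast
    qed
  qed
  have um [measurable]: "u \<in> borel_measurable M"
    by (intro measurable_continuous C1_on_continuous harmonic_on_C1 harm)
  have vm [measurable]: "v \<in> borel_measurable M" using vi by auto
  have inf [measurable]: "(\<lambda>x. infdist x (- \<Omega>)) \<in> borel_measurable M"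
    by (rule measurable_continuous) (intro continuous_intros)
  have AEr: "AE x in M. r < infdist x (- \<Omega>) \<longrightarrow> v x = u x" if r: "r > 0" for r
  proof -
    \<comment> \<open>Only points at distance more than \<open>r\<close> from the complement are
      compared, so that one kernel radius works for all of them.\<close>
    define W where "W x = (if r < infdist x (- \<Omega>) then \<bar>u x - v x\<bar> else 0)" for x
    have [measurable]: "W \<in> borel_measurable M" unfolding W_def by measurable
    define m where "m = measure M (space M)"
    have m: "emeasure M (space M) = ennreal m"
      unfolding m_def using finite_measure.emeasure_eq_measure[OF finite_measure_dom] by blast
    \<comment> \<open>One e comes from averaging |v - f|, one from |v - f| itself, and e m from the
      oscillation of \<open>f\<close>, integrated over \<Omega>.\<close>
    have small: "(\<integral>\<^sup>+x. ennreal (W x) \<partial>M) \<le> ennreal (e * (2 + m))" if e: "e > 0" for e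
    proof -
      obtain f where f: "continuous_on (closure \<Omega>) f" "(\<integral>y. \<bar>v y - f y\<bar> \<partial>M) \<le> e" using approx[OF e] by blast
      have "uniformly_continuous_on (closure \<Omega>) f"
        using bounded_dom by (intro compact_uniformly_continuous f) auto
      then obtain d where d: "d > 0" "\<And>x y. x \<in> closure \<Omega> \<Longrightarrow> y \<in> closure \<Omega> \<Longrightarrow> dist y x < d \<Longrightarrow> dist (f y) (f x) < e"
        using e unfolding uniformly_continuous_on_def by metis
      \<comment> \<open>At most \<open>r\<close>, so that the balls stay in \<Omega>, and at most
        \<open>d\<close>, so that \<open>f\<close> oscillates by less than \<open>e\<close> on
        them.\<close>
      define s where "s = min d r"
      have s: "s > 0" "s \<le> r" "s \<le> d" using d r by (auto simp: s_def)
      have fi: "integrable M f"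
        by (rule square_integrable_integrable[OF square_integrable_continuous_closure[OF f(1)]])
      have ai: "integrable M (\<lambda>y. \<bar>v y - f y\<bar>)" using vi fi by auto
      have [measurable]: "f \<in> borel_measurable M" using fi by auto
      let ?N = "kernel_mass (1 / s\<^sup>2)" let ?g = "conv (\<lambda>y. \<bar>v y - f y\<bar>) (?k (1 / s\<^sup>2))"
      have k: "test_fun UNIV (?k (1 / s\<^sup>2))" by (rule test_fun_kernel(1)[OF s(1) order_refl])
      have gc: "continuous_on \<Omega> ?g"
        by (intro continuous_at_imp_continuous_on ballI differentiable_imp_continuous_within conv_differentiable ai k)
      have [measurable]: "?g \<in> borel_measurable M" by (rule measurable_continuous[OF gc])
      have N0: "0 \<le> ?N" unfolding kernel_mass_def
        by (intro Bochner_Integration.integral_nonneg) (rule bump_kernel_deriv_1_nonneg)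
      have g0: "0 \<le> ?g x" for x unfolding conv_def
        by (intro Bochner_Integration.integral_nonneg mult_nonneg_nonneg) (auto simp: bump_kernel_deriv_1_nonneg)
      have W: "W x \<le> inverse ?N * ?g x + (e + \<bar>v x - f x\<bar>)" if x: "x \<in> \<Omega>" for x
      proof (cases "r < infdist x (- \<Omega>)")
        case True
        have sub: "cball x s \<subseteq> \<Omega>" using cball_subset_dom[of s x] True s by simp
        have "\<bar>U (1 / s\<^sup>2) x - f x\<bar> \<le> ?g x / ?N + e"
          unfolding U_def
        proof (rule mean_near[OF v s(1) sub f(1)])
          fix y assume "y \<in> \<Omega>" "dist x y < s"
          moreover have "x \<in> closure \<Omega>" "y \<in> closure \<Omega>" using x \<open>y \<in> \<Omega>\<close> closure_subset[of \<Omega>] by auto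
          ultimately have "dist (f y) (f x) < e" using s(3) by (intro d(2)) (simp_all add: dist_commute)
          then show "\<bar>f y - f x\<bar> \<le> e" by (simp add: dist_real_def)
        qed
        then show ?thesis using True uU[OF x s(1) sub] by (simp add: W_def divide_inverse mult.commute)
      next
        case False
        then show ?thesis using g0 N0 e by (simp add: W_def)
      qed
      have "(\<integral>\<^sup>+x. ennreal (W x) \<partial>M) \<le> (\<integral>\<^sup>+x. ennreal (inverse ?N) * ennreal (?g x) + (ennreal e + ennreal \<bar>v x - f x\<bar>) \<partial>M)"
      proof (rule nn_integral_mono)
        fix x assume "x \<in> space M"
        then have "ennreal (W x) \<le> ennreal (inverse ?N * ?g x + (e + \<bar>v x - f x\<bar>))" using W[of x] by (intro ennreal_leI) simp
        also have "\<dots> = ennreal (inverse ?N) * ennreal (?g x) + (ennreal e + ennreal \<bar>v x - f x\<bar>)"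
          using N0 g0[of x] e by (simp add: ennreal_plus ennreal_mult)
        finally show "ennreal (W x) \<le> ennreal (inverse ?N) * ennreal (?g x) + (ennreal e + ennreal \<bar>v x - f x\<bar>)" .
      qed
      also have "\<dots> = ennreal (inverse ?N) * (\<integral>\<^sup>+x. ennreal (?g x) \<partial>M) + (ennreal e * emeasure M (space M) + (\<integral>\<^sup>+x. ennreal \<bar>v x - f x\<bar> \<partial>M))"
        by (simp add: nn_integral_add nn_integral_cmult)
      also have "\<dots> \<le> ennreal (inverse ?N) * (ennreal ?N * ennreal (\<integral>y. \<bar>v y - f y\<bar> \<partial>M))
          + (ennreal e * ennreal m + ennreal (\<integral>y. \<bar>v y - f y\<bar> \<partial>M))"
        unfolding m using nn_integral_eq_integral[OF ai]
        by (intro add_mono mult_left_mono nn_integral_conv_le[OF ai _ s(1) order_refl]) auto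
      also have "\<dots> \<le> ennreal (inverse ?N * (?N * e) + (e * m + e))"
      proof -
        have "inverse ?N * (?N * (\<integral>y. \<bar>v y - f y\<bar> \<partial>M)) + (e * m + (\<integral>y. \<bar>v y - f y\<bar> \<partial>M)) \<le> inverse ?N * (?N * e) + (e * m + e)"
          using f(2) N0 e by (intro add_mono mult_left_mono) auto
        moreover have "0 \<le> (\<integral>y. \<bar>v y - f y\<bar> \<partial>M)" "0 \<le> m" by (auto simp: m_def)
        ultimately show ?thesis using N0 e by (simp add: ennreal_mult[symmetric] ennreal_plus[symmetric] del: ennreal_plus)
      qed
      also have "\<dots> \<le> ennreal (e * (2 + m))"
      proof (rule ennreal_leI)
        \<comment> \<open>Positivity of the mass was derived only for balls inside \<Omega>, and
          there may be none of this radius. If the mass were zero, the convention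
          \<open>inverse 0 = 0\<close> still gives the inequality.\<close>
        have "inverse ?N * (?N * e) \<le> e" using e by (cases "?N = 0") auto
        then show "inverse ?N * (?N * e) + (e * m + e) \<le> e * (2 + m)" by (simp add: algebra_simps)
      qed
      finally show ?thesis .
    qed
    have "(\<integral>\<^sup>+x. ennreal (W x) \<partial>M) \<le> 0"
    proof (rule ennreal_le_epsilon)
      fix e :: real assume e: "e > 0"
      have m0: "0 \<le> m" by (simp add: m_def)
      have "(\<integral>\<^sup>+x. ennreal (W x) \<partial>M) \<le> ennreal ((e / (2 + m)) * (2 + m))"
        using e m0 by (intro small divide_pos_pos) auto
      then show "(\<integral>\<^sup>+x. ennreal (W x) \<partial>M) \<le> 0 + ennreal e" using m0 by simp
    qed
    then have "AE x in M. ennreal (W x) = 0" by (subst (asm) le_zero_eq, subst (asm) nn_integral_0_iff_AE) auto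
    then show ?thesis by eventually_elim (auto simp: W_def ennreal_eq_0_iff split: if_splits)
  qed
  \<comment> \<open>Countably many distances 1 / (n + 1) exhaust the open set \<Omega>.\<close>
  have "AE x in M. \<forall>n. inverse (real (Suc n)) < infdist x (- \<Omega>) \<longrightarrow> v x = u x"
    unfolding AE_all_countable using AEr by simp
  moreover have "AE x in M. x \<in> \<Omega>" by (rule AE_I2) simp
  ultimately have "AE x in M. v x = u x"
  proof eventually_elim
    case (elim x)
    \<comment> \<open>\<open>infdist\<close> to the empty set is 0 by convention, so a nonempty
      complement is essential for a positive distance.\<close>
    have "- \<Omega> \<noteq> {}" using bounded_dom not_bounded_UNIV by (metis Compl_empty_eq double_compl)
    then have "infdist x (- \<Omega>) > 0"
      using elim(2) open_dom in_closed_iff_infdist_zero[of "- \<Omega>" x] infdist_nonneg[of x "- \<Omega>"]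
      by (auto simp: order_less_le)
    then obtain n where "inverse (real (Suc n)) < infdist x (- \<Omega>)" using reals_Archimedean by blast
    then show ?case using elim(1) by blast
  qed
  then show ?thesis using harm that by blast
qed

end

section \<open>The harmonic part of a continuous function\<close>

context bounded_open begin

lemma L2_on_iff: "L2_on \<Omega> f \<longleftrightarrow> square_integrable M f"
  by (simp add: L2_on_def square_integrable_def)

lemma L2_vec_on_iff: "L2_vec_on \<Omega> g \<longleftrightarrow> square_integrable M g"
proof
  assume L: "L2_vec_on \<Omega> g"
  then have m: "(\<lambda>x. g x \<bullet> i) \<in> borel_measurable M" if "i \<in> Basis" for i
    using that by (simp add: L2_vec_on_def L2_on_def)
  have "g \<in> borel_measurable M" using m by (subst borel_measurable_euclidean_space) auto
  moreover have "(norm (g x))\<^sup>2 = (\<Sum>i\<in>Basis. (g x \<bullet> i)\<^sup>2)" for x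
    unfolding power2_norm_eq_inner by (subst euclidean_inner) (simp add: power2_eq_square)
  then have "integrable M (\<lambda>x. (norm (g x))\<^sup>2)"
    using L by (simp add: L2_vec_on_def L2_on_def)
  ultimately show "square_integrable M g" by (simp add: square_integrable_def)
next
  assume g: "square_integrable M g"
  have [measurable]: "g \<in> borel_measurable M" by (rule square_integrable_measurable[OF g])
  have "integrable M (\<lambda>x. (g x \<bullet> i)\<^sup>2)" if "i \<in> Basis" for i
  proof (rule Bochner_Integration.integrable_bound)
    show "integrable M (\<lambda>x. (norm (g x))\<^sup>2)" using g by (simp add: square_integrable_def)
    have "(g x \<bullet> i)\<^sup>2 \<le> (norm (g x))\<^sup>2" for x
      using Basis_le_norm[OF that, of "g x"] by (simp add: abs_le_square_iff[symmetric])
    then show "AE x in M. norm ((g x \<bullet> i)\<^sup>2) \<le> norm ((norm (g x))\<^sup>2)" by (intro AE_I2) simp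
  qed measurable
  then show "L2_vec_on \<Omega> g" by (auto simp: L2_vec_on_def L2_on_def)
qed

lemma l2_norm_power2_real: "(\<integral>x. (f x - g x)\<^sup>2 \<partial>M) = (l2_norm M (\<lambda>x. f x - g x))\<^sup>2"
  by (simp add: l2_norm_power2_integral)

lemma H1_0_D:
  assumes "H1_0 \<Omega> f"
  obtains g \<psi> where "square_integrable M f" "square_integrable M g" "\<And>n. test_fun \<Omega> (\<psi> n)"
    "(\<lambda>n. l2_norm M (\<lambda>x. \<psi> n x - f x)) \<longlonglongrightarrow> 0" "(\<lambda>n. l2_norm M (\<lambda>x. grad (\<psi> n) x - g x)) \<longlonglongrightarrow> 0"
proof -
  obtain g \<psi> where *: "square_integrable M f" "square_integrable M g" "\<And>n. test_fun \<Omega> (\<psi> n)"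
    and lim: "(\<lambda>n. (l2_norm M (\<lambda>x. \<psi> n x - f x))\<^sup>2 + (l2_norm M (\<lambda>x. grad (\<psi> n) x - g x))\<^sup>2) \<longlonglongrightarrow> 0"
    using assms unfolding H1_0_def L2_on_iff L2_vec_on_iff l2_norm_power2_real l2_norm_power2_integral[symmetric] by blast
  have "(\<lambda>n. (l2_norm M (\<lambda>x. \<psi> n x - f x))\<^sup>2) \<longlonglongrightarrow> 0"
    by (rule Lim_null_comparison[OF _ lim]) simp
  from tendsto_real_sqrt[OF this] have 1: "(\<lambda>n. l2_norm M (\<lambda>x. \<psi> n x - f x)) \<longlonglongrightarrow> 0" by simp
  have "(\<lambda>n. (l2_norm M (\<lambda>x. grad (\<psi> n) x - g x))\<^sup>2) \<longlonglongrightarrow> 0"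
    by (rule Lim_null_comparison[OF _ lim]) simp
  from tendsto_real_sqrt[OF this] have 2: "(\<lambda>n. l2_norm M (\<lambda>x. grad (\<psi> n) x - g x)) \<longlonglongrightarrow> 0" by simp
  show ?thesis by (rule that[OF * 1 2])
qed

text \<open>Membership concerns functions, not classes, and Weyl's lemma identifies \<open>h\<close>
  with \<open>\<Phi> - u\<close> only almost everywhere. The weak gradient and the approximating
  sequence of \<open>h\<close> are carried over null sets.\<close>

lemma H1_0_I:
  assumes h: "square_integrable M h" "square_integrable M g" "\<And>n. test_fun \<Omega> (\<psi> n)"
    "(\<lambda>n. l2_norm M (\<lambda>x. \<psi> n x - h x)) \<longlonglongrightarrow> 0" "(\<lambda>n. l2_norm M (\<lambda>x. grad (\<psi> n) x - g x)) \<longlonglongrightarrow> 0"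
    and f: "f \<in> borel_measurable M" "AE x in M. h x = f x"
  shows "H1_0 \<Omega> f"
proof -
  have [measurable]: "h \<in> borel_measurable M" "f \<in> borel_measurable M"
    using f(1) square_integrable_measurable[OF h(1)] by auto
  have "integrable M (\<lambda>x. (norm (h x))\<^sup>2) \<longleftrightarrow> integrable M (\<lambda>x. (norm (f x))\<^sup>2)"
    using f(2) by (intro integrable_cong_AE) auto
  then have fs: "square_integrable M f" using h(1) f(1) by (simp add: square_integrable_def)
  have wg: "weak_gradient \<Omega> f g"
    unfolding weak_gradient_def
  proof (intro allI impI ballI)
    fix w and i :: 'a assume w: "test_fun \<Omega> w" and i: "i \<in> Basis"
    have [measurable]: "dderiv i w \<in> borel_measurable M"
      by (rule square_integrable_measurable[OF test_fun_square_integrable(4)[OF w i]])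
    have "(\<integral>x. f x * dderiv i w x \<partial>M) = (\<integral>x. h x * dderiv i w x \<partial>M)"
      using f(2) by (intro integral_cong_AE) auto
    also have "\<dots> = - (\<integral>x. (g x \<bullet> i) * w x \<partial>M)"
      using weak_gradient_limit[OF h(3,1,2,4,5)] w i by (simp add: weak_gradient_def)
    finally show "(\<integral>x. f x * dderiv i w x \<partial>M) = - (\<integral>x. (g x \<bullet> i) * w x \<partial>M)" .
  qed
  have eq: "l2_norm M (\<lambda>x. \<psi> n x - f x) = l2_norm M (\<lambda>x. \<psi> n x - h x)" for n
    using f(2) by (intro l2_norm_cong_AE square_integrable_diff fs h(1) test_fun_square_integrable h(3)) auto
  have "(\<lambda>n. (l2_norm M (\<lambda>x. \<psi> n x - f x))\<^sup>2 + (l2_norm M (\<lambda>x. grad (\<psi> n) x - g x))\<^sup>2) \<longlonglongrightarrow> 0\<^sup>2 + 0\<^sup>2"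
    unfolding eq by (intro tendsto_intros h)
  then show ?thesis
    unfolding H1_0_def L2_on_iff L2_vec_on_iff l2_norm_power2_real l2_norm_power2_integral[symmetric]
    using fs h(2,3) wg by auto
qed

section \<open>Existence of the harmonic part\<close>

lemma harmonic_extension_exists:
  assumes "continuous_on (frontier \<Omega>) \<phi>"
  obtains u \<Phi> where "harmonic_on \<Omega> u" "continuous_on (closure \<Omega>) \<Phi>" "\<And>x. x \<in> frontier \<Omega> \<Longrightarrow> \<Phi> x = \<phi> x"
    "H1_0 \<Omega> (\<lambda>x. \<Phi> x - u x)"
proof -
  obtain \<Phi> where \<Phi>: "continuous_on (closure \<Omega>) \<Phi>" "\<And>x. x \<in> frontier \<Omega> \<Longrightarrow> \<Phi> x = \<phi> x"
    "\<And>w. test_fun \<Omega> w \<Longrightarrow> \<bar>\<integral>x. \<Phi> x * laplacian w x \<partial>M\<bar> \<le> 2 * l2_norm M (grad w)"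
    using extension_with_bounded_laplacian[OF assms] by blast
  obtain \<psi> h g where h: "\<And>n. test_fun \<Omega> (\<psi> n)" "square_integrable M h" "square_integrable M g"
    "(\<lambda>n. l2_norm M (\<lambda>x. \<psi> n x - h x)) \<longlonglongrightarrow> 0" "(\<lambda>n. l2_norm M (\<lambda>x. grad (\<psi> n) x - g x)) \<longlonglongrightarrow> 0"
    "\<And>w. test_fun \<Omega> w \<Longrightarrow> (\<integral>x. (\<Phi> x - h x) * laplacian w x \<partial>M) = 0"
    using Dirichlet_correction[OF \<Phi>(1,3)] by blast
  define v where "v x = \<Phi> x - h x" for x
  have vs: "square_integrable M v"
    unfolding v_def by (intro square_integrable_diff square_integrable_continuous_closure \<Phi> h)
  have v: "weakly_harmonic v"
    unfolding weakly_harmonic_def using h(6) square_integrable_integrable[OF vs] by (simp add: v_def)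
  \<comment> \<open>Subtracting \<open>\<Phi> - \<psi> n\<close> from \<open>\<Phi> - h\<close>
    leaves \<open>\<psi> n - h\<close>, small in L2. Cauchy-Schwarz against the constant 1 makes it
    small in L1.\<close>
  have approx: "\<exists>f. continuous_on (closure \<Omega>) f \<and> (\<integral>y. \<bar>v y - f y\<bar> \<partial>M) \<le> e" if e: "e > 0" for e
  proof -
    have "(\<lambda>n. l2_norm M (\<lambda>x. \<psi> n x - h x) * l2_norm M (\<lambda>x. 1::real)) \<longlonglongrightarrow> 0"
      by (rule tendsto_mult_left_zero[OF h(4)])
    from LIMSEQ_D[OF this e] obtain n where n: "l2_norm M (\<lambda>x. \<psi> n x - h x) * l2_norm M (\<lambda>x. 1::real) < e" by auto
    have d: "square_integrable M (\<lambda>x. \<psi> n x - h x)"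
      by (intro square_integrable_diff h test_fun_square_integrable)
    have "continuous_on (closure \<Omega>) (\<lambda>x. \<Phi> x - \<psi> n x)"
      using h(1)[of n] by (intro continuous_on_diff \<Phi> C1_on_continuous smooth_fun_C1_on) (simp add: test_fun_def)
    moreover have "(\<integral>y. \<bar>v y - (\<Phi> y - \<psi> n y)\<bar> \<partial>M) = l2_inner M (\<lambda>x. norm (\<psi> n x - h x)) (\<lambda>x. 1)"
      by (simp add: v_def l2_inner_def)
    moreover have "\<dots> \<le> l2_norm M (\<lambda>x. \<psi> n x - h x) * l2_norm M (\<lambda>x. 1::real)"
      using l2_inner_Cauchy_Schwarz[OF square_integrable_norm[OF d] square_integrable_const[of 1]] unfolding l2_norm_norm by linarith
    ultimately show ?thesis using n by (intro exI[of _ "\<lambda>x. \<Phi> x - \<psi> n x"]) auto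
  qed
  obtain u where u: "harmonic_on \<Omega> u" "AE x in M. v x = u x" using Weyl[OF v approx] by blast
  have um: "u \<in> borel_measurable M" by (intro measurable_continuous C1_on_continuous harmonic_on_C1 u)
  have \<Phi>m: "\<Phi> \<in> borel_measurable M" by (intro square_integrable_measurable square_integrable_continuous_closure \<Phi>)
  have "H1_0 \<Omega> (\<lambda>x. \<Phi> x - u x)"
  proof (rule H1_0_I[OF h(2,3,1,4,5)])
    show "(\<lambda>x. \<Phi> x - u x) \<in> borel_measurable M" using um \<Phi>m by measurable
    show "AE x in M. h x = \<Phi> x - u x" using u(2) by eventually_elim (simp add: v_def)
  qed
  then show ?thesis using that u \<Phi> by blast
qed

section \<open>Uniqueness of the harmonic part\<close>

lemma integrable_grad_inner:
  assumes "C1_on \<Omega> f" "C1_compact \<Omega> w"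
  shows "integrable M (\<lambda>x. grad f x \<bullet> grad w x)"
proof -
  have w: "C1_on \<Omega> w" "compact (support w)" "support w \<subseteq> \<Omega>"
    using assms(2) C1_on_subset[of UNIV w \<Omega>] by (auto simp: C1_compact_def)
  show ?thesis
    by (rule integrable_compact_support(1)[OF continuous_on_inner[OF C1_on_continuous_grad[OF assms(1)] C1_on_continuous_grad[OF w(1)]] w(2,3)])
      (simp add: grad_notin_support)
qed

text \<open>If q > b + sqrt c, then q and q - b both exceed sqrt c, so q (q - b) > c. The
  coefficient of \<open>b\<close> in the conclusion is exactly 1, which the sharp comparison of
  energies needs while \<open>c\<close> tends to 0.\<close>

lemma quadratic_bound:
  fixes q b c :: real
  assumes "q\<^sup>2 \<le> b * q + c" "0 \<le> b" "0 \<le> c"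
  shows "q \<le> b + sqrt c"
proof (rule ccontr)
  assume "\<not> q \<le> b + sqrt c"
  then have q: "q - b > sqrt c" "q > sqrt c" using assms by auto
  have "sqrt c * sqrt c < q * (q - b)"
    using q assms by (intro mult_strict_mono') auto
  then show False using assms by (simp add: power2_eq_square algebra_simps)
qed

text \<open>The test function is a smooth truncation of the smooth functions \<open>u + \<psi> n\<close>, which approximate
  \<open>\<Psi>\<close>; it is cut off to the compact set where \<open>\<Psi>\<close> is not small, and the cut-off costs nothing in
  the limit because the truncation of \<open>\<Psi>\<close> vanishes where the cut-off function varies.\<close>

lemma energy_bounded_approximation:
  assumes \<Psi>: "continuous_on (closure \<Omega>) \<Psi>" "\<And>x. x \<in> frontier \<Omega> \<Longrightarrow> \<Psi> x = 0"
    and u: "C1_on \<Omega> u" "\<And>w. C1_compact \<Omega> w \<Longrightarrow> l2_inner M (grad u) (grad w) = 0"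
    and us: "square_integrable M u" and g: "square_integrable M g" and \<psi>: "\<And>n. test_fun \<Omega> (\<psi> n)"
    and lim: "(\<lambda>n. l2_norm M (\<lambda>x. u x + \<psi> n x - \<Psi> x)) \<longlonglongrightarrow> 0" "(\<lambda>n. l2_norm M (\<lambda>x. grad (\<psi> n) x - g x)) \<longlonglongrightarrow> 0"
    and \<eta>: "\<eta> > 0"
  obtains \<xi> where "C1_compact \<Omega> \<xi>" "l2_norm M (\<lambda>x. \<xi> x - \<Psi> x) \<le> \<eta>" "l2_norm M (grad \<xi>) \<le> l2_norm M g + \<eta>"
proof -
  define N1 where "N1 = l2_norm M (\<lambda>x. 1::real)"
  have N1: "0 \<le> N1" by (simp add: N1_def)
  \<comment> \<open>Truncation moves values by at most 2 \<epsilon>, which costs at most \<eta> / 2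
    in the L2 norm. The summand 1 avoids a zero denominator for empty \<Omega>.\<close>
  define \<epsilon> where "\<epsilon> = \<eta> / (4 * (1 + N1))"
  have \<epsilon>: "\<epsilon> > 0" "2 * \<epsilon> * N1 \<le> \<eta> / 2"
    using \<eta> N1 by (auto simp: \<epsilon>_def field_simps)
  obtain T T' where T: "smooth_fun T" "\<And>t. (T has_real_derivative T' t) (at t)"
    "\<And>t. 0 \<le> T' t" "\<And>t. T' t \<le> 1" "\<And>t. \<bar>t\<bar> \<le> \<epsilon> \<Longrightarrow> T t = t" "\<And>t. \<bar>T t\<bar> \<le> 2 * \<epsilon>"
    "continuous_on UNIV T'"
    using smooth_truncation_exists[OF \<epsilon>(1)] by blast
  \<comment> \<open>Complementary to the truncation: zero for |t| \<le> \<epsilon>, within 2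
    \<epsilon> of the identity, and with slope between 0 and 1.\<close>
  define \<theta> where "\<theta> t = t - T t" for t
  define \<theta>' where "\<theta>' t = 1 - T' t" for t
  have \<theta>: "(\<theta> has_real_derivative \<theta>' t) (at t)" for t
    unfolding \<theta>_def \<theta>'_def using T(2) by (auto intro!: derivative_eq_intros)
  have \<theta>'01: "0 \<le> \<theta>' t" "\<theta>' t \<le> 1" for t using T(3,4) by (auto simp: \<theta>'_def)
  have \<theta>'c: "continuous_on UNIV \<theta>'" unfolding \<theta>'_def by (intro continuous_intros T(7))
  have \<theta>0: "\<theta> t = 0" if "\<bar>t\<bar> \<le> \<epsilon>" for t using T(5)[OF that] by (simp add: \<theta>_def)
  have \<theta>near: "\<bar>\<theta> t - t\<bar> \<le> 2 * \<epsilon>" for t using T(6)[of t] by (simp add: \<theta>_def)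
  have \<theta>lip: "\<bar>\<theta> s - \<theta> t\<bar> \<le> \<bar>s - t\<bar>" for s t
  proof -
    have "norm (\<theta> s - \<theta> t) \<le> 1 * norm (s - t)"
      by (rule field_differentiable_bound[of UNIV \<theta> \<theta>']) (use \<theta> \<theta>'01 in auto)
    then show ?thesis by simp
  qed
  define K where "K = {x \<in> closure \<Omega>. \<epsilon> \<le> \<bar>\<Psi> x\<bar>}"
  have "K = closure \<Omega> \<inter> (\<lambda>x. \<bar>\<Psi> x\<bar>) -` {\<epsilon>..}" by (auto simp: K_def)
  then have "closed K"
    using continuous_closed_preimage[OF continuous_on_rabs[OF \<Psi>(1)] closed_closure closed_atLeast, of \<epsilon>] by simp
  then have K: "compact K" by (rule compact_subset[of "closure \<Omega>", rotated]) (use bounded_dom in \<open>auto simp: K_def\<close>)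
  have K\<Omega>: "K \<subseteq> \<Omega>"
  proof
    fix x assume x: "x \<in> K"
    show "x \<in> \<Omega>"
    proof (rule ccontr)
      assume "x \<notin> \<Omega>"
      then have "x \<in> frontier \<Omega>" using x open_dom by (simp add: K_def frontier_def interior_open)
      then show False using \<Psi>(2) x \<epsilon>(1) by (auto simp: K_def)
    qed
  qed
  obtain \<zeta> where \<zeta>: "test_fun \<Omega> \<zeta>" "\<And>x. x \<in> K \<Longrightarrow> \<zeta> x = 1" "\<And>x. 0 \<le> \<zeta> x" "\<And>x. \<zeta> x \<le> 1"
    using cutoff_exists[OF K open_dom K\<Omega>] by blast
  have \<zeta>\<theta>: "\<theta> (\<Psi> x) * \<zeta> x = \<theta> (\<Psi> x)" if "x \<in> \<Omega>" for x
  proof (cases "\<bar>\<Psi> x\<bar> \<le> \<epsilon>")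
    case False
    then have "x \<in> K" using that closure_subset[of \<Omega>] by (auto simp: K_def)
    then show ?thesis by (simp add: \<zeta>(2))
  qed (simp add: \<theta>0)
  have grad\<zeta>: "\<theta> (\<Psi> x) *\<^sub>R grad \<zeta> x = 0" if x: "x \<in> \<Omega>" for x
  proof (cases "\<bar>\<Psi> x\<bar> \<le> \<epsilon>")
    case False
    define S where "S = \<Omega> \<inter> (\<lambda>x. \<bar>\<Psi> x\<bar>) -` {\<epsilon><..}"
    have "continuous_on \<Omega> (\<lambda>x. \<bar>\<Psi> x\<bar>)"
      by (intro continuous_intros continuous_on_subset[OF \<Psi>(1) closure_subset])
    then have "open S" unfolding S_def by (rule continuous_open_preimage[OF _ open_dom]) simp
    moreover have "x \<in> S" using False x by (simp add: S_def)
    moreover have "\<zeta> y = 1" if "y \<in> S" for y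
      using that closure_subset[of \<Omega>] by (intro \<zeta>(2)) (auto simp: S_def K_def)
    ultimately have "\<forall>\<^sub>F y in nhds x. \<zeta> y = 1" by (rule eventually_nhds_open)
    then have "dderiv i \<zeta> x = 0" for i using dderiv_cong_ev[of \<zeta> "\<lambda>y. 1" x i] by simp
    then show ?thesis by (simp add: grad_def)
  qed (simp add: \<theta>0)
  define \<xi> where "\<xi> n x = \<theta> (u x + \<psi> n x) * \<zeta> x" for n x
  \<comment> \<open>The product rule splits \<open>grad (\<xi> n)\<close> into the part
    \<open>e n\<close> carried by \<open>grad \<zeta>\<close> and the part \<open>q n\<close>, which
    is \<open>grad u + grad (\<psi> n)\<close> times a factor between 0 and 1.\<close>
  define e where "e n x = \<theta> (u x + \<psi> n x) *\<^sub>R grad \<zeta> x" for n x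
  define q where "q n x = grad (\<xi> n) x - e n x" for n x
  \<comment> \<open>\<open>grad u\<close> need not be square integrable on \<Omega>, but it is
    bounded on the compact support of \<zeta>, and \<open>e n\<close> vanishes elsewhere.\<close>
  define a where "a x = indicator (support \<zeta>) x *\<^sub>R grad u x" for x
  have \<psi>C: "C1_on \<Omega> (\<psi> n)" for n using \<psi>[of n] by (simp add: test_fun_def smooth_fun_C1_on)
  have sumC: "C1_on \<Omega> (\<lambda>x. u x + \<psi> n x)" for n by (rule C1_on_add[OF u(1) \<psi>C])
  have \<theta>C: "C1_on \<Omega> (\<lambda>x. \<theta> (u x + \<psi> n x))" for n by (rule C1_on_compose(1)[OF \<theta> \<theta>'c sumC])
  have \<xi>C: "C1_compact \<Omega> (\<xi> n)" for n
    unfolding \<xi>_def by (rule C1_compact_mult[OF open_dom \<theta>C test_fun_C1_compact[OF \<zeta>(1)]])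
  have \<zeta>C: "C1_on \<Omega> \<zeta>" "compact (support \<zeta>)" "support \<zeta> \<subseteq> \<Omega>"
    using \<zeta>(1) by (auto simp: test_fun_def smooth_fun_C1_on)
  have q: "q n x = (\<zeta> x * \<theta>' (u x + \<psi> n x)) *\<^sub>R (grad u x + grad (\<psi> n) x)" if x: "x \<in> \<Omega>" for n x
  proof -
    have d: "(\<lambda>x. \<theta> (u x + \<psi> n x)) differentiable at x" "\<zeta> differentiable at x" "u differentiable at x" "\<psi> n differentiable at x"
      using x \<theta>C \<zeta>C(1) u(1) \<psi>C by (auto simp: C1_on_def)
    have "grad (\<lambda>x. \<theta> (u x + \<psi> n x)) x = \<theta>' (u x + \<psi> n x) *\<^sub>R (grad u x + grad (\<psi> n) x)"
      unfolding grad_add[OF d(3,4), symmetric]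
      by (simp add: grad_def C1_on_compose(2)[OF \<theta> \<theta>'c sumC x] scaleR_sum_right)
    then show ?thesis
      unfolding q_def e_def \<xi>_def[abs_def] using grad_mult[OF d(1,2)] by simp
  qed
  have \<psi>s: "square_integrable M (\<psi> n)" "square_integrable M (grad (\<psi> n))" for n
    by (intro test_fun_square_integrable \<psi>)+
  have \<Psi>s: "square_integrable M \<Psi>" by (rule square_integrable_continuous_closure[OF \<Psi>(1)])
  have ds: "square_integrable M (\<lambda>x. u x + \<psi> n x - \<Psi> x)" for n
    by (intro square_integrable_diff square_integrable_add us \<psi>s \<Psi>s)
  have es: "square_integrable M (e n)" for n
    unfolding e_def
    by (rule integrable_compact_support(2)[OF _ \<zeta>C(2,3)])
      (auto intro!: continuous_on_scaleR C1_on_continuous \<theta>C C1_on_continuous_grad \<zeta>C simp: grad_notin_support)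
  have \<xi>s: "square_integrable M (\<xi> n)" "square_integrable M (grad (\<xi> n))" for n
    by (rule C1_compact_square_integrable[OF \<xi>C])+
  have qs: "square_integrable M (q n)" for n unfolding q_def by (intro square_integrable_diff \<xi>s es)
  have uc: "continuous_on \<Omega> (grad u)" by (rule C1_on_continuous_grad[OF u(1)])
  have as: "square_integrable M a"
  proof -
    obtain B where B: "0 \<le> B" "\<And>x. x \<in> support \<zeta> \<Longrightarrow> norm (grad u x) \<le> B"
      using compact_support_bounded[OF \<zeta>C(2) continuous_on_subset[OF uc \<zeta>C(3)], of "support \<zeta>"] by auto
    have [measurable]: "grad u \<in> borel_measurable M" by (rule measurable_continuous[OF uc])
    have "(indicator (support \<zeta>) :: 'a \<Rightarrow> real) \<in> borel_measurable lborel" by simp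
    then have [measurable]: "(indicator (support \<zeta>) :: 'a \<Rightarrow> real) \<in> borel_measurable M"
      by (intro measurable_restrict_space1 measurable_completion)
    show ?thesis unfolding a_def
    proof (rule square_integrable_bounded[where B=B])
      show "(\<lambda>x. indicator (support \<zeta>) x *\<^sub>R grad u x) \<in> borel_measurable M" by measurable
      show "norm (indicator (support \<zeta>) x *\<^sub>R grad u x) \<le> B" for x
        using B by (cases "x \<in> support \<zeta>") auto
    qed
  qed
  obtain B where B: "0 \<le> B" "\<And>x. x \<in> \<Omega> \<Longrightarrow> norm (grad \<zeta> x) \<le> B"
    using compact_support_bounded[OF \<zeta>C(2) continuous_on_subset[OF C1_on_continuous_grad[OF \<zeta>C(1)] \<zeta>C(3)], of \<Omega>]
    by (auto simp: grad_notin_support)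
  have e_le: "l2_norm M (e n) \<le> B * l2_norm M (\<lambda>x. u x + \<psi> n x - \<Psi> x)" for n
  proof -
    have "l2_norm M (e n) \<le> l2_norm M (\<lambda>x. B *\<^sub>R (u x + \<psi> n x - \<Psi> x))"
    proof (rule l2_norm_mono[OF es square_integrable_scaleR[OF ds]])
      fix x assume "x \<in> space M"
      then have x: "x \<in> \<Omega>" by simp
      \<comment> \<open>Subtracting the vanishing term with \<theta> (\<Psi> x) leaves a difference
        to which the Lipschitz bound of \<theta> applies.\<close>
      have "e n x = (\<theta> (u x + \<psi> n x) - \<theta> (\<Psi> x)) *\<^sub>R grad \<zeta> x"
        using grad\<zeta>[OF x] by (simp add: e_def scaleR_diff_left)
      then have "norm (e n x) = \<bar>\<theta> (u x + \<psi> n x) - \<theta> (\<Psi> x)\<bar> * norm (grad \<zeta> x)" by simp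
      also have "\<dots> \<le> \<bar>u x + \<psi> n x - \<Psi> x\<bar> * B" by (intro mult_mono \<theta>lip B(2) x) auto
      finally show "norm (e n x) \<le> norm (B *\<^sub>R (u x + \<psi> n x - \<Psi> x))" using B(1) by (simp add: abs_mult mult.commute)
    qed
    then show ?thesis using B(1) unfolding l2_norm_scaleR by simp
  qed
  have "(\<lambda>n. B * l2_norm M (\<lambda>x. u x + \<psi> n x - \<Psi> x)) \<longlonglongrightarrow> 0" by (rule tendsto_mult_right_zero[OF lim(1)])
  then have e0: "(\<lambda>n. l2_norm M (e n)) \<longlonglongrightarrow> 0"
    by (rule Lim_null_comparison[rotated]) (use e_le in simp)
  have \<xi>_le: "l2_norm M (\<lambda>x. \<xi> n x - \<Psi> x) \<le> l2_norm M (\<lambda>x. u x + \<psi> n x - \<Psi> x) + \<eta> / 2" for n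
  proof -
    have "l2_norm M (\<lambda>x. \<xi> n x - \<Psi> x) \<le> l2_norm M (\<lambda>x. norm (u x + \<psi> n x - \<Psi> x) + 2 * \<epsilon>)"
    proof (rule l2_norm_mono)
      show "square_integrable M (\<lambda>x. \<xi> n x - \<Psi> x)" by (intro square_integrable_diff \<xi>s \<Psi>s)
      show "square_integrable M (\<lambda>x. norm (u x + \<psi> n x - \<Psi> x) + 2 * \<epsilon>)"
        by (intro square_integrable_add square_integrable_norm ds square_integrable_const)
      fix x assume "x \<in> space M"
      then have x: "x \<in> \<Omega>" by simp
      have "\<xi> n x - \<Psi> x = (\<theta> (u x + \<psi> n x) - \<theta> (\<Psi> x)) * \<zeta> x + (\<theta> (\<Psi> x) - \<Psi> x)"
        using \<zeta>\<theta>[OF x] by (simp add: \<xi>_def algebra_simps)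
      moreover have "\<bar>(\<theta> (u x + \<psi> n x) - \<theta> (\<Psi> x)) * \<zeta> x\<bar> \<le> \<bar>u x + \<psi> n x - \<Psi> x\<bar> * 1"
        unfolding abs_mult using \<zeta>(3,4)[of x] by (intro mult_mono \<theta>lip) auto
      ultimately show "norm (\<xi> n x - \<Psi> x) \<le> norm (norm (u x + \<psi> n x - \<Psi> x) + 2 * \<epsilon>)"
        using \<theta>near[of "\<Psi> x"] by simp
    qed
    also have "\<dots> \<le> l2_norm M (\<lambda>x. norm (u x + \<psi> n x - \<Psi> x)) + l2_norm M (\<lambda>x. (2 * \<epsilon>) *\<^sub>R (1::real))"
      using l2_norm_triangle[OF square_integrable_norm[OF ds] square_integrable_const[of "2 * \<epsilon>"]] by simp
    also have "\<dots> \<le> l2_norm M (\<lambda>x. u x + \<psi> n x - \<Psi> x) + \<eta> / 2"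
      unfolding l2_norm_norm l2_norm_scaleR using \<epsilon> by (simp add: N1_def)
    finally show ?thesis .
  qed
  \<comment> \<open>As \<open>q n\<close> is \<open>grad u + grad (\<psi> n)\<close> times a factor
    in [0, 1], its square is at most its inner product with that sum. Since \<open>grad u\<close> is
    orthogonal to \<open>grad (\<xi> n)\<close>, replacing \<open>q n\<close> by
    \<open>grad (\<xi> n) - e n\<close> in the term with \<open>grad u\<close> leaves only the
    pairing of \<open>a\<close> with \<open>e n\<close>.\<close>
  have q_le: "(l2_norm M (q n))\<^sup>2 \<le> l2_norm M (grad (\<psi> n)) * l2_norm M (q n) + l2_norm M a * l2_norm M (e n)" for n
  proof -
    have ue: "grad u x \<bullet> e n x = a x \<bullet> e n x" for x
      by (cases "x \<in> support \<zeta>") (auto simp: a_def e_def grad_notin_support)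
    have I1: "integrable M (\<lambda>x. grad u x \<bullet> grad (\<xi> n) x)" by (rule integrable_grad_inner[OF u(1) \<xi>C])
    have I2: "integrable M (\<lambda>x. a x \<bullet> e n x)" by (rule square_integrable_inner[OF as es])
    have I3: "integrable M (\<lambda>x. grad (\<psi> n) x \<bullet> q n x)" by (rule square_integrable_inner[OF \<psi>s(2) qs])
    have "l2_inner M (q n) (q n) \<le> (\<integral>x. (grad u x \<bullet> grad (\<xi> n) x - a x \<bullet> e n x) + grad (\<psi> n) x \<bullet> q n x \<partial>M)"
      unfolding l2_inner_def
    proof (rule integral_mono)
      show "integrable M (\<lambda>x. q n x \<bullet> q n x)" by (rule square_integrable_inner[OF qs qs])
      show "integrable M (\<lambda>x. (grad u x \<bullet> grad (\<xi> n) x - a x \<bullet> e n x) + grad (\<psi> n) x \<bullet> q n x)"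
        by (intro Bochner_Integration.integrable_add Bochner_Integration.integrable_diff I1 I2 I3)
      fix x assume "x \<in> space M"
      then have x: "x \<in> \<Omega>" by simp
      define p where "p = grad u x + grad (\<psi> n) x"
      define t where "t = \<zeta> x * \<theta>' (u x + \<psi> n x)"
      have t: "0 \<le> t" "t \<le> 1" using \<zeta>(3,4)[of x] \<theta>'01 by (auto simp: t_def intro: mult_le_one)
      have "q n x \<bullet> q n x = t * (t * (p \<bullet> p))" using q[OF x, of n] by (simp add: p_def t_def)
      also have "\<dots> \<le> 1 * (t * (p \<bullet> p))" using t by (intro mult_right_mono) auto
      also have "\<dots> = p \<bullet> q n x" using q[OF x, of n] by (simp add: p_def t_def)
      also have "\<dots> = grad u x \<bullet> (grad (\<xi> n) x - e n x) + grad (\<psi> n) x \<bullet> q n x"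
        by (simp add: p_def inner_add_left q_def)
      also have "\<dots> = (grad u x \<bullet> grad (\<xi> n) x - a x \<bullet> e n x) + grad (\<psi> n) x \<bullet> q n x"
        by (simp add: inner_diff_right ue)
      finally show "q n x \<bullet> q n x \<le> (grad u x \<bullet> grad (\<xi> n) x - a x \<bullet> e n x) + grad (\<psi> n) x \<bullet> q n x" .
    qed
    also have "\<dots> = (l2_inner M (grad u) (grad (\<xi> n)) - l2_inner M a (e n)) + l2_inner M (grad (\<psi> n)) (q n)"
      unfolding l2_inner_def using I1 I2 I3 by simp
    also have "\<dots> = l2_inner M (grad (\<psi> n)) (q n) - l2_inner M a (e n)" using u(2)[OF \<xi>C] by simp
    also have "\<dots> \<le> l2_norm M (grad (\<psi> n)) * l2_norm M (q n) + l2_norm M a * l2_norm M (e n)"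
      using l2_inner_Cauchy_Schwarz[OF \<psi>s(2)[of n] qs[of n]] l2_inner_Cauchy_Schwarz[OF as es[of n]] by linarith
    finally show ?thesis by (simp add: l2_norm_power2)
  qed
  have grad_le: "l2_norm M (grad (\<xi> n)) \<le> l2_norm M g + (l2_norm M (\<lambda>x. grad (\<psi> n) x - g x) + sqrt (l2_norm M a * l2_norm M (e n)) + l2_norm M (e n))" for n
  proof -
    have "l2_norm M (q n) \<le> l2_norm M (grad (\<psi> n)) + sqrt (l2_norm M a * l2_norm M (e n))"
      by (rule quadratic_bound[OF q_le]) auto
    moreover have "l2_norm M (grad (\<xi> n)) \<le> l2_norm M (q n) + l2_norm M (e n)"
      using l2_norm_triangle[OF qs[of n] es[of n]] by (simp add: q_def)
    moreover have "l2_norm M (grad (\<psi> n)) \<le> l2_norm M (\<lambda>x. grad (\<psi> n) x - g x) + l2_norm M g"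
      using l2_norm_triangle[OF square_integrable_diff[OF \<psi>s(2)[of n] g] g] by simp
    ultimately show ?thesis by linarith
  qed
  have "(\<lambda>n. l2_norm M (\<lambda>x. grad (\<psi> n) x - g x) + sqrt (l2_norm M a * l2_norm M (e n)) + l2_norm M (e n)) \<longlonglongrightarrow> 0 + sqrt (l2_norm M a * 0) + 0"
    by (intro tendsto_intros lim e0)
  then have "\<forall>\<^sub>F n in sequentially. l2_norm M (\<lambda>x. grad (\<psi> n) x - g x) + sqrt (l2_norm M a * l2_norm M (e n)) + l2_norm M (e n) < \<eta>"
    using \<eta> by (intro order_tendstoD(2)) auto
  moreover have "\<forall>\<^sub>F n in sequentially. l2_norm M (\<lambda>x. u x + \<psi> n x - \<Psi> x) < \<eta> / 2"
    using \<eta> by (intro order_tendstoD(2)[OF lim(1)]) auto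
  ultimately have "\<forall>\<^sub>F n in sequentially. l2_norm M (grad (\<xi> n)) \<le> l2_norm M g + \<eta> \<and> l2_norm M (\<lambda>x. \<xi> n x - \<Psi> x) \<le> \<eta>"
  proof eventually_elim
    case (elim n)
    then show ?case using grad_le[of n] \<xi>_le[of n] by linarith
  qed
  then obtain n where "l2_norm M (grad (\<xi> n)) \<le> l2_norm M g + \<eta>" "l2_norm M (\<lambda>x. \<xi> n x - \<Psi> x) \<le> \<eta>"
    using eventually_happens'[OF sequentially_bot] by blast
  then show ?thesis using that[OF \<xi>C] by blast
qed

text \<open>For fixed m the squared distance of \<open>grad (\<xi> k)\<close> from
  \<open>grad (\<psi> m)\<close> is expanded. The mixed term converges as k grows because its
  derivatives can be moved to \<psi> m, and the energy bound controls the square of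
  \<open>grad (\<xi> k)\<close>. The limit is at most the squared distance of \<open>g\<close> from
  \<open>grad (\<psi> m)\<close>, which tends to 0 with m; no weak compactness is involved.\<close>

lemma harmonic_part_zero:
  assumes \<Psi>: "continuous_on (closure \<Omega>) \<Psi>" "\<And>x. x \<in> frontier \<Omega> \<Longrightarrow> \<Psi> x = 0"
    and u: "C1_on \<Omega> u" "\<And>w. C1_compact \<Omega> w \<Longrightarrow> l2_inner M (grad u) (grad w) = 0"
    and us: "square_integrable M u" and g: "square_integrable M g" and \<psi>: "\<And>n. test_fun \<Omega> (\<psi> n)"
    and lim: "(\<lambda>n. l2_norm M (\<lambda>x. u x + \<psi> n x - \<Psi> x)) \<longlonglongrightarrow> 0" "(\<lambda>n. l2_norm M (\<lambda>x. grad (\<psi> n) x - g x)) \<longlonglongrightarrow> 0"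
    and x: "x \<in> \<Omega>"
  shows "u x = 0"
proof -
  have "\<exists>\<xi>. C1_compact \<Omega> \<xi> \<and> l2_norm M (\<lambda>x. \<xi> x - \<Psi> x) \<le> inverse (real (Suc k)) \<and> l2_norm M (grad \<xi>) \<le> l2_norm M g + inverse (real (Suc k))" for k
    by (rule energy_bounded_approximation[OF \<Psi> u us g \<psi> lim, of "inverse (real (Suc k))"]) auto
  then obtain \<xi> where \<xi>: "\<And>k. C1_compact \<Omega> (\<xi> k)" "\<And>k. l2_norm M (\<lambda>x. \<xi> k x - \<Psi> x) \<le> inverse (real (Suc k))"
    "\<And>k. l2_norm M (grad (\<xi> k)) \<le> l2_norm M g + inverse (real (Suc k))"
    by metis
  obtain c where c: "c > 0" "\<And>f. C1_compact \<Omega> f \<Longrightarrow> l2_norm M f \<le> c * l2_norm M (grad f)" using Poincare by blast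
  note \<psi>s = test_fun_square_integrable[OF \<psi>]
  note \<xi>s = C1_compact_square_integrable[OF \<xi>(1)]
  have \<Psi>s: "square_integrable M \<Psi>" by (rule square_integrable_continuous_closure[OF \<Psi>(1)])
  have \<xi>0: "(\<lambda>k. l2_norm M (\<lambda>x. \<xi> k x - \<Psi> x)) \<longlonglongrightarrow> 0"
    by (rule Lim_null_comparison[OF _ LIMSEQ_inverse_real_of_nat]) (use \<xi>(2) in auto)
  \<comment> \<open>\<Psi> and \<open>\<Psi> - u\<close> have the same weak Laplacian, and the
    latter function is the L2 limit of the \<psi> n, whose gradients converge to
    \<open>g\<close>.\<close>
  have key: "l2_inner M \<Psi> (laplacian (\<psi> m)) = - l2_inner M g (grad (\<psi> m))" for m
  proof -
    define w where "w x = \<Psi> x - u x" for x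
    have ws: "square_integrable M w" unfolding w_def by (intro square_integrable_diff \<Psi>s us)
    have "l2_norm M (\<lambda>x. u x + \<psi> n x - \<Psi> x) = l2_norm M (\<lambda>x. \<psi> n x - w x)" for n
      by (simp add: w_def algebra_simps)
    then have lw: "(\<lambda>n. l2_norm M (\<lambda>x. \<psi> n x - w x)) \<longlonglongrightarrow> 0" using lim(1) by simp
    have "l2_inner M (grad (\<psi> n)) (grad (\<psi> m)) = - l2_inner M (\<psi> n) (laplacian (\<psi> m))" for n
      using Green_test_fun[OF smooth_fun_C1_on \<psi>, of "\<psi> n" m] \<psi>[of n] by (simp add: test_fun_def l2_inner_def)
    then have "(\<lambda>n. l2_inner M (grad (\<psi> n)) (grad (\<psi> m))) \<longlonglongrightarrow> - l2_inner M w (laplacian (\<psi> m))"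
      using tendsto_minus[OF tendsto_l2_inner_left[OF \<psi>s(1) ws \<psi>s(3) lw]] by simp
    moreover have "(\<lambda>n. l2_inner M (grad (\<psi> n)) (grad (\<psi> m))) \<longlonglongrightarrow> l2_inner M g (grad (\<psi> m))"
      by (rule tendsto_l2_inner_left[OF \<psi>s(2) g \<psi>s(2) lim(2)])
    ultimately have "- l2_inner M w (laplacian (\<psi> m)) = l2_inner M g (grad (\<psi> m))" by (rule LIMSEQ_unique)
    moreover have "l2_inner M u (laplacian (\<psi> m)) = 0"
      using Green_test_fun[OF u(1) \<psi>[of m]] u(2)[OF test_fun_C1_compact[OF \<psi>[of m]]] by (simp add: l2_inner_def)
    moreover have "l2_inner M w (laplacian (\<psi> m)) = l2_inner M \<Psi> (laplacian (\<psi> m)) - l2_inner M u (laplacian (\<psi> m))"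
      unfolding w_def by (rule l2_inner_diff_left[OF \<Psi>s us \<psi>s(3)])
    ultimately show ?thesis by simp
  qed
  have bound: "l2_norm M (\<lambda>x. \<Psi> x - \<psi> m x) \<le> c * l2_norm M (\<lambda>x. grad (\<psi> m) x - g x)" for m
  proof -
    \<comment> \<open>An upper bound for the squared norm of
      \<open>grad (\<xi> k) - grad (\<psi> m)\<close>; by \<open>key\<close> its limit is the
      complete square of \<open>g - grad (\<psi> m)\<close>.\<close>
    let ?E = "\<lambda>k. (l2_norm M g + inverse (real (Suc k)))\<^sup>2 + 2 * l2_inner M (\<xi> k) (laplacian (\<psi> m)) + (l2_norm M (grad (\<psi> m)))\<^sup>2"
    have le: "l2_norm M (\<lambda>x. \<Psi> x - \<psi> m x) \<le> l2_norm M (\<lambda>x. \<xi> k x - \<Psi> x) + c * sqrt (?E k)" for k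
    proof -
      have \<xi>C: "C1_on \<Omega> (\<xi> k)" "\<And>x. \<xi> k differentiable at x"
        using \<xi>(1)[of k] C1_on_subset[of UNIV "\<xi> k" \<Omega>] by (auto simp: C1_compact_def C1_on_def)
      have D: "C1_compact \<Omega> (\<lambda>x. \<xi> k x - \<psi> m x)"
        by (intro C1_compact_diff \<xi> test_fun_C1_compact \<psi>)
      have gr: "grad (\<lambda>x. \<xi> k x - \<psi> m x) = (\<lambda>x. grad (\<xi> k) x - grad (\<psi> m) x)"
        using \<psi>[of m] by (intro ext grad_diff \<xi>C) (simp add: test_fun_def smooth_fun_differentiable)
      have "(l2_norm M (grad (\<lambda>x. \<xi> k x - \<psi> m x)))\<^sup>2
          = (l2_norm M (grad (\<xi> k)))\<^sup>2 - 2 * l2_inner M (grad (\<xi> k)) (grad (\<psi> m)) + (l2_norm M (grad (\<psi> m)))\<^sup>2"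
        unfolding gr l2_norm_power2 using \<xi>s \<psi>s
        by (simp add: l2_inner_diff_left l2_inner_diff_right square_integrable_diff l2_inner_commute[of M "grad (\<psi> m)" "grad (\<xi> k)"])
      also have "l2_inner M (grad (\<xi> k)) (grad (\<psi> m)) = - l2_inner M (\<xi> k) (laplacian (\<psi> m))"
        using Green_test_fun[OF \<xi>C(1) \<psi>] by (simp add: l2_inner_def)
      also have "(l2_norm M (grad (\<xi> k)))\<^sup>2 - 2 * - l2_inner M (\<xi> k) (laplacian (\<psi> m)) + (l2_norm M (grad (\<psi> m)))\<^sup>2 \<le> ?E k"
        using power_mono[OF \<xi>(3) l2_norm_nonneg, of k 2] by simp
      finally have "l2_norm M (grad (\<lambda>x. \<xi> k x - \<psi> m x)) \<le> sqrt (?E k)" by (rule real_le_rsqrt)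
      then have "l2_norm M (\<lambda>x. \<xi> k x - \<psi> m x) \<le> c * sqrt (?E k)"
        using c(2)[OF D] c(1) by (meson mult_left_mono less_imp_le order_trans)
      then show ?thesis
        using l2_norm_triangle_diff[OF \<Psi>s \<xi>s(1)[of k] \<psi>s(1)[of m]] l2_norm_minus_commute[of M \<Psi> "\<xi> k"] by linarith
    qed
    have "(\<lambda>k. l2_norm M (\<lambda>x. \<xi> k x - \<Psi> x) + c * sqrt (?E k))
        \<longlonglongrightarrow> 0 + c * sqrt ((l2_norm M g + 0)\<^sup>2 + 2 * l2_inner M \<Psi> (laplacian (\<psi> m)) + (l2_norm M (grad (\<psi> m)))\<^sup>2)"
      by (intro tendsto_intros \<xi>0 LIMSEQ_inverse_real_of_nat tendsto_l2_inner_left[OF \<xi>s(1) \<Psi>s \<psi>s(3) \<xi>0])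
    from LIMSEQ_le_const[OF this, of "l2_norm M (\<lambda>x. \<Psi> x - \<psi> m x)"] le
    have "l2_norm M (\<lambda>x. \<Psi> x - \<psi> m x) \<le> c * sqrt ((l2_norm M g)\<^sup>2 + 2 * l2_inner M \<Psi> (laplacian (\<psi> m)) + (l2_norm M (grad (\<psi> m)))\<^sup>2)" by auto
    also have "(l2_norm M g)\<^sup>2 + 2 * l2_inner M \<Psi> (laplacian (\<psi> m)) + (l2_norm M (grad (\<psi> m)))\<^sup>2 = (l2_norm M (\<lambda>x. grad (\<psi> m) x - g x))\<^sup>2"
      unfolding l2_norm_power2 key using g \<psi>s
      by (simp add: l2_inner_diff_left l2_inner_diff_right square_integrable_diff l2_inner_commute[of M "grad (\<psi> m)" g])
    finally show ?thesis by simp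
  qed
  \<comment> \<open>Here u is written as (\<Psi> - \<psi> m) + (u + \<psi> m - \<Psi>); both
    summands tend to 0 in L2.\<close>
  have "l2_norm M u \<le> c * l2_norm M (\<lambda>x. grad (\<psi> m) x - g x) + l2_norm M (\<lambda>x. u x + \<psi> m x - \<Psi> x)" for m
    using bound[of m] l2_norm_triangle[of M "\<lambda>x. \<Psi> x - \<psi> m x" "\<lambda>x. u x + \<psi> m x - \<Psi> x"] \<psi>s \<Psi>s us
    by (simp add: square_integrable_diff square_integrable_add)
  moreover have "(\<lambda>m. c * l2_norm M (\<lambda>x. grad (\<psi> m) x - g x) + l2_norm M (\<lambda>x. u x + \<psi> m x - \<Psi> x)) \<longlonglongrightarrow> c * 0 + 0"
    by (intro tendsto_intros lim)
  ultimately have "l2_norm M u \<le> 0" using LIMSEQ_le_const[of _ "c * 0 + 0" "l2_norm M u"] by auto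
  then have "l2_norm M u = 0" using l2_norm_nonneg[of M u] by linarith
  then have "AE x in M. u x = 0" by (rule l2_norm_eq_0_AE[OF us])
  then show ?thesis using AE_zero_imp_zero[OF C1_on_continuous[OF u(1)]] x by blast
qed

text \<open>Subtracting the two decompositions gives one for \<open>\<Phi>1 - \<Phi>2\<close>, which
  vanishes on the frontier; its harmonic part is \<open>u1 - u2\<close>.\<close>

lemma harmonic_part_unique:
  assumes u: "harmonic_on \<Omega> u1" "harmonic_on \<Omega> u2"
    and \<Phi>: "continuous_on (closure \<Omega>) \<Phi>1" "continuous_on (closure \<Omega>) \<Phi>2"
    and b: "\<And>x. x \<in> frontier \<Omega> \<Longrightarrow> \<Phi>1 x = \<Phi>2 x"
    and H: "H1_0 \<Omega> (\<lambda>x. \<Phi>1 x - u1 x)" "H1_0 \<Omega> (\<lambda>x. \<Phi>2 x - u2 x)" and x: "x \<in> \<Omega>"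
  shows "u1 x = u2 x"
proof -
  obtain g1 \<psi>1 where 1: "square_integrable M (\<lambda>x. \<Phi>1 x - u1 x)" "square_integrable M g1" "\<And>n. test_fun \<Omega> (\<psi>1 n)"
    "(\<lambda>n. l2_norm M (\<lambda>x. \<psi>1 n x - (\<Phi>1 x - u1 x))) \<longlonglongrightarrow> 0" "(\<lambda>n. l2_norm M (\<lambda>x. grad (\<psi>1 n) x - g1 x)) \<longlonglongrightarrow> 0"
    using H1_0_D[OF H(1)] by blast
  obtain g2 \<psi>2 where 2: "square_integrable M (\<lambda>x. \<Phi>2 x - u2 x)" "square_integrable M g2" "\<And>n. test_fun \<Omega> (\<psi>2 n)"
    "(\<lambda>n. l2_norm M (\<lambda>x. \<psi>2 n x - (\<Phi>2 x - u2 x))) \<longlonglongrightarrow> 0" "(\<lambda>n. l2_norm M (\<lambda>x. grad (\<psi>2 n) x - g2 x)) \<longlonglongrightarrow> 0"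
    using H1_0_D[OF H(2)] by blast
  note \<Phi>s = square_integrable_continuous_closure[OF \<Phi>(1)] square_integrable_continuous_closure[OF \<Phi>(2)]
  note C = harmonic_on_C1(1)[OF u(1)] harmonic_on_C1(1)[OF u(2)]
  note t1 = test_fun_square_integrable[OF 1(3)] and t2 = test_fun_square_integrable[OF 2(3)]
  \<comment> \<open>Each harmonic function is the difference of a bounded function and a member of
    \<open>H1_0\<close>. This gives square integrability of the function, not of its
    gradient.\<close>
  have us: "square_integrable M u1" "square_integrable M u2"
    using square_integrable_diff[OF \<Phi>s(1) 1(1)] square_integrable_diff[OF \<Phi>s(2) 2(1)] by simp_all
  have d: "u1 differentiable at x" "u2 differentiable at x" if "x \<in> \<Omega>" for x
    using C that by (auto simp: C1_on_def)
  have sum0: "(\<lambda>n. p n) \<longlonglongrightarrow> 0" if "\<And>n. 0 \<le> p n" "\<And>n. p n \<le> q n + r n" "q \<longlonglongrightarrow> 0" "r \<longlonglongrightarrow> 0" for p q r :: "nat \<Rightarrow> real"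
  proof -
    have "(\<lambda>n. q n + r n) \<longlonglongrightarrow> 0 + 0" by (intro tendsto_add that)
    then show ?thesis by (intro Lim_null_comparison[of p "\<lambda>n. q n + r n"]) (use that(1,2) in auto)
  qed
  have "(\<lambda>x. u1 x - u2 x) x = 0"
  proof (rule harmonic_part_zero[where \<Psi>="\<lambda>x. \<Phi>1 x - \<Phi>2 x" and \<psi>="\<lambda>n x. \<psi>1 n x - \<psi>2 n x" and g="\<lambda>x. g1 x - g2 x"])
    show "continuous_on (closure \<Omega>) (\<lambda>x. \<Phi>1 x - \<Phi>2 x)" by (intro continuous_on_diff \<Phi>)
    show "\<Phi>1 x - \<Phi>2 x = 0" if "x \<in> frontier \<Omega>" for x using b[OF that] by simp
    have "C1_on \<Omega> (\<lambda>x. u1 x + (-1) * u2 x)"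
      by (intro C1_on_add C1_on_mult C smooth_fun_C1_on smooth_fun_const)
    then show "C1_on \<Omega> (\<lambda>x. u1 x - u2 x)" by simp
    show "l2_inner M (grad (\<lambda>x. u1 x - u2 x)) (grad w) = 0" if w: "C1_compact \<Omega> w" for w
    proof -
      have I: "integrable M (\<lambda>x. grad f x \<bullet> grad w x)" if "C1_on \<Omega> f" for f
        by (rule integrable_grad_inner[OF that w])
      have "l2_inner M (grad (\<lambda>x. u1 x - u2 x)) (grad w) = (\<integral>x. grad u1 x \<bullet> grad w x - grad u2 x \<bullet> grad w x \<partial>M)"
        unfolding l2_inner_def by (intro Bochner_Integration.integral_cong refl) (simp add: grad_diff d inner_diff_left)
      also have "\<dots> = l2_inner M (grad u1) (grad w) - l2_inner M (grad u2) (grad w)"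
        unfolding l2_inner_def by (intro Bochner_Integration.integral_diff I C)
      finally show ?thesis by (simp add: Green_harmonic[OF u(1) w] Green_harmonic[OF u(2) w])
    qed
    show "square_integrable M (\<lambda>x. u1 x - u2 x)" by (intro square_integrable_diff us)
    show "square_integrable M (\<lambda>x. g1 x - g2 x)" by (intro square_integrable_diff 1 2)
    show "test_fun \<Omega> (\<lambda>x. \<psi>1 n x - \<psi>2 n x)" for n by (intro test_fun_diff 1 2)
    show "(\<lambda>n. l2_norm M (\<lambda>x. u1 x - u2 x + (\<psi>1 n x - \<psi>2 n x) - (\<Phi>1 x - \<Phi>2 x))) \<longlonglongrightarrow> 0"
    proof (rule sum0[OF l2_norm_nonneg _ 1(4) 2(4)])
      fix n
      have "l2_norm M (\<lambda>x. u1 x - u2 x + (\<psi>1 n x - \<psi>2 n x) - (\<Phi>1 x - \<Phi>2 x))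
          = l2_norm M (\<lambda>x. (\<psi>1 n x - (\<Phi>1 x - u1 x)) - (\<psi>2 n x - (\<Phi>2 x - u2 x)))"
        by (simp add: algebra_simps)
      also have "\<dots> \<le> l2_norm M (\<lambda>x. \<psi>1 n x - (\<Phi>1 x - u1 x)) + l2_norm M (\<lambda>x. \<psi>2 n x - (\<Phi>2 x - u2 x))"
        by (rule l2_norm_diff_le) (intro square_integrable_diff t1 t2 \<Phi>s us)+
      finally show "l2_norm M (\<lambda>x. u1 x - u2 x + (\<psi>1 n x - \<psi>2 n x) - (\<Phi>1 x - \<Phi>2 x))
          \<le> l2_norm M (\<lambda>x. \<psi>1 n x - (\<Phi>1 x - u1 x)) + l2_norm M (\<lambda>x. \<psi>2 n x - (\<Phi>2 x - u2 x))" .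
    qed
    show "(\<lambda>n. l2_norm M (\<lambda>x. grad (\<lambda>x. \<psi>1 n x - \<psi>2 n x) x - (g1 x - g2 x))) \<longlonglongrightarrow> 0"
    proof (rule sum0[OF l2_norm_nonneg _ 1(5) 2(5)])
      fix n
      have "l2_norm M (\<lambda>x. grad (\<lambda>x. \<psi>1 n x - \<psi>2 n x) x - (g1 x - g2 x))
          = l2_norm M (\<lambda>x. (grad (\<psi>1 n) x - g1 x) - (grad (\<psi>2 n) x - g2 x))"
        unfolding grad_diff_test_fun[OF 1(3) 2(3)] by (simp add: algebra_simps)
      also have "\<dots> \<le> l2_norm M (\<lambda>x. grad (\<psi>1 n) x - g1 x) + l2_norm M (\<lambda>x. grad (\<psi>2 n) x - g2 x)"
        by (rule l2_norm_diff_le) (intro square_integrable_diff t1 t2 1 2)+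
      finally show "l2_norm M (\<lambda>x. grad (\<lambda>x. \<psi>1 n x - \<psi>2 n x) x - (g1 x - g2 x))
          \<le> l2_norm M (\<lambda>x. grad (\<psi>1 n) x - g1 x) + l2_norm M (\<lambda>x. grad (\<psi>2 n) x - g2 x)" .
    qed
  qed (rule x)
  then show ?thesis by simp
qed

end

section \<open>The theorem\<close>

theorem theorem1p1:
  fixes \<Omega> :: "'a::euclidean_space set" and \<phi> :: "'a \<Rightarrow> real"
  assumes "DIM('a) \<ge> 2" and "bounded \<Omega>" and "connected \<Omega>" and "open \<Omega>"
    and "continuous_on (frontier \<Omega>) \<phi>"
  shows "(\<exists>u \<Phi>. harmonic_on \<Omega> u \<and> continuous_on (closure \<Omega>) \<Phi>
            \<and> (\<forall>x\<in>frontier \<Omega>. \<Phi> x = \<phi> x) \<and> H1_0 \<Omega> (\<lambda>x. \<Phi> x - u x))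
       \<and> (\<forall>u1 u2 \<Phi>1 \<Phi>2. harmonic_on \<Omega> u1 \<and> harmonic_on \<Omega> u2
            \<and> continuous_on (closure \<Omega>) \<Phi>1 \<and> continuous_on (closure \<Omega>) \<Phi>2
            \<and> (\<forall>x\<in>frontier \<Omega>. \<Phi>1 x = \<phi> x) \<and> (\<forall>x\<in>frontier \<Omega>. \<Phi>2 x = \<phi> x)
            \<and> H1_0 \<Omega> (\<lambda>x. \<Phi>1 x - u1 x) \<and> H1_0 \<Omega> (\<lambda>x. \<Phi>2 x - u2 x)
            \<longrightarrow> (\<forall>x\<in>\<Omega>. u1 x = u2 x))"
proof -
  interpret bounded_open \<Omega> by standard (use assms in auto)
  obtain u \<Phi> where "harmonic_on \<Omega> u" "continuous_on (closure \<Omega>) \<Phi>"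
    "\<And>x. x \<in> frontier \<Omega> \<Longrightarrow> \<Phi> x = \<phi> x" "H1_0 \<Omega> (\<lambda>x. \<Phi> x - u x)"
    using harmonic_extension_exists[OF assms(5)] by blast
  moreover have "u1 x = u2 x"
    if "harmonic_on \<Omega> u1 \<and> harmonic_on \<Omega> u2
        \<and> continuous_on (closure \<Omega>) \<Phi>1 \<and> continuous_on (closure \<Omega>) \<Phi>2
        \<and> (\<forall>x\<in>frontier \<Omega>. \<Phi>1 x = \<phi> x) \<and> (\<forall>x\<in>frontier \<Omega>. \<Phi>2 x = \<phi> x)
        \<and> H1_0 \<Omega> (\<lambda>x. \<Phi>1 x - u1 x) \<and> H1_0 \<Omega> (\<lambda>x. \<Phi>2 x - u2 x)" "x \<in> \<Omega>"
    for u1 u2 \<Phi>1 \<Phi>2 x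
    using that by (intro harmonic_part_unique[of u1 u2 \<Phi>1 \<Phi>2 x]) auto
  ultimately show ?thesis by blast
qed

end
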